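(* Let $n\ge 3$ and let $P_0=\{P_1,\dots,P_n,A_1,\dots,A_n\}$ be the double circle on $2n$ points. Let $I'\subseteq\{A_1,\dots,A_n\}$ be arbitrary and set $P=\{P_1,\dots,P_n\}\cup I'$. Then $P$ is universal.
   Context: All point sets are in the plane and in general position (no three collinear). An edge of a point set is a segment with two distinct endpoints in it; a triangulation is a maximal set of pairwise non-crossing edges. For point sets $P,Q$ and a bijection $f:P\to Q$, a compatible triangulation of $(P,Q)$ with respect to $f$ is a pair $(T_P,T_Q)$ of triangulations of $P$ and $Q$ such that $(p,p')\in T_P$ iff $(f(p),f(p'))\in T_Q$. A bijection $f_0$ from the convex hull vertices of $P$ to those of $Q$ is cyclic if for all hull vertices $p_1,p_2$ of $P$, $p_1p_2$ is a hull edge of $P$ iff $f_0(p_1)f_0(p_2)$ is a hull edge of $Q$. A point set $P$ is universal if for every point set $Q$ with $|Q|=|P|$ and every cyclic bijection $f_0$ from the hull vertices of $P$ to those of $Q$, there is a bijection $f:P\to Q$ extending $f_0$ and a compatible triangulation of $(P,Q)$ with respect to $f$. Double circle: let $P_1\dots P_n$ be a regular $n$-gon with center $O$; $A_i$ is the point on the segment from $O$ to the midpoint of $P_iP_{i+1}$ (indices mod $n$) at distance $\varepsilon$ from $P_iP_{i+1}$, with $\varepsilon>0$ small enough that the order type is the same for all $0<\varepsilon'<\varepsilon$. *)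

theory Defs
  imports "HOL-Analysis.Analysis"
begin

(* The Euclidean plane is the type complex. *)

definition point_set :: "complex set \<Rightarrow> bool" where
  "point_set S \<longleftrightarrow> finite S \<and>
     (\<forall>a\<in>S. \<forall>b\<in>S. \<forall>c\<in>S. a \<noteq> b \<and> a \<noteq> c \<and> b \<noteq> c \<longrightarrow> \<not> collinear {a, b, c})"

definition edges :: "complex set \<Rightarrow> complex set set" where
  "edges S = {closed_segment a b | a b. a \<in> S \<and> b \<in> S \<and> a \<noteq> b}"

(* In general position, distinct edges that meet outside a common endpoint
   meet in their relative interiors. *)
definition crosses :: "complex set \<Rightarrow> complex set \<Rightarrow> bool" where
  "crosses s t \<longleftrightarrow> s \<noteq> t \<and> rel_interior s \<inter> rel_interior t \<noteq> {}"

definition noncrossing :: "complex set set \<Rightarrow> bool" where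
  "noncrossing T \<longleftrightarrow> (\<forall>s\<in>T. \<forall>t\<in>T. \<not> crosses s t)"

definition triangulation :: "complex set \<Rightarrow> complex set set \<Rightarrow> bool" where
  "triangulation S T \<longleftrightarrow> T \<subseteq> edges S \<and> noncrossing T \<and>
     (\<forall>T'. T \<subseteq> T' \<and> T' \<subseteq> edges S \<and> noncrossing T' \<longrightarrow> T' = T)"

definition compatible_triangulation ::
  "complex set \<Rightarrow> complex set \<Rightarrow> (complex \<Rightarrow> complex) \<Rightarrow>
   complex set set \<Rightarrow> complex set set \<Rightarrow> bool" where
  "compatible_triangulation P Q f TP TQ \<longleftrightarrow>
     triangulation P TP \<and> triangulation Q TQ \<and>
     (\<forall>p\<in>P. \<forall>p'\<in>P. closed_segment p p' \<in> TP \<longleftrightarrow> closed_segment (f p) (f p') \<in> TQ)"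

definition hull_vertices :: "complex set \<Rightarrow> complex set" where
  "hull_vertices S = {p. p extreme_point_of (convex hull S)}"

definition cyclic_bijection ::
  "complex set \<Rightarrow> complex set \<Rightarrow> (complex \<Rightarrow> complex) \<Rightarrow> bool" where
  "cyclic_bijection P Q f0 \<longleftrightarrow>
     bij_betw f0 (hull_vertices P) (hull_vertices Q) \<and>
     (\<forall>p1\<in>hull_vertices P. \<forall>p2\<in>hull_vertices P.
        closed_segment p1 p2 edge_of (convex hull P) \<longleftrightarrow>
        closed_segment (f0 p1) (f0 p2) edge_of (convex hull Q))"

definition universal :: "complex set \<Rightarrow> bool" where
  "universal P \<longleftrightarrow> point_set P \<and>
     (\<forall>Q f0. point_set Q \<and> card Q = card P \<and> cyclic_bijection P Q f0 \<longrightarrow>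
        (\<exists>f. bij_betw f P Q \<and> (\<forall>p\<in>hull_vertices P. f p = f0 p) \<and>
           (\<exists>TP TQ. compatible_triangulation P Q f TP TQ)))"

(* 1, -1 or 0 according as a, b, c is counterclockwise, clockwise or collinear:
   the sign of the determinant of (b - a, c - a). *)
definition orientation :: "complex \<Rightarrow> complex \<Rightarrow> complex \<Rightarrow> real" where
  "orientation a b c = sgn (Im (cnj (b - a) * (c - a)))"

definition same_order_type :: "complex set \<Rightarrow> complex set \<Rightarrow> bool" where
  "same_order_type S T \<longleftrightarrow> (\<exists>g. bij_betw g S T \<and>
     (\<forall>a\<in>S. \<forall>b\<in>S. \<forall>c\<in>S. orientation (g a) (g b) (g c) = orientation a b c))"

(* Vertices P 1, ..., P n, labelled counterclockwise, of a regular n-gon of arbitrary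
   size and rotation with centre c. *)
definition regular_polygon :: "nat \<Rightarrow> complex \<Rightarrow> (nat \<Rightarrow> complex) \<Rightarrow> bool" where
  "regular_polygon n c P \<longleftrightarrow>
     (\<exists>w. w \<noteq> 0 \<and> (\<forall>i\<in>{1..n}. P i = c + w * cis (2 * pi * real i / real n)))"

(* i mod n + 1 is the cyclic successor of i in {1..n}. *)
definition inner_points ::
  "nat \<Rightarrow> complex \<Rightarrow> (nat \<Rightarrow> complex) \<Rightarrow> real \<Rightarrow> (nat \<Rightarrow> complex) \<Rightarrow> bool" where
  "inner_points n c P \<epsilon> A \<longleftrightarrow> (\<forall>i\<in>{1..n}.
     A i \<in> closed_segment c (midpoint (P i) (P (i mod n + 1))) \<and>
     infdist (A i) (closed_segment (P i) (P (i mod n + 1))) = \<epsilon>)"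

definition double_circle :: "nat \<Rightarrow> (nat \<Rightarrow> complex) \<Rightarrow> (nat \<Rightarrow> complex) \<Rightarrow> bool" where
  "double_circle n P A \<longleftrightarrow> (\<exists>c \<epsilon>. 0 < \<epsilon> \<and> regular_polygon n c P \<and> inner_points n c P \<epsilon> A \<and>
     (\<forall>\<epsilon>' A'. 0 < \<epsilon>' \<and> \<epsilon>' < \<epsilon> \<and> inner_points n c P \<epsilon>' A' \<longrightarrow>
        same_order_type (P ` {1..n} \<union> A ` {1..n}) (P ` {1..n} \<union> A' ` {1..n})))"

end

theory Submission
  imports Defs
begin

text \<open>
  In the double circle every inner point sits just inside its own hull edge, so a triangulation of
  \<open>P\<close> is a combinatorial triangulation of the cyclic sequence of all points along the boundary, plus
  the hull edges that carry an inner point. For \<open>Q\<close> it thus suffices to assign the interior points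
  \<open>q\<^sub>e\<close> bijectively to the corresponding hull edges \<open>e\<close> such that the triangles spanned by \<open>e\<close> and
  \<open>q\<^sub>e\<close> do not overlap. An assignment that minimises the product of the distances \<open>d\<^sub>e(q\<^sub>e)\<close> of the
  points to the lines through their edges has this property: as exchanging two points does not decrease
  the product, for some \<open>t\<close> one triangle lies in the half-plane \<open>d\<^sub>e \<le> t \<cdot> d\<^sub>f\<close> and the other
  one in \<open>d\<^sub>e \<ge> t \<cdot> d\<^sub>f\<close>.

  Take a triangulation of \<open>Q\<close> that contains the sides of these triangles. Two of its edges inside
  the remaining polygon have endpoints that do not interleave along the polygon; otherwise both could
  be prolonged to the hull inside the triangles, and the prolonged curves would have to meet. Moreover
  every edge of a triangulation has a triangle on each side that contains points, and two apexes of
  the same edge on the same boundary arc would give interleaved edges. Hence every diagonal is either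
  present or interleaves with a present one, so the image of the triangulation in \<open>P\<close> is maximal.
\<close>

section \<open>Orientation determinants and barycentric coordinates\<close>

text \<open>The exchange inequality for sides \<open>e\<close>, \<open>f\<close> says that
  \<open>d\<^sub>e / d\<^sub>f\<close> at the point of \<open>e\<close> is at most its value at the
  point of \<open>f\<close>; any \<open>t\<close> between the two values separates the triangles.
  Exchanges of two points are all that is used of minimality.

  The polygon that remains in \<open>Q\<close> is not convex, so the order of its vertices cannot be
  read off orientations. Prolonging the edges to the midpoints of the sides moves their ends to a
  convex curve, where crossing chords are visible from orientations, and Fashoda's theorem carries
  this over to the curves. The price is that the three labels of a side become collinear; hull edges
  over an attached point therefore need separate treatment.

  Which geometric side of an edge belongs to which arc of labels is never determined: there is an
  apex on either side, and it suffices that both cannot lie on the outer arc. No edges or triangles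
  are counted, because triangulations are defined by maximality.

  In \<open>P\<close>, an equivalence of order types may permute the points, so it does not
  transport labelled orientations. These come from a continuous motion that stays in general
  position.\<close>

definition det3 :: "complex \<Rightarrow> complex \<Rightarrow> complex \<Rightarrow> real" where
  "det3 a b c = (Re b - Re a) * (Im c - Im a) - (Im b - Im a) * (Re c - Re a)"

lemma orientation_det3: "orientation a b c = sgn (det3 a b c)"
  by (simp add: orientation_def det3_def algebra_simps)

lemma det3_rotate: "det3 b c a = det3 a b c"
  by (simp add: det3_def algebra_simps)

lemma det3_rotate2: "det3 c a b = det3 a b c"
  by (simp add: det3_def algebra_simps)

lemmas det3_cyclic = det3_rotate det3_rotate2

lemma det3_swap: "det3 b a c = - det3 a b c"
  by (simp add: det3_def algebra_simps)

lemma det3_swap2: "det3 a c b = - det3 a b c"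
  by (simp add: det3_def algebra_simps)

lemma det3_degenerate [simp]: "det3 a a c = 0" "det3 a b a = 0" "det3 a b b = 0"
  by (simp_all add: det3_def)

lemma det3_affine:
  "det3 a b ((1 - u) *\<^sub>R x + u *\<^sub>R y) = (1 - u) * det3 a b x + u * det3 a b y"
  by (simp add: det3_def algebra_simps)

lemma det3_affine1:
  "det3 ((1 - u) *\<^sub>R x + u *\<^sub>R y) a b = (1 - u) * det3 x a b + u * det3 y a b"
  by (simp add: det3_def algebra_simps)

lemma det3_sum: "det3 x b c + det3 a x c + det3 a b x = det3 a b c"
  by (simp add: det3_def algebra_simps)

lemma det3_sum3:
  assumes "u + v + w = 1"
  shows "det3 a b (u *\<^sub>R x + v *\<^sub>R y + w *\<^sub>R z) = u * det3 a b x + v * det3 a b y + w * det3 a b z"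
proof -
  have u: "u = 1 - v - w" using assms by simp
  show ?thesis unfolding u by (simp add: det3_def algebra_simps)
qed

text \<open>The three-term Grassmann-Pluecker relation. It propagates convexity from consecutive
  vertices to arbitrary triples in \<open>convex_polygon_if_edges\<close>.\<close>

lemma det3_plucker:
  "det3 o' p b * det3 o' a c = det3 o' p a * det3 o' b c + det3 o' p c * det3 o' a b"
  by (simp add: det3_def algebra_simps)

lemma collinear_iff_det3: "collinear {a, b, c} \<longleftrightarrow> det3 a b c = 0"
proof -
  have "collinear {a,b,c} \<longleftrightarrow> collinear {b,a,c}" by (simp add: insert_commute)
  also have "\<dots> \<longleftrightarrow> collinear {0, b - a, c - a}"
    by (subst collinear_3) (auto simp: collinear_lemma intro: exI[of _ "- _"])
  also have "\<dots> \<longleftrightarrow> det3 a b c = 0"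
  proof (cases "b = a")
    case False
    define d where "d = b - a"
    define e where "e = c - a"
    have d0: "d \<noteq> 0" using False d_def by simp
    have "collinear {0, d, e} \<longleftrightarrow> e / d \<in> \<real>" by (rule collinear_iff_Reals)
    also have "\<dots> \<longleftrightarrow> Im (e / d) = 0" by (simp add: complex_is_Real_iff)
    also have "\<dots> \<longleftrightarrow> Im e * Re d - Re e * Im d = 0"
      using d0 by (auto simp: Im_divide complex_eq_iff sum_power2_eq_zero_iff)
    also have "\<dots> \<longleftrightarrow> det3 a b c = 0"
      by (simp add: det3_def d_def e_def algebra_simps)
    finally show ?thesis by (simp add: d_def e_def)
  qed simp
  finally show ?thesis .
qed

lemma det3_closed_segment_0: "x \<in> closed_segment a b \<Longrightarrow> det3 a b x = 0"
  by (auto simp: in_segment det3_affine)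

lemma det3_closed_segment_nonneg:
  assumes "x \<in> closed_segment c d" "s * det3 a b c \<ge> 0" "s * det3 a b d \<ge> 0"
  shows "s * det3 a b x \<ge> 0"
proof -
  obtain u where u: "0 \<le> u" "u \<le> 1" "x = (1 - u) *\<^sub>R c + u *\<^sub>R d"
    using assms by (auto simp: in_segment)
  have "s * det3 a b x = (1 - u) * (s * det3 a b c) + u * (s * det3 a b d)"
    unfolding u(3) det3_affine by (simp add: algebra_simps)
  then show ?thesis using u assms by simp
qed

lemma det3_open_segment_pos:
  assumes "x \<in> open_segment c d" "s * det3 a b c \<ge> 0" "s * det3 a b d > 0"
  shows "s * det3 a b x > 0"
proof -
  obtain u where u: "0 < u" "u < 1" "x = (1 - u) *\<^sub>R c + u *\<^sub>R d"
    using assms by (auto simp: in_segment)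
  have "s * det3 a b x = (1 - u) * (s * det3 a b c) + u * (s * det3 a b d)"
    unfolding u(3) det3_affine by (simp add: algebra_simps)
  then show ?thesis using u assms by (simp add: add_nonneg_pos)
qed

text \<open>The barycentric coordinate of \<open>x\<close> at the first vertex \<open>a\<close>;
  rotating the triple gives the other two coordinates.\<close>

definition bary :: "complex \<Rightarrow> complex \<Rightarrow> complex \<Rightarrow> complex \<Rightarrow> real" where
  "bary a b c x = det3 x b c / det3 a b c"

lemma bary_affine:
  "bary a b c ((1 - u) *\<^sub>R x + u *\<^sub>R y) = (1 - u) * bary a b c x + u * bary a b c y"
  by (simp add: bary_def det3_affine1 add_divide_distrib)

lemma bary_sum:
  assumes "det3 a b c \<noteq> 0"
  shows "bary a b c x + bary b c a x + bary c a b x = 1"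
proof -
  have "bary a b c x + bary b c a x + bary c a b x
      = (det3 x b c + det3 a x c + det3 a b x) / det3 a b c"
    by (simp add: bary_def det3_rotate[of b c a] det3_rotate[of a b c, symmetric]
        det3_rotate[of x c a] det3_rotate[of x a b, symmetric] add_divide_distrib)
       (simp add: det3_rotate)
  then show ?thesis using assms by (simp add: det3_sum)
qed

lemma bary_vertex [simp]:
  assumes "det3 a b c \<noteq> 0"
  shows "bary a b c a = 1" "bary a b c b = 0" "bary a b c c = 0"
  using assms by (simp_all add: bary_def det3_rotate)

lemma bary_expand:
  assumes "det3 a b c \<noteq> 0"
  shows "x = bary a b c x *\<^sub>R a + bary b c a x *\<^sub>R b + bary c a b x *\<^sub>R c"
proof -
  have r: "det3 b c a = det3 a b c" "det3 c a b = det3 a b c" by (simp_all add: det3_cyclic)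
  have "det3 a b c *\<^sub>R x = det3 x b c *\<^sub>R a + det3 x c a *\<^sub>R b + det3 x a b *\<^sub>R c"
    by (simp add: complex_eq_iff det3_def algebra_simps)
  then have "x = (1 / det3 a b c) *\<^sub>R (det3 x b c *\<^sub>R a + det3 x c a *\<^sub>R b + det3 x a b *\<^sub>R c)"
    using assms by (metis divide_self inverse_eq_divide left_inverse scaleR_one scaleR_scaleR)
  then show ?thesis by (simp add: bary_def r scaleR_add_right)
qed

lemma bary_unique:
  assumes "det3 a b c \<noteq> 0" "u + v + w = 1"
  shows "bary a b c (u *\<^sub>R a + v *\<^sub>R b + w *\<^sub>R c) = u"
proof -
  have "det3 b c (u *\<^sub>R a + v *\<^sub>R b + w *\<^sub>R c) = u * det3 b c a"
    using det3_sum3[OF assms(2)] by simp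
  then show ?thesis using assms by (simp add: bary_def det3_rotate)
qed

lemma mem_triangle_iff:
  assumes "det3 a b c \<noteq> 0"
  shows "x \<in> convex hull {a, b, c} \<longleftrightarrow>
    bary a b c x \<ge> 0 \<and> bary b c a x \<ge> 0 \<and> bary c a b x \<ge> 0"
proof
  assume "x \<in> convex hull {a, b, c}"
  then obtain u v w where *: "0 \<le> u" "0 \<le> v" "0 \<le> w" "u + v + w = 1" "x = u *\<^sub>R a + v *\<^sub>R b + w *\<^sub>R c"
    by (auto simp: convex_hull_3)
  have "det3 b c a \<noteq> 0" "det3 c a b \<noteq> 0" using assms by (simp_all add: det3_cyclic)
  moreover have "x = v *\<^sub>R b + w *\<^sub>R c + u *\<^sub>R a" "x = w *\<^sub>R c + u *\<^sub>R a + v *\<^sub>R b" using * by simp_all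
  ultimately have "bary a b c x = u" "bary b c a x = v" "bary c a b x = w"
    using * bary_unique[of a b c u v w] bary_unique[of b c a v w u] bary_unique[of c a b w u v] assms
    by (simp_all add: add.commute add.left_commute)
  then show "bary a b c x \<ge> 0 \<and> bary b c a x \<ge> 0 \<and> bary c a b x \<ge> 0" using * by simp
next
  assume "bary a b c x \<ge> 0 \<and> bary b c a x \<ge> 0 \<and> bary c a b x \<ge> 0"
  then show "x \<in> convex hull {a, b, c}"
    using bary_expand[OF assms, of x] bary_sum[OF assms, of x] by (force simp: convex_hull_3)
qed

lemma triangle_side:
  assumes "det3 a b c \<noteq> 0" "x \<in> convex hull {a, b, c}" "bary a b c x = 0"
  shows "x \<in> closed_segment b c"
proof -
  have "bary b c a x + bary c a b x = 1" "bary c a b x \<ge> 0" "bary b c a x \<ge> 0"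
    using bary_sum[OF assms(1), of x] assms mem_triangle_iff[OF assms(1), of x] by auto
  moreover have "x = bary b c a x *\<^sub>R b + bary c a b x *\<^sub>R c"
    using bary_expand[OF assms(1), of x] assms(3) by simp
  moreover have "bary b c a x = 1 - bary c a b x" using calculation by simp
  ultimately show ?thesis unfolding in_segment(1) by (smt (verit, best))
qed

text \<open>\<open>u\<close> and \<open>g\<close> are the values of affine functions at the ends of
  a segment. A function with negative end value vanishes at \<open>u i / (u i - g i)\<close>; at the
  least of these times the first function reaches zero and none is negative yet.\<close>

lemma affine_exit_param:
  fixes u g :: "'i \<Rightarrow> real"
  assumes "finite I" "\<And>i. i \<in> I \<Longrightarrow> u i \<ge> 0" "\<exists>i\<in>I. g i < 0"
  obtains t i where "0 \<le> t" "t \<le> 1" "i \<in> I" "g i < 0" "(1 - t) * u i + t * g i = 0"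
    "\<And>j. j \<in> I \<Longrightarrow> (1 - t) * u j + t * g j \<ge> 0"
proof -
  define r where "r = (\<lambda>i. u i / (u i - g i))"
  have "finite {i \<in> I. g i < 0}" "{i \<in> I. g i < 0} \<noteq> {}" using assms by auto
  then obtain i where i: "i \<in> I" "g i < 0" and min: "\<And>j. j \<in> I \<Longrightarrow> g j < 0 \<Longrightarrow> r i \<le> r j"
    using ex_is_arg_min_if_finite[of "{i \<in> I. g i < 0}" r] by (auto simp: is_arg_min_linorder)
  have ui: "u i \<ge> 0" "u i - g i > 0" using assms(2)[OF i(1)] i(2) by auto
  show thesis
  proof (rule that[of "r i" i])
    show "0 \<le> r i" "r i \<le> 1" using ui i by (auto simp: r_def divide_simps)
    show "(1 - r i) * u i + r i * g i = 0" using ui by (simp add: r_def divide_simps algebra_simps)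
    fix j assume j: "j \<in> I"
    show "(1 - r i) * u j + r i * g j \<ge> 0"
    proof (cases "g j < 0")
      case True
      have uj: "u j - g j > 0" using assms(2)[OF j] True by simp
      have "r i * (u j - g j) \<le> r j * (u j - g j)" using min[OF j True] uj by simp
      also have "\<dots> = u j" using uj by (simp add: r_def)
      finally show ?thesis by (simp add: algebra_simps)
    next
      case False
      then show ?thesis using assms(2)[OF j] \<open>0 \<le> r i\<close> \<open>r i \<le> 1\<close> by simp
    qed
  qed (use i in auto)
qed

text \<open>The exit parameter is applied to the three barycentric coordinates. The sign at
  \<open>g\<close> is recorded because it excludes an exit through a side when \<open>g\<close> is
  known not to lie beyond that side.\<close>

lemma triangle_exit:
  assumes D: "det3 a b c \<noteq> 0" and u: "u \<in> convex hull {a, b, c}" and g: "g \<notin> convex hull {a, b, c}"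
  obtains p where "p \<in> closed_segment u g"
    "(p \<in> closed_segment b c \<and> bary a b c g < 0) \<or>
     (p \<in> closed_segment c a \<and> bary b c a g < 0) \<or>
     (p \<in> closed_segment a b \<and> bary c a b g < 0)"
proof -
  define f where "f = (\<lambda>i x. if i = (0::nat) then bary a b c x else if i = 1 then bary b c a x else bary c a b x)"
  have I: "{..<3} = {0, 1, 2::nat}" by auto
  have "\<And>i. i \<in> {..<3} \<Longrightarrow> f i u \<ge> 0" using u mem_triangle_iff[OF D] by (auto simp: f_def)
  moreover have "\<exists>i\<in>{..<3}. f i g < 0" using g mem_triangle_iff[OF D, of g] unfolding I
    by (auto simp: f_def)
  ultimately obtain t i where t: "0 \<le> t" "t \<le> 1" and i: "i \<in> {..<3}" "f i g < 0"
    "(1 - t) * f i u + t * f i g = 0" and nn: "\<And>j. j \<in> {..<3} \<Longrightarrow> (1 - t) * f j u + t * f j g \<ge> 0"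
    using affine_exit_param[of "{..<3::nat}" "\<lambda>i. f i u" "\<lambda>i. f i g"] by auto
  define p where "p = (1 - t) *\<^sub>R u + t *\<^sub>R g"
  have fp: "f j p = (1 - t) * f j u + t * f j g" for j
    by (simp add: f_def p_def bary_affine)
  have D': "det3 b c a \<noteq> 0" "det3 c a b \<noteq> 0" using D by (simp_all add: det3_cyclic)
  have pin: "p \<in> convex hull {a, b, c}"
    using nn[of 0] nn[of 1] nn[of 2] fp[of 0] fp[of 1] fp[of 2] unfolding mem_triangle_iff[OF D]
    by (simp add: f_def)
  have "p \<in> convex hull {b, c, a}" "p \<in> convex hull {c, a, b}"
    using pin by (simp_all add: insert_commute)
  then have "(p \<in> closed_segment b c \<and> bary a b c g < 0) \<or>
     (p \<in> closed_segment c a \<and> bary b c a g < 0) \<or>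
     (p \<in> closed_segment a b \<and> bary c a b g < 0)"
    using triangle_side[OF D pin] triangle_side[OF D'(1), of p] triangle_side[OF D'(2), of p] i fp[of i]
    unfolding I by (auto simp: f_def)
  moreover have "p \<in> closed_segment u g" using t unfolding in_segment p_def by auto
  ultimately show thesis using that by blast
qed

section \<open>Maximal sets of non-crossing edges\<close>

lemma point_set_det3:
  "\<lbrakk>point_set S; a \<in> S; b \<in> S; c \<in> S; a \<noteq> b; a \<noteq> c; b \<noteq> c\<rbrakk> \<Longrightarrow> det3 a b c \<noteq> 0"
  unfolding point_set_def collinear_iff_det3 by blast

lemma point_set_closed_segment:
  assumes "point_set S" "a \<in> S" "b \<in> S" "x \<in> S" "a \<noteq> b" "x \<in> closed_segment a b"
  shows "x = a \<or> x = b"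
  using point_set_det3[OF assms(1-4)] assms(5) det3_closed_segment_0[OF assms(6)] by metis

lemma point_set_open_segment:
  assumes "point_set S" "a \<in> S" "b \<in> S" "x \<in> S"
  shows "x \<notin> open_segment a b"
  using point_set_closed_segment[OF assms] by (cases "a = b") (auto simp: open_segment_def)

lemma closed_segment_in_edges_iff:
  "closed_segment a b \<in> edges S \<longleftrightarrow> a \<in> S \<and> b \<in> S \<and> a \<noteq> b"
  unfolding edges_def by (auto simp: doubleton_eq_iff)

lemma finite_edges: "finite S \<Longrightarrow> finite (edges S)"
proof -
  assume "finite S"
  moreover have "edges S \<subseteq> (\<lambda>(x, y). closed_segment x y) ` (S \<times> S)" by (auto simp: edges_def)
  ultimately show ?thesis by (meson finite_SigmaI finite_imageI finite_subset)
qed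

lemma closed_segment_antisym:
  fixes a b c :: complex
  shows "a \<in> closed_segment b c \<Longrightarrow> b \<in> closed_segment a c \<Longrightarrow> a = b"
  using between_antisym[of b c a] by (simp add: between_mem_segment)

lemma crosses_segments:
  assumes "a \<noteq> b" "c \<noteq> d"
  shows "crosses (closed_segment a b) (closed_segment c d) \<longleftrightarrow>
    {a, b} \<noteq> {c, d} \<and> open_segment a b \<inter> open_segment c d \<noteq> {}"
  using assms by (simp add: crosses_def rel_interior_closed_segment)

text \<open>If the common point is interior to both edges, they coincide. Otherwise it is an
  endpoint of one of them, hence a point of \<open>S\<close>, and general position makes it an
  endpoint of the other.\<close>

lemma noncrossing_meet:
  assumes S: "point_set S" and T: "T \<subseteq> edges S" "noncrossing T"
    and ab: "closed_segment a b \<in> T" "p \<in> closed_segment a b"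
    and cd: "closed_segment c d \<in> T" "p \<in> closed_segment c d"
  shows "{a, b} = {c, d} \<or> (p \<in> {a, b} \<and> p \<in> {c, d})"
proof -
  have m: "a \<in> S" "b \<in> S" "a \<noteq> b" "c \<in> S" "d \<in> S" "c \<noteq> d"
    using ab cd T closed_segment_in_edges_iff by blast+
  have "\<not> crosses (closed_segment a b) (closed_segment c d)"
    using T(2) ab cd by (auto simp: noncrossing_def)
  then have n: "{a, b} = {c, d} \<or> p \<notin> open_segment a b \<or> p \<notin> open_segment c d"
    using crosses_segments[OF m(3,6)] by blast
  show ?thesis
    using n ab(2) cd(2) m point_set_closed_segment[OF S m(1,2) _ m(3), of p]
      point_set_closed_segment[OF S m(4,5) _ m(6), of p]
    by (auto simp: open_segment_def)
qed

lemma triangulation_maximal: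
  assumes T: "triangulation S T" and xy: "x \<in> S" "y \<in> S" "x \<noteq> y"
    and nc: "\<And>c d u. \<lbrakk>closed_segment c d \<in> T; {c, d} \<noteq> {x, y}; u \<in> open_segment x y; u \<in> open_segment c d\<rbrakk> \<Longrightarrow> False"
  shows "closed_segment x y \<in> T"
proof -
  let ?T = "insert (closed_segment x y) T"
  have sub: "T \<subseteq> edges S" and ncr: "noncrossing T" using T by (auto simp: triangulation_def)
  have e: "closed_segment x y \<in> edges S" using xy by (simp add: closed_segment_in_edges_iff)
  have no: "\<not> crosses (closed_segment x y) t" "\<not> crosses t (closed_segment x y)" if t: "t \<in> T" for t
  proof -
    obtain c d where cd: "t = closed_segment c d" "c \<noteq> d" using sub t by (auto simp: edges_def)
    have "{c, d} = {x, y} \<or> open_segment x y \<inter> open_segment c d = {}"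
      using nc[of c d] t cd by blast
    then show "\<not> crosses (closed_segment x y) t" "\<not> crosses t (closed_segment x y)"
      using crosses_segments[OF xy(3) cd(2)] crosses_segments[OF cd(2) xy(3)] cd(1) by auto
  qed
  have "\<not> crosses (closed_segment x y) (closed_segment x y)" by (simp add: crosses_def)
  then have "noncrossing ?T" using ncr no by (auto simp: noncrossing_def)
  then have "?T = T" using T sub e unfolding triangulation_def by blast
  then show ?thesis by blast
qed

lemma open_segment_det3_opposite:
  assumes S: "point_set S" "a \<in> S" "b \<in> S" "c \<in> S" "d \<in> S" "a \<noteq> b" "c \<noteq> d"
    and u: "u \<in> open_segment a b" "u \<in> open_segment c d" and ne: "{a, b} \<noteq> {c, d}"
  shows "a \<notin> {c, d}" "b \<notin> {c, d}" "det3 a b c * det3 a b d < 0"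
proof -
  have u0: "det3 a b u = 0" "det3 c d u = 0"
    using u det3_closed_segment_0[of u a b] det3_closed_segment_0[of u c d] by (auto simp: open_segment_def)
  obtain t where t: "0 < t" "t < 1" "u = (1 - t) *\<^sub>R c + t *\<^sub>R d" using u by (auto simp: in_segment)
  have eq: "(1 - t) * det3 a b c + t * det3 a b d = 0" using u0 t det3_affine by metis
  have c0: "det3 a b c \<noteq> 0 \<or> det3 a b d \<noteq> 0"
    using point_set_det3[OF S(1-4)] point_set_det3[OF S(1-3,5)] ne S(6,7) by (metis insert_commute)
  then have both: "det3 a b c \<noteq> 0 \<and> det3 a b d \<noteq> 0" using eq t by auto
  then show "a \<notin> {c, d}" "b \<notin> {c, d}" by auto
  have "det3 a b c * ((1 - t) * det3 a b c + t * det3 a b d) = 0" using eq by simp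
  then have "t * (det3 a b c * det3 a b d) = - ((1 - t) * (det3 a b c)\<^sup>2)"
    by (simp add: algebra_simps power2_eq_square)
  also have "\<dots> < 0" using t both by simp
  finally show "det3 a b c * det3 a b d < 0" using t by (simp add: mult_less_0_iff)
qed

lemma mem_edge_iff:
  assumes "point_set S" "T \<subseteq> edges S" "closed_segment c d \<in> T" "a \<in> S"
  shows "a \<in> closed_segment c d \<longleftrightarrow> a \<in> {c, d}"
proof -
  have "c \<in> S" "d \<in> S" "c \<noteq> d" using assms closed_segment_in_edges_iff by blast+
  then show ?thesis using point_set_closed_segment[of S c d a] assms by auto
qed

section \<open>Triangles next to an edge of a triangulation\<close>

lemma dot_det3:
  "((b - a) \<bullet> (c - a)) * det3 a b d - det3 a b c * ((b - a) \<bullet> (d - a)) = (norm (b - a))\<^sup>2 * det3 a c d"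
  unfolding det3_def inner_complex_def cmod_power2 by (simp add: power2_eq_square algebra_simps)

text \<open>Up to the factor \<open>t\<close>, the quotient of inner product and determinant is the
  cotangent of the angle at \<open>a\<close> from \<open>b\<close> to \<open>c\<close>. Its maximum
  is attained at the first point in angular order, and \<open>dot_det3\<close> turns a comparison of
  cotangents into an orientation.\<close>

lemma angular_first:
  assumes "finite N" "N \<noteq> {}" and pos: "\<And>c. c \<in> N \<Longrightarrow> t * det3 a b c > 0"
  obtains c where "c \<in> N" "\<And>d. d \<in> N \<Longrightarrow> t * det3 a c d \<ge> 0"
proof -
  define f where "f = (\<lambda>c. - ((b - a) \<bullet> (c - a)) / (t * det3 a b c))"
  obtain c where c: "c \<in> N" and min: "\<And>x. x \<in> N \<Longrightarrow> f c \<le> f x"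
    using ex_is_arg_min_if_finite[of N f] assms by (auto simp: is_arg_min_linorder)
  have "t * det3 a c d \<ge> 0" if d: "d \<in> N" for d
  proof -
    have "a \<noteq> b" using pos[OF c] by auto
    have "((b - a) \<bullet> (d - a)) / (t * det3 a b d) \<le> ((b - a) \<bullet> (c - a)) / (t * det3 a b c)"
      using min[OF d] by (simp add: f_def)
    then have "((b - a) \<bullet> (d - a)) * (t * det3 a b c) \<le> ((b - a) \<bullet> (c - a)) * (t * det3 a b d)"
      using pos[OF c] pos[OF d] by (simp only: pos_divide_le_eq pos_le_divide_eq times_divide_eq_left)
    then have "0 \<le> t * (((b - a) \<bullet> (c - a)) * det3 a b d - det3 a b c * ((b - a) \<bullet> (d - a)))"
      by (simp add: algebra_simps)
    then have "0 \<le> (norm (b - a))\<^sup>2 * (t * det3 a c d)" unfolding dot_det3 by (simp add: mult_ac)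
    then show ?thesis using \<open>a \<noteq> b\<close> by (simp add: zero_le_mult_iff)
  qed
  then show thesis using that c by blast
qed

text \<open>If \<open>a z\<close> is not an edge, something blocks the view from \<open>a\<close> to
  \<open>z\<close>. Near the first obstacle there is a point of \<open>S\<close> that
  \<open>a\<close> sees without obstruction, and maximality makes the connection to it an
  edge.\<close>

lemma triangulation_left_neighbour:
  assumes S: "point_set S" and T: "triangulation S T"
    and a: "a \<in> S" and b: "b \<in> S" and z: "z \<in> S" "det3 a b z > 0"
  shows "\<exists>c\<in>S. closed_segment a c \<in> T \<and> det3 a b c > 0"
proof (cases "closed_segment a z \<in> T")
  case True
  then show ?thesis using z by blast
next
  case False
  have sub: "T \<subseteq> edges S" and ncr: "noncrossing T" using T by (auto simp: triangulation_def)
  have finT: "finite T" using sub finite_edges[of S] S by (auto simp: point_set_def intro: finite_subset)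
  have az: "a \<noteq> z" using z by auto
  \<comment> \<open>These are the points of \<open>a z\<close> on edges that avoid \<open>a\<close>.
    For the one closest to \<open>a\<close>, called \<open>w\<close>, no such edge meets the segment
    from \<open>a\<close> to \<open>w\<close> before \<open>w\<close>.\<close>
  define U where "U = \<Union>{t \<in> T. a \<notin> t} \<inter> closed_segment a z"
  have "\<exists>c d u. closed_segment c d \<in> T \<and> {c, d} \<noteq> {a, z} \<and> u \<in> open_segment a z \<and> u \<in> open_segment c d"
    using triangulation_maximal[OF T a z(1) az] False by blast
  then obtain c0 d0 u0 where c0: "closed_segment c0 d0 \<in> T" "{c0, d0} \<noteq> {a, z}"
    "u0 \<in> open_segment a z" "u0 \<in> open_segment c0 d0" by blast
  have "c0 \<in> S" "d0 \<in> S" "c0 \<noteq> d0" using c0(1) sub closed_segment_in_edges_iff by blast+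
  then have "a \<notin> {c0, d0}"
    using open_segment_det3_opposite[OF S a z(1) _ _ az _ c0(3,4)] c0(2) by auto
  then have "a \<notin> closed_segment c0 d0" using mem_edge_iff[OF S sub c0(1) a] by simp
  then have u0U: "u0 \<in> U" using c0 unfolding U_def by (auto simp: open_segment_def)
  have "compact U" unfolding U_def
    using sub finT by (intro compact_Int_closed compact_Union) (auto simp: edges_def)
  then obtain w where w: "w \<in> U" "\<And>y. y \<in> U \<Longrightarrow> dist a w \<le> dist a y"
    using distance_attains_inf[of U a] u0U by (metis compact_imp_closed empty_iff)
  obtain t where t: "t \<in> T" "a \<notin> t" "w \<in> t" using w unfolding U_def by blast
  obtain d' e' where de': "t = closed_segment d' e'" "d' \<in> S" "e' \<in> S" "d' \<noteq> e'"
    using t(1) sub by (auto simp: edges_def)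
  have "dist a u0 < dist a z"
    using c0(3) dist_in_open_segment[of u0 a z] by (simp add: dist_commute)
  then have wz: "w \<noteq> z" using w(2)[OF u0U] by auto
  have wa: "w \<noteq> a" using t by auto
  have wo: "w \<in> open_segment a z" using w(1) wz wa unfolding U_def by (auto simp: open_segment_def)
  then obtain s where s: "0 < s" "s < 1" "w = (1 - s) *\<^sub>R a + s *\<^sub>R z" by (auto simp: in_segment)
  have wS: "w \<notin> S" using point_set_open_segment[OF S a z(1)] wo by blast
  have abw: "det3 a b w > 0" using det3_open_segment_pos[OF wo, of 1 a b] z by simp
  obtain d e where de: "t = closed_segment d e" "d \<in> S" "e \<in> S" "d \<noteq> e" "det3 a b e > 0"
  proof (cases "det3 a b e' > 0")
    case True then show thesis using that de' by blast
  next
    case False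
    have "det3 a b d' > 0"
    proof (rule ccontr)
      assume "\<not> ?thesis"
      then have "(-1) * det3 a b w \<ge> 0" using False t(3) de'(1)
        by (intro det3_closed_segment_nonneg[of w d' e']) auto
      then show False using abw by simp
    qed
    then show thesis using that de' closed_segment_commute by metis
  qed
  have wde: "w \<in> open_segment d e" using t de wS by (auto simp: open_segment_def)
  have ade: "a \<noteq> d" "a \<noteq> e" using t(2) de(1) by auto
  have deaz: "{d, e} \<noteq> {a, z}" using ade by auto
  have opp: "a \<notin> {d, e}" "z \<notin> {d, e}" "det3 a z d * det3 a z e < 0"
    using open_segment_det3_opposite[OF S a z(1) de(2,3) az de(4) wo wde] deaz by auto
  have aw: "det3 a w x = s * det3 a z x" for x
    using det3_affine1[of s a z x a] unfolding s(3) by (simp add: det3_cyclic)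
  have D: "det3 a w e \<noteq> 0" using aw s opp by auto
  have D': "det3 w e a \<noteq> 0" "det3 e a w \<noteq> 0" using D by (simp_all add: det3_cyclic)
  define t0 where "t0 = det3 a w e"
  have t0: "t0 * det3 a w x = t0\<^sup>2 * bary e a w x" "t0 * det3 a x e = t0\<^sup>2 * bary w e a x" for x
    using D by (simp_all add: t0_def bary_def power2_eq_square det3_cyclic)
  \<comment> \<open>The neighbour will be the first point \<open>c\<close> of this triangle when
    turning around \<open>a\<close> from \<open>w\<close> towards \<open>e\<close>. An edge crossing
    \<open>a c\<close> has an endpoint outside the triangle on the \<open>w\<close> side of
    \<open>a c\<close>, so it must leave through \<open>w e\<close>, \<open>e a\<close> or
    \<open>a w\<close>, and each is impossible.\<close>
  define C where "C = {x \<in> S. x \<noteq> a \<and> x \<in> convex hull {a, w, e}}"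
  have Cpos: "t0 * det3 a w x > 0" if x: "x \<in> C" for x
  proof -
    have "bary e a w x \<noteq> 0"
    proof
      assume "bary e a w x = 0"
      then have "x \<in> closed_segment a w" using triangle_side[OF D'(2), of x] x by (simp add: C_def insert_commute)
      moreover have "closed_segment a w \<subseteq> closed_segment a z"
        using wo by (auto simp: open_segment_def subset_closed_segment)
      moreover have "z \<notin> closed_segment a w"
        using wo wz closed_segment_antisym[of z w a] by (auto simp: open_segment_def closed_segment_commute)
      ultimately show False using point_set_closed_segment[OF S a z(1) _ az, of x] x by (auto simp: C_def)
    qed
    then have "bary e a w x > 0" using x mem_triangle_iff[OF D, of x] by (simp add: C_def)
    then show ?thesis unfolding t0(1) using D by (simp add: t0_def)
  qed
  have "finite C" using S by (simp add: C_def point_set_def)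
  moreover have eC: "e \<in> C" using de ade hull_inc[of e "{a,w,e}" convex] by (auto simp: C_def)
  ultimately obtain c where c: "c \<in> C" and first: "\<And>x. x \<in> C \<Longrightarrow> t0 * det3 a c x \<ge> 0"
    using angular_first[of C t0 a w] Cpos by blast
  have cS: "c \<in> S" "c \<noteq> a" "c \<in> convex hull {a, w, e}" using c by (auto simp: C_def)
  have nn: "bary a w e c \<ge> 0" "bary w e a c \<ge> 0" using cS(3) mem_triangle_iff[OF D] by auto
  have gc: "bary e a w c > 0" using Cpos[OF c] unfolding t0(1) by (simp add: zero_less_mult_iff)
  have "det3 a b c = bary w e a c * det3 a b w + bary e a w c * det3 a b e"
    using det3_sum3[OF bary_sum[OF D, of c], of a b a w e] arg_cong[OF bary_expand[OF D, of c], of "det3 a b"] by simp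
  then have left: "det3 a b c > 0" using nn(2) gc abw de(5) by (simp add: add_nonneg_pos)
  have "closed_segment a c \<in> T"
  proof (rule triangulation_maximal[OF T a cS(1) cS(2)[symmetric]])
    fix c1 d1 u
    assume c1: "closed_segment c1 d1 \<in> T" and ne: "{c1, d1} \<noteq> {a, c}"
      and u: "u \<in> open_segment a c" "u \<in> open_segment c1 d1"
    have c1S: "c1 \<in> S" "d1 \<in> S" "c1 \<noteq> d1" using c1 sub closed_segment_in_edges_iff by blast+
    have o: "a \<notin> {c1, d1}" "det3 a c c1 * det3 a c d1 < 0"
      using open_segment_det3_opposite[OF S a cS(1) c1S(1,2) cS(2)[symmetric] c1S(3) u] ne by auto
    have at1: "a \<notin> closed_segment c1 d1" using mem_edge_iff[OF S sub c1 a] o by simp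
    have uS: "u \<notin> S" using point_set_open_segment[OF S a cS(1)] u(1) by blast
    have u0: "det3 a c u = 0" using u(1) det3_closed_segment_0 by (auto simp: open_segment_def)
    obtain v where v: "0 < v" "v < 1" "u = (1 - v) *\<^sub>R a + v *\<^sub>R c" using u by (auto simp: in_segment)
    have "bary a w e u = (1 - v) + v * bary a w e c" unfolding v(3) bary_affine using D by simp
    then have alu: "bary a w e u > 0" using v nn(1) by (simp add: add_pos_nonneg)
    have ut: "u \<notin> t"
    proof
      assume "u \<in> t"
      then obtain r where r: "u = (1 - r) *\<^sub>R d + r *\<^sub>R e" using de(1) by (auto simp: in_segment)
      have "det3 w e d = 0" using det3_closed_segment_0[of w d e] t(3) de(1) by (simp add: det3_cyclic det3_swap2[of d w e])
      then have "det3 w e u = 0" by (simp add: r det3_affine)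
      then show False using alu by (simp add: bary_def det3_cyclic)
    qed
    have dene: "{d, e} \<noteq> {c1, d1}"
    proof
      assume "{d, e} = {c1, d1}"
      then have "closed_segment d e = closed_segment c1 d1" by (simp only: closed_segment_eq)
      then show False using ut u(2) de(1) unfolding open_segment_def by blast
    qed
    have "(t0 * det3 a c c1) * (t0 * det3 a c d1) = t0\<^sup>2 * (det3 a c c1 * det3 a c d1)"
      by (simp add: power2_eq_square)
    also have "\<dots> < 0" using o(2) D by (simp add: t0_def mult_pos_neg)
    finally have "t0 * det3 a c c1 < 0 \<or> t0 * det3 a c d1 < 0" by (auto simp: mult_less_0_iff)
    then obtain g where g: "g \<in> {c1, d1}" "t0 * det3 a c g < 0" by blast
    have gS: "g \<in> S" "g \<noteq> a" using g c1S o by auto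
    have gout: "g \<notin> convex hull {a, w, e}" using first[of g] g(2) gS by (auto simp: C_def)
    have ug: "closed_segment u g \<subseteq> closed_segment c1 d1" using g u
      by (auto simp: open_segment_def subset_closed_segment)
    have uin: "u \<in> convex hull {a, w, e}"
    proof -
      have "closed_segment a c \<subseteq> convex hull {a, w, e}" using cS(3) by (intro closed_segment_subset) (auto intro: hull_inc)
      then show ?thesis using u(1) by (auto simp: open_segment_def)
    qed
    obtain p where p: "p \<in> closed_segment u g"
      "(p \<in> closed_segment w e \<and> bary a w e g < 0) \<or>
       (p \<in> closed_segment e a \<and> bary w e a g < 0) \<or>
       (p \<in> closed_segment a w \<and> bary e a w g < 0)"
      using triangle_exit[OF D uin gout] by blast
    have p1: "p \<in> closed_segment c1 d1" using p(1) ug by blast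
    \<comment> \<open>Past \<open>u\<close> the crossing edge lies strictly on the \<open>w\<close>
      side of the line \<open>a c\<close>, so an exit point on the other closed side is
      \<open>u\<close> itself.\<close>
    have before: "p = u" if "t0 * det3 a c p \<ge> 0"
    proof -
      obtain r where r: "0 \<le> r" "r \<le> 1" "p = (1 - r) *\<^sub>R u + r *\<^sub>R g" using p(1) by (auto simp: in_segment)
      have eq: "t0 * det3 a c p = r * (t0 * det3 a c g)" unfolding r(3) det3_affine u0 by simp
      have "r * (t0 * det3 a c g) \<ge> 0" using that unfolding eq .
      then have "r = 0" using mult_pos_neg[OF _ g(2), of r] r(1) by linarith
      then show ?thesis using r by simp
    qed
    from p(2) show False
    proof (elim disjE conjE)
      assume pwe: "p \<in> closed_segment w e"
      moreover have "closed_segment w e \<subseteq> closed_segment d e"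
        using wde by (simp add: open_segment_def subset_closed_segment)
      ultimately have pt: "p \<in> closed_segment d e" by blast
      then have "p \<in> {d, e}" using noncrossing_meet[OF S sub ncr _ pt c1 p1] t(1) de(1) dene by blast
      moreover have "d \<notin> closed_segment w e" using closed_segment_antisym[of d w e] wde by (auto simp: open_segment_def)
      ultimately have "p = e" using pwe by blast
      then have "p = u" using before first[OF eC] by simp
      then show False using uS \<open>p = e\<close> de(3) by simp
    next
      assume pe: "p \<in> closed_segment e a" and gw: "bary w e a g < 0"
      have "t0 * det3 a c p \<ge> 0" using det3_closed_segment_nonneg[OF pe] first[OF eC] by simp
      then have "det3 e a u = 0" using before det3_closed_segment_0[OF pe] by simp
      then have "v * det3 e a c = 0" unfolding v(3) det3_affine by simp
      then have "c = e" using v(1) point_set_det3[OF S de(3) a cS(1)] ade cS(2) by auto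
      then have "t0 * det3 a e g < 0" using g(2) by simp
      moreover have "det3 a g e = - det3 a e g" by (rule det3_swap2)
      ultimately have "t0\<^sup>2 * bary w e a g > 0" using t0(2)[of g] by simp
      then show False using gw by (simp add: zero_less_mult_iff)
    next
      assume pw: "p \<in> closed_segment a w"
      have "closed_segment a w \<subseteq> closed_segment a z"
        using wo by (auto simp: open_segment_def subset_closed_segment)
      then have "p \<in> U" using p1 c1 at1 pw unfolding U_def by blast
      then have "dist a w \<le> dist a p" using w by blast
      then have "p \<notin> open_segment a w" using dist_in_open_segment[of p a w] by (auto simp: dist_commute)
      moreover have "p \<noteq> a" using p1 at1 by blast
      ultimately have "p = w" using pw by (simp add: open_segment_def)
      then have "{d, e} = {c1, d1} \<or> (w \<in> {d, e} \<and> w \<in> {c1, d1})"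
        using noncrossing_meet[OF S sub ncr, of d e w c1 d1] t de(1) c1 p1 by simp
      then show False using wS de(2,3) dene by blast
    qed
  qed
  then show ?thesis using cS left by blast
qed

text \<open>The apex is the angularly first neighbour of \<open>a\<close> on the left of
  \<open>a b\<close>. A point inside the triangle would yield an earlier neighbour, and an edge
  crossing \<open>b c\<close> would have to end inside the empty triangle or at \<open>a\<close>.
  The right side is covered by exchanging \<open>a\<close> and \<open>b\<close>.\<close>

lemma triangulation_left_triangle:
  assumes S: "point_set S" and T: "triangulation S T"
    and ab: "closed_segment a b \<in> T" and z: "z \<in> S" "det3 a b z > 0"
  obtains c where "c \<in> S" "det3 a b c > 0" "closed_segment a c \<in> T" "closed_segment b c \<in> T"
    "S \<inter> convex hull {a, b, c} \<subseteq> {a, b, c}"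
proof -
  have sub: "T \<subseteq> edges S" and ncr: "noncrossing T" using T by (auto simp: triangulation_def)
  have a: "a \<in> S" and b: "b \<in> S" and "a \<noteq> b" using ab sub closed_segment_in_edges_iff by blast+
  define N where "N = {c \<in> S. closed_segment a c \<in> T \<and> det3 a b c > 0}"
  have "finite N" using S by (simp add: N_def point_set_def)
  moreover have "N \<noteq> {}" using triangulation_left_neighbour[OF S T a b z] by (auto simp: N_def)
  ultimately obtain c where c: "c \<in> N" and first: "\<And>d. d \<in> N \<Longrightarrow> det3 a c d \<ge> 0"
    using angular_first[of N 1 a b] unfolding N_def by auto
  have cS: "c \<in> S" "closed_segment a c \<in> T" "det3 a b c > 0" using c by (auto simp: N_def)
  have ne: "a \<noteq> c" "b \<noteq> c" using cS(3) by auto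
  have D: "det3 a b c \<noteq> 0" using cS by simp
  have D': "det3 b c a \<noteq> 0" "det3 c a b \<noteq> 0" using D by (simp_all add: det3_cyclic)
  let ?al = "bary a b c" and ?be = "bary b c a" and ?ga = "bary c a b"
  have sg: "?be x > 0 \<longleftrightarrow> det3 a c x < 0" "?ga x > 0 \<longleftrightarrow> det3 a b x > 0" for x
  proof -
    have "det3 x c a = - det3 a c x" "det3 b c a = det3 a b c" "det3 x a b = det3 a b x" "det3 c a b = det3 a b c"
      by (simp_all add: det3_def algebra_simps)
    then show "?be x > 0 \<longleftrightarrow> det3 a c x < 0" "?ga x > 0 \<longleftrightarrow> det3 a b x > 0"
      using cS(3) by (simp_all add: bary_def zero_less_divide_iff divide_less_0_iff)
  qed
  have wedge: False if "y \<in> S" "closed_segment a y \<in> T" "?be y > 0" "?ga y > 0" for y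
    using first[of y] that sg[of y] by (auto simp: N_def)
  \<comment> \<open>An edge of \<open>T\<close> avoiding \<open>a\<close> cannot leave the triangle
    through the edges \<open>a b\<close> and \<open>a c\<close>, and leaving through
    \<open>b c\<close> requires a negative coordinate at \<open>a\<close> for its end.\<close>
  have enter: "g \<in> convex hull {a, b, c}"
    if t: "closed_segment g g2 \<in> T" "a \<notin> closed_segment g g2" and u: "u \<in> closed_segment g g2"
      "?al u \<ge> 0" "?be u > 0" "?ga u > 0" and g: "?al g > 0" for g g2 u
  proof (rule ccontr)
    assume no: "g \<notin> convex hull {a, b, c}"
    have "u \<in> convex hull {a, b, c}" using u mem_triangle_iff[OF D] by simp
    from triangle_exit[OF D this no] obtain p where p: "p \<in> closed_segment u g"
      "p \<in> closed_segment c a \<or> p \<in> closed_segment a b" using g by (metis less_asym)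
    have pt: "p \<in> closed_segment g g2" using p(1) u(1)
      by (metis closed_segment_subset convex_closed_segment ends_in_segment(1) in_mono)
    have pnu: "p \<noteq> u"
    proof
      assume "p = u"
      then have "det3 c a u = 0 \<or> det3 a b u = 0" using p(2) det3_closed_segment_0 by blast
      then show False using u(3,4) unfolding bary_def by (auto simp: det3_cyclic)
    qed
    obtain r where r: "0 \<le> r" "r \<le> 1" "p = (1 - r) *\<^sub>R u + r *\<^sub>R g" using p(1) by (auto simp: in_segment)
    have "r \<noteq> 0" using pnu r by auto
    then have alp: "?al p > 0" unfolding r(3) bary_affine using r u g by (simp add: add_nonneg_pos)
    then have pbc: "p \<noteq> b" "p \<noteq> c" using D by auto
    have pa: "p \<noteq> a" using pt t(2) by auto
    from p(2) show False
    proof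
      assume "p \<in> closed_segment c a"
      then have "{a, c} = {g, g2} \<or> p \<in> {a, c}"
        using noncrossing_meet[OF S sub ncr cS(2) _ t(1) pt] by (auto simp: closed_segment_commute)
      then show False using pbc pa t(2) ends_in_segment[where a=g and b=g2] by (auto simp: doubleton_eq_iff)
    next
      assume "p \<in> closed_segment a b"
      then have "{a, b} = {g, g2} \<or> p \<in> {a, b}"
        using noncrossing_meet[OF S sub ncr ab _ t(1) pt] by auto
      then show False using pbc pa t(2) ends_in_segment[where a=g and b=g2] by (auto simp: doubleton_eq_iff)
    qed
  qed
  define Z where "Z = {x \<in> S. x \<in> convex hull {a, b, c} \<and> x \<notin> {a, b, c}}"
  have Zpos: "?al x > 0" "?be x > 0" "?ga x > 0" if "x \<in> Z" for x
  proof -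
    have x: "x \<in> S" "x \<noteq> a" "x \<noteq> b" "x \<noteq> c" "x \<in> convex hull {a, b, c}" using that by (auto simp: Z_def)
    have "det3 x b c \<noteq> 0" "det3 x c a \<noteq> 0" "det3 x a b \<noteq> 0"
      using point_set_det3[OF S] x a b cS(1) ne \<open>a \<noteq> b\<close> by metis+
    then have "?al x \<noteq> 0" "?be x \<noteq> 0" "?ga x \<noteq> 0" using D D' by (simp_all add: bary_def)
    then show "?al x > 0" "?be x > 0" "?ga x > 0" using x(5) mem_triangle_iff[OF D, of x] by auto
  qed
  have "Z = {}"
  proof (rule ccontr)
    assume "Z \<noteq> {}"
    moreover have "finite Z" using S by (simp add: Z_def point_set_def)
    \<comment> \<open>The point of \<open>Z\<close> farthest from the line \<open>b c\<close> is
      visible from \<open>a\<close>: an edge crossing \<open>a z\<close> would have an endpoint in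
      the triangle that is still farther from \<open>b c\<close>.\<close>
    ultimately obtain z where z: "z \<in> Z" and max: "\<And>x. x \<in> Z \<Longrightarrow> ?al x \<le> ?al z"
      using ex_is_arg_min_if_finite[of Z "\<lambda>x. - ?al x"] by (auto simp: is_arg_min_linorder)
    have zS: "z \<in> S" "a \<noteq> z" using z by (auto simp: Z_def)
    have "closed_segment a z \<in> T"
    proof (rule triangulation_maximal[OF T a zS])
      fix c1 d1 u
      assume t: "closed_segment c1 d1 \<in> T" and nn: "{c1, d1} \<noteq> {a, z}" and u: "u \<in> open_segment a z" "u \<in> open_segment c1 d1"
      have c1S: "c1 \<in> S" "d1 \<in> S" "c1 \<noteq> d1" using t sub closed_segment_in_edges_iff by blast+
      have "a \<notin> {c1, d1}"
        using open_segment_det3_opposite[OF S a zS(1) c1S(1,2) zS(2) c1S(3) u] nn by auto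
      then have at: "a \<notin> closed_segment c1 d1" using mem_edge_iff[OF S sub t a] by simp
      obtain v where v: "0 < v" "v < 1" "u = (1 - v) *\<^sub>R a + v *\<^sub>R z" using u by (auto simp: in_segment)
      have uc: "?be u > 0" "?ga u > 0" unfolding v(3) bary_affine using D' v Zpos[OF z] by simp_all
      have "?al z < 1" using bary_sum[OF D, of z] Zpos[OF z] by simp
      then have "0 < (1 - v) * (1 - ?al z)" using v by simp
      then have alu: "?al u > ?al z" unfolding v(3) bary_affine using D by (simp add: algebra_simps)
      obtain r where r: "0 < r" "r < 1" "u = (1 - r) *\<^sub>R c1 + r *\<^sub>R d1" using u by (auto simp: in_segment)
      have aleq: "?al u = (1 - r) * ?al c1 + r * ?al d1" unfolding r(3) bary_affine by simp
      have "?al c1 \<ge> ?al u \<or> ?al d1 \<ge> ?al u"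
      proof (rule ccontr)
        assume "\<not> ?thesis"
        then have "(1 - r) * ?al c1 < (1 - r) * ?al u" "r * ?al d1 < r * ?al u" using r by simp_all
        then have "?al u < (1 - r) * ?al u + r * ?al u" using aleq by linarith
        then show False by (simp add: algebra_simps)
      qed
      then obtain g g2 where g: "closed_segment g g2 = closed_segment c1 d1" "g \<in> S" "?al g \<ge> ?al u"
        "g = c1 \<or> g = d1"
        using c1S closed_segment_commute by metis
      have "?al g > ?al z" using g alu by simp
      moreover have "g \<in> convex hull {a, b, c}"
        using enter[of g g2 u] g t at u(2) uc alu Zpos[OF z] by (auto simp: open_segment_def)
      moreover have "g \<noteq> a" using at g(4) by auto
      moreover have "g \<noteq> b" "g \<noteq> c" using calculation(1) Zpos[OF z] D by auto
      ultimately have "g \<in> Z" using g(2) by (auto simp: Z_def)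
      then show False using max[of g] \<open>?al g > ?al z\<close> by simp
    qed
    then show False using wedge[of z] zS Zpos[OF z] by blast
  qed
  then have empty: "S \<inter> convex hull {a, b, c} \<subseteq> {a, b, c}" by (auto simp: Z_def)
  have "closed_segment b c \<in> T"
  proof (rule triangulation_maximal[OF T b cS(1) ne(2)])
    fix c1 d1 u
    assume t: "closed_segment c1 d1 \<in> T" and nn: "{c1, d1} \<noteq> {b, c}" and u: "u \<in> open_segment b c" "u \<in> open_segment c1 d1"
    have c1S: "c1 \<in> S" "d1 \<in> S" "c1 \<noteq> d1" using t sub closed_segment_in_edges_iff by blast+
    have o: "b \<notin> {c1, d1}" "c \<notin> {c1, d1}" "det3 b c c1 * det3 b c d1 < 0"
      using open_segment_det3_opposite[OF S b cS(1) c1S(1,2) ne(2) c1S(3) u] nn by auto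
    obtain v where v: "0 < v" "v < 1" "u = (1 - v) *\<^sub>R b + v *\<^sub>R c" using u by (auto simp: in_segment)
    have uc: "?be u > 0" "?ga u > 0" "?al u = 0" unfolding v(3) bary_affine using D D' v by simp_all
    have at: "a \<notin> closed_segment c1 d1"
    proof
      assume "a \<in> closed_segment c1 d1"
      then have "a \<in> {c1, d1}" using mem_edge_iff[OF S sub t a] by simp
      then obtain y where y: "closed_segment a y \<in> T" "y \<in> S" "u \<in> open_segment a y"
        using t u c1S closed_segment_commute open_segment_commute by (metis insertE singletonD)
      obtain r where r: "0 < r" "r < 1" "u = (1 - r) *\<^sub>R a + r *\<^sub>R y" using y(3) by (auto simp: in_segment)
      have "r * ?be y > 0" "r * ?ga y > 0" using uc(1,2) D' unfolding r(3) bary_affine by simp_all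
      then have "?be y > 0" "?ga y > 0" using r by (simp_all add: zero_less_mult_iff)
      then show False using wedge y by blast
    qed
    have "?al c1 * ?al d1 = (det3 b c c1 * det3 b c d1) / (det3 a b c)\<^sup>2"
      by (simp add: bary_def det3_rotate[of b c] power2_eq_square)
    then have "?al c1 * ?al d1 < 0" using o(3) D by (simp add: divide_less_0_iff)
    then have "?al c1 > 0 \<or> ?al d1 > 0" by (auto simp: mult_less_0_iff)
    then obtain g g2 where g: "closed_segment g g2 = closed_segment c1 d1" "g \<in> S" "?al g > 0" "g = c1 \<or> g = d1"
      using c1S closed_segment_commute by metis
    have "g \<in> convex hull {a, b, c}"
      using enter[of g g2 u] g t at u(2) uc by (auto simp: open_segment_def)
    then have "g \<in> {a, b, c}" using empty g by blast
    then show False using g(4) at o by auto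
  qed
  then show thesis using that cS empty by blast
qed

section \<open>Points on the boundary of a convex polygon\<close>

lemma det3_midpoint:
  "det3 (midpoint a a') b c = (det3 a b c + det3 a' b c) / 2"
  "det3 a (midpoint b b') c = (det3 a b c + det3 a b' c) / 2"
  "det3 a b (midpoint c c') = (det3 a b c + det3 a b c') / 2"
  by (simp_all add: det3_def midpoint_def field_simps)

lemma labels_eq:
  assumes "J \<subseteq> {..<n}"
  shows "{x. x < 2 * n \<and> (odd x \<longrightarrow> x div 2 \<in> J)} = (\<lambda>i. 2 * i) ` {..<n} \<union> (\<lambda>i. Suc (2 * i)) ` J"
proof (intro equalityI subsetI)
  fix x assume x: "x \<in> {x. x < 2 * n \<and> (odd x \<longrightarrow> x div 2 \<in> J)}"
  show "x \<in> (\<lambda>i. 2 * i) ` {..<n} \<union> (\<lambda>i. Suc (2 * i)) ` J"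
  proof (cases "even x")
    case True
    then show ?thesis using x by (auto elim!: evenE)
  next
    case False
    then have "x = Suc (2 * (x div 2))" "x div 2 \<in> J" using x by auto
    then show ?thesis by blast
  qed
qed (use assms in force)

text \<open>The determinant of three boundary points is an average over eight triples of vertices.
  This is the index arithmetic showing that one of the eight is a proper triangle unless the labels
  lie on one side; index \<open>n\<close> stands for vertex \<open>0\<close>, so a triple from
  \<open>0\<close> to \<open>n\<close> is degenerate.\<close>

lemma half_triple:
  fixes x y z :: nat
  assumes "x < y" "y < z" "z < 2 * n" and n3: "n \<ge> 3"
  and x0: "x = 2 * x0 \<or> x = 2 * x0 + 1" and y0: "y = 2 * y0 \<or> y = 2 * y0 + 1"
    and z0: "z = 2 * z0 \<or> z = 2 * z0 + 1"
  and X: "hx = (if x = 2 * x0 then x0 else x0 + 1)"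
  and Y: "hy = (if y = 2 * y0 then y0 else y0 + 1)"
  and Z:  "hz = (if z = 2 * z0 then z0 else z0 + 1)"
  and nf: "\<not> (x = 2 * x0 \<and> y = x + 1 \<and> z = x + 2)" "\<not> (x = 0 \<and> y = 2 * n - 2 \<and> z = 2 * n - 1)"
  shows "\<exists>a\<in>{x0, hx}. \<exists>b\<in>{y0, hy}. \<exists>c\<in>{z0, hz}. a < b \<and> b < c \<and> \<not> (a = 0 \<and> c = n)"
proof (rule ccontr)
  assume no: "\<not> ?thesis"
  have H: "\<And>a b c. a \<in> {x0, hx} \<Longrightarrow> b \<in> {y0, hy} \<Longrightarrow> c \<in> {z0, hz} \<Longrightarrow> a < b \<Longrightarrow> b < c \<Longrightarrow> a = 0 \<and> c = n" using no by blast
  have xf: "(x = 2 * x0 \<and> hx = x0) \<or> (x = 2 * x0 + 1 \<and> hx = x0 + 1)" using x0 X by (cases "x = 2 * x0") auto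
  have yf: "(y = 2 * y0 \<and> hy = y0) \<or> (y = 2 * y0 + 1 \<and> hy = y0 + 1)" using y0 Y by (cases "y = 2 * y0") auto
  have zf: "(z = 2 * z0 \<and> hz = z0) \<or> (z = 2 * z0 + 1 \<and> hz = z0 + 1)" using z0 Z by (cases "z = 2 * z0") auto
  have zn: "z0 < n" "hz \<le> n" using zf assms(3) by linarith+
  from yf show False
  proof (elim disjE conjE)
    assume y: "y = 2 * y0" "hy = y0"
    have lt1: "x0 < y0" using assms(1) y(1) xf by linarith
    have lt2: "y0 < hz" using assms(2) y(1) zf by linarith
    have w: "x0 = 0" "hz = n" using H[of x0 y0 hz] lt1 lt2 by blast+
    have z: "z = 2 * n - 1" "z0 = n - 1" using zf w(2) assms(3) by linarith+
    have "\<not> y0 < z0" using H[of x0 y0 z0] lt1 zn(1) by (metis insertCI less_irrefl)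
    then have y0: "y0 = n - 1" using lt2 z(2) w(2) by linarith
    then have "y = 2 * n - 2" using y(1) by simp
    then have "hx = 1" using nf(2) z(1) xf w(1) by linarith
    then show False using H[of hx y0 hz] lt2 y0 n3 by fastforce
  next
    assume y: "y = 2 * y0 + 1" "hy = y0 + 1"
    have lt1: "x0 \<le> y0" using assms(1) y(1) xf by linarith
    have lt2: "y0 < z0" using assms(2) y(1) zf by linarith
    have "\<not> x0 < y0" using H[of x0 y0 z0] lt2 zn(1) by (metis insertCI less_irrefl)
    then have eq: "x0 = y0" using lt1 by linarith
    have x: "x = 2 * x0" using xf y(1) assms(1) eq by linarith
    have nz: "z \<noteq> x + 2" using nf(1) x y(1) eq by linarith
    have lt3: "hy < hz" using nz zf x y eq lt2 by linarith
    have w: "x0 = 0" "hz = n" using H[of x0 hy hz] y(2) eq lt3 by simp_all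
    have "z0 \<ge> n - 1" using zf w(2) by linarith
    then have "hy < z0" using y(2) eq w(1) n3 by linarith
    then have "z0 = n" using H[of x0 hy z0] y(2) eq by simp
    then show False using zn(1) by linarith
  qed
qed

text \<open>The factor \<open>s\<close> admits both orientations, because a cyclic bijection may
  reverse the hull. The extra vertex \<open>G n\<close> lets every side, including the last, run
  from \<open>G i\<close> to \<open>G (Suc i)\<close>.\<close>

locale convex_polygon =
  fixes n :: nat and G :: "nat \<Rightarrow> complex" and s :: real
  assumes n3: "n \<ge> 3" and wrap: "G n = G 0"
    and convex_position: "\<And>i j k. \<lbrakk>i < j; j < k; k < n\<rbrakk> \<Longrightarrow> s * det3 (G i) (G j) (G k) > 0"
begin

lemma convex_position_wrap:
  assumes "a < b" "b < c" "c \<le> n" "\<not> (a = 0 \<and> c = n)"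
  shows "s * det3 (G a) (G b) (G c) > 0"
proof (cases "c = n")
  case True
  then have "s * det3 (G 0) (G a) (G b) > 0" using assms by (intro convex_position) auto
  then show ?thesis using True by (simp add: wrap det3_cyclic)
qed (use assms convex_position in auto)

lemma convex_position_weak:
  assumes "a \<le> b" "b \<le> c" "c \<le> n"
  shows "s * det3 (G a) (G b) (G c) \<ge> 0"
proof -
  consider "a = b" | "b = c" | "a = 0" "c = n" | "a < b" "b < c" "\<not> (a = 0 \<and> c = n)" using assms by linarith
  then show ?thesis
    by cases (use convex_position_wrap[of a b c] assms in \<open>auto simp: wrap\<close>)
qed

text \<open>The two rounded halves agree for even labels and are consecutive for odd ones, so one
  formula yields both the vertices and the midpoints of the sides.\<close>

definition bd :: "nat \<Rightarrow> complex" where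
  "bd x = midpoint (G (x div 2)) (G ((x + 1) div 2))"

lemma bd_even [simp]: "bd (2 * i) = G i"
  by (simp add: bd_def)

lemma bd_odd [simp]: "bd (Suc (2 * i)) = midpoint (G i) (G (Suc i))"
  by (simp add: bd_def)

text \<open>The determinant is affine in each argument, so at midpoints it is the mean of eight
  determinants of vertices. All eight are nonnegative because their indices are weakly increasing;
  one positive term suffices.\<close>

lemma bd_position_aux:
  assumes le: "x \<le> y" "y \<le> z" "z < 2 * n"
    and a: "a \<in> {x div 2, (x + 1) div 2}" and b: "b \<in> {y div 2, (y + 1) div 2}" and c: "c \<in> {z div 2, (z + 1) div 2}"
    and lt: "a < b" "b < c" "\<not> (a = 0 \<and> c = n)"
    and strict: "x < y" "y < z"
  shows "s * det3 (bd x) (bd y) (bd z) > 0"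
proof -
  define e where "e = (\<lambda>a b c. s * det3 (G a) (G b) (G c))"
  let ?x = "x div 2" and ?x' = "(x + 1) div 2" and ?y = "y div 2" and ?y' = "(y + 1) div 2"
    and ?z = "z div 2" and ?z' = "(z + 1) div 2"
  have eq: "s * det3 (bd x) (bd y) (bd z) =
    (e ?x ?y ?z + e ?x' ?y ?z + e ?x ?y' ?z + e ?x' ?y' ?z + e ?x ?y ?z' + e ?x' ?y ?z' + e ?x ?y' ?z' + e ?x' ?y' ?z') / 8"
    unfolding bd_def det3_midpoint e_def by (simp add: field_simps)
  have nn: "e a b c \<ge> 0" if "a \<in> {?x, ?x'}" "b \<in> {?y, ?y'}" "c \<in> {?z, ?z'}" for a b c
  proof -
    have m: "?x \<le> ?x'" "?x' \<le> ?y" "?y \<le> ?y'" "?y' \<le> ?z" "?z \<le> ?z'" "?z' \<le> n"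
      using strict le(3) by (simp_all add: div_le_mono)
    have "a \<le> b" using that(1,2) m by (metis insertE le_trans singletonD)
    moreover have "b \<le> c" using that(2,3) m by (metis insertE le_trans singletonD)
    moreover have "c \<le> n" using that(3) m by (metis insertE le_trans singletonD)
    ultimately show ?thesis unfolding e_def by (rule convex_position_weak)
  qed
  have "z div 2 \<le> n" "(z + 1) div 2 \<le> n" using le(3) by simp_all
  then have "c \<le> n" using c by blast
  then have P: "e a b c > 0" unfolding e_def using convex_position_wrap lt by blast
  have Q: "e ?x ?y ?z \<ge> 0" "e ?x' ?y ?z \<ge> 0" "e ?x ?y' ?z \<ge> 0" "e ?x' ?y' ?z \<ge> 0"
    "e ?x ?y ?z' \<ge> 0" "e ?x' ?y ?z' \<ge> 0" "e ?x ?y' ?z' \<ge> 0" "e ?x' ?y' ?z' \<ge> 0"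
    by (rule nn; blast)+
  have R: "e a b c \<in> {e ?x ?y ?z, e ?x' ?y ?z, e ?x ?y' ?z, e ?x' ?y' ?z, e ?x ?y ?z', e ?x' ?y ?z', e ?x ?y' ?z', e ?x' ?y' ?z'}"
    using a b c by (elim insertE emptyE) simp_all
  have pos8: "0 < (E1 + E2 + E3 + E4 + E5 + E6 + E7 + E8) / 8"
    if "0 < E" "0 \<le> E1" "0 \<le> E2" "0 \<le> E3" "0 \<le> E4" "0 \<le> E5" "0 \<le> E6" "0 \<le> E7" "0 \<le> E8"
      "E \<in> {E1, E2, E3, E4, E5, E6, E7, E8}" for E E1 E2 E3 E4 E5 E6 E7 E8 :: real
  proof -
    have "E = E1 \<or> E = E2 \<or> E = E3 \<or> E = E4 \<or> E = E5 \<or> E = E6 \<or> E = E7 \<or> E = E8" using that(10) by simp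
    then show ?thesis using that(1-9) by (elim disjE) simp_all
  qed
  show ?thesis unfolding eq by (rule pos8[OF P Q R])
qed

text \<open>The triples of labels whose boundary points are collinear; the second disjunct is the last side,
  which joins vertex \<open>n - 1\<close> to vertex \<open>0\<close>.\<close>

definition flat :: "nat \<Rightarrow> nat \<Rightarrow> nat \<Rightarrow> bool" where
  "flat x y z \<longleftrightarrow> (even x \<and> y = x + 1 \<and> z = x + 2) \<or> (x = 0 \<and> y = 2 * n - 2 \<and> z = 2 * n - 1)"

lemma bd_position:
  assumes "x < y" "y < z" "z < 2 * n" "\<not> flat x y z"
  shows "s * det3 (bd x) (bd y) (bd z) > 0"
proof -
  obtain x0 y0 z0 where x0: "x = 2 * x0 \<or> x = 2 * x0 + 1" and y0: "y = 2 * y0 \<or> y = 2 * y0 + 1"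
    and z0: "z = 2 * z0 \<or> z = 2 * z0 + 1" by (meson evenE oddE)
  define hi where "hi = (\<lambda>x. (x + 1) div 2 :: nat)"
  have X: "x div 2 = x0" "hi x = (if x = 2 * x0 then x0 else x0 + 1)" using x0 by (auto simp: hi_def)
  have Y: "y div 2 = y0" "hi y = (if y = 2 * y0 then y0 else y0 + 1)" using y0 by (auto simp: hi_def)
  have Z: "z div 2 = z0" "hi z = (if z = 2 * z0 then z0 else z0 + 1)" using z0 by (auto simp: hi_def)
  have nf: "\<not> (x = 2 * x0 \<and> y = x + 1 \<and> z = x + 2)" "\<not> (x = 0 \<and> y = 2 * n - 2 \<and> z = 2 * n - 1)"
    using assms(4) by (auto simp: flat_def)
  have "\<exists>a\<in>{x0, hi x}. \<exists>b\<in>{y0, hi y}. \<exists>c\<in>{z0, hi z}. a < b \<and> b < c \<and> \<not> (a = 0 \<and> c = n)"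
    by (rule half_triple[OF assms(1-3) n3 x0 y0 z0 X(2) Y(2) Z(2) nf])
  then have "\<exists>a\<in>{x div 2, (x + 1) div 2}. \<exists>b\<in>{y div 2, (y + 1) div 2}. \<exists>c\<in>{z div 2, (z + 1) div 2}.
    a < b \<and> b < c \<and> \<not> (a = 0 \<and> c = n)"
    unfolding X(1) Y(1) Z(1) hi_def .
  then show ?thesis using bd_position_aux[of x y z] assms by auto
qed

end

text \<open>The points \<open>a\<close>, \<open>c\<close>, \<open>b\<close>, \<open>d\<close> form a
  convex quadrilateral in this order, so its diagonals cross. The distances of \<open>a\<close> and
  \<open>b\<close> from the line \<open>c d\<close> are proportional to the areas \<open>p\<close>
  and \<open>r\<close>, which gives the parameter \<open>p / (p + r)\<close>; both sums of two areas
  equal that of the quadrilateral.\<close>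

lemma open_segments_cross:
  assumes "s * det3 a c b > 0" "s * det3 a b d > 0" "s * det3 c b d > 0" "s * det3 a c d > 0"
  obtains u where "u \<in> open_segment a b" "u \<in> open_segment c d"
proof -
  define p where "p = det3 a c d"
  define r where "r = det3 c b d"
  define p' where "p' = det3 a c b"
  define r' where "r' = det3 a b d"
  have pos: "s * p > 0" "s * r > 0" "s * p' > 0" "s * r' > 0" using assms by (simp_all add: p_def r_def p'_def r'_def)
  have rel: "p + r = p' + r'" by (simp add: p_def r_def p'_def r'_def det3_def algebra_simps)
  define t where "t = p / (p + r)"
  define t' where "t' = p' / (p' + r')"
  have ratio: "0 < x / (x + y)" "x / (x + y) < 1" "x + y \<noteq> 0" if "s * x > 0" "s * y > 0" for x y :: real
  proof -
    have "s * (x + y) > 0" using that by (simp add: distrib_left)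
    then show "x + y \<noteq> 0" by auto
    have "s \<noteq> 0" using that by auto
    then have sx: "x / (x + y) = (s * x) / (s * x + s * y)" by (simp flip: distrib_left)
    show "0 < x / (x + y)" "x / (x + y) < 1" unfolding sx using that by (simp_all add: divide_simps)
  qed
  have t: "0 < t" "t < 1" "0 < t'" "t' < 1" unfolding t_def t'_def using ratio pos by blast+
  have ne: "a \<noteq> b" "c \<noteq> d" using assms by auto
  have nz: "p + r \<noteq> 0" using ratio pos by blast
  have "(p + r) *\<^sub>R ((1 - t) *\<^sub>R a + t *\<^sub>R b) = r *\<^sub>R a + p *\<^sub>R b"
  proof -
    have "(p + r) * t = p" "(p + r) * (1 - t) = r" using nz by (simp_all add: t_def field_simps)
    then show ?thesis by (simp add: scaleR_add_right)
  qed
  also have "\<dots> = r' *\<^sub>R c + p' *\<^sub>R d"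
    by (simp add: complex_eq_iff p_def r_def p'_def r'_def det3_def algebra_simps)
  also have "\<dots> = (p + r) *\<^sub>R ((1 - t') *\<^sub>R c + t' *\<^sub>R d)"
  proof -
    have "(p + r) * t' = p'" "(p + r) * (1 - t') = r'" using nz unfolding t'_def rel by (simp_all add: field_simps)
    then show ?thesis by (simp add: scaleR_add_right)
  qed
  finally have "(1 - t) *\<^sub>R a + t *\<^sub>R b = (1 - t') *\<^sub>R c + t' *\<^sub>R d" using nz by (simp only: scaleR_cancel_left) simp
  moreover have "(1 - t) *\<^sub>R a + t *\<^sub>R b \<in> open_segment a b" "(1 - t') *\<^sub>R c + t' *\<^sub>R d \<in> open_segment c d"
    using t ne unfolding in_segment by blast+
  ultimately show thesis using that by metis
qed

section \<open>Curves joining interleaved boundary points\<close>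

lemma segment_on_axis:
  fixes e :: "'a :: real_vector"
  assumes z: "z \<in> closed_segment (p *\<^sub>R e) (r *\<^sub>R e)" and pr: "p \<le> r"
  shows "\<exists>x. z = x *\<^sub>R e \<and> p \<le> x \<and> x \<le> r"
proof -
  obtain u where u: "0 \<le> u" "u \<le> 1" "z = (1 - u) *\<^sub>R p *\<^sub>R e + u *\<^sub>R r *\<^sub>R e" using z by (auto simp: in_segment)
  then have "z = ((1 - u) * p + u * r) *\<^sub>R e" by (simp add: algebra_simps)
  moreover have "0 \<le> u * (r - p)" "0 \<le> (1 - u) * (r - p)" using u pr by simp_all
  then have "p \<le> (1 - u) * p + u * r" "(1 - u) * p + u * r \<le> r" by (simp_all add: algebra_simps)
  ultimately show ?thesis by blast
qed

text \<open>In affine coordinates in which the two chords lie on the axes, the curves can be prolonged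
  along the axes to the sides of a large box, where Fashoda's theorem applies.\<close>

lemma chords_curves_meet:
  fixes K :: "complex set"
  assumes K: "bounded K"
    and z0: "z0 \<in> open_segment A B" "z0 \<in> open_segment C D" and ncl: "det3 A B C \<noteq> 0"
    and ray: "\<And>X t. X \<in> {A, B, C, D} \<Longrightarrow> t > 1 \<Longrightarrow> z0 + t *\<^sub>R (X - z0) \<notin> K"
    and g: "path g" "path_image g \<subseteq> K" "pathstart g = A" "pathfinish g = B"
    and h: "path h" "path_image h \<subseteq> K" "pathstart h = C" "pathfinish h = D"
  shows "path_image g \<inter> path_image h \<noteq> {}"
proof -
  obtain a where a: "0 < a" "a < 1" "z0 = (1 - a) *\<^sub>R A + a *\<^sub>R B" using z0 by (auto simp: in_segment)
  obtain c where c: "0 < c" "c < 1" "z0 = (1 - c) *\<^sub>R C + c *\<^sub>R D" using z0 by (auto simp: in_segment)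
  define v w where "v = B - A" and "w = D - C"
  define d where "d = Re v * Im w - Im v * Re w"
  have A: "A = z0 - a *\<^sub>R v" "B = z0 + (1 - a) *\<^sub>R v" by (simp_all add: a(3) v_def algebra_simps)
  have C: "C = z0 - c *\<^sub>R w" "D = z0 + (1 - c) *\<^sub>R w" by (simp_all add: c(3) w_def algebra_simps)
  have "det3 A B C = - (c * d)"
    unfolding A C d_def by (simp add: det3_def algebra_simps)
  then have d0: "d \<noteq> 0" using ncl by auto
  \<comment> \<open>Cramer's rule: \<open>X\<close> and \<open>Y\<close> are the coordinates with
    respect to the origin \<open>z0\<close> and the directions \<open>v\<close>, \<open>w\<close> of
    the two chords.\<close>
  define X where "X = (\<lambda>x. ((Re x - Re z0) * Im w - (Im x - Im z0) * Re w) / d)"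
  define Y where "Y = (\<lambda>x. (Re v * (Im x - Im z0) - Im v * (Re x - Re z0)) / d)"
  have coord: "x = z0 + X x *\<^sub>R v + Y x *\<^sub>R w" for x
  proof -
    have "d *\<^sub>R (x - z0) = (d * X x) *\<^sub>R v + (d * Y x) *\<^sub>R w"
      unfolding X_def Y_def using d0 by (simp add: complex_eq_iff) (simp add: d_def algebra_simps)
    also have "\<dots> = d *\<^sub>R (X x *\<^sub>R v + Y x *\<^sub>R w)" by (simp add: scaleR_add_right)
    finally have "x - z0 = X x *\<^sub>R v + Y x *\<^sub>R w" using d0 by (simp only: scaleR_cancel_left) simp
    then show ?thesis by (simp add: algebra_simps)
  qed
  have XY: "X (z0 + p *\<^sub>R v + r *\<^sub>R w) = p" "Y (z0 + p *\<^sub>R v + r *\<^sub>R w) = r" for p r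
  proof -
    have "(p * Re v + r * Re w) * Im w - (p * Im v + r * Im w) * Re w = p * d"
      "Re v * (p * Im v + r * Im w) - Im v * (p * Re v + r * Re w) = r * d"
      by (simp_all add: d_def algebra_simps)
    then show "X (z0 + p *\<^sub>R v + r *\<^sub>R w) = p" "Y (z0 + p *\<^sub>R v + r *\<^sub>R w) = r"
      using d0 by (simp_all add: X_def Y_def)
  qed
  define pt :: "real \<Rightarrow> real \<Rightarrow> real^2" where "pt = (\<lambda>p r. p *\<^sub>R axis 1 1 + r *\<^sub>R axis 2 1)"
  have pt: "pt p r $ 1 = p" "pt p r $ 2 = r" for p r by (simp_all add: pt_def axis_def)
  have pt_inj: "pt p r = pt p' r' \<longleftrightarrow> p = p' \<and> r = r'" for p r p' r' by (metis pt)
  define f where "f = (\<lambda>x. pt (X x) (Y x))"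
  have cont: "continuous_on S f" for S
    unfolding f_def pt_def X_def Y_def by (intro continuous_intros) (use d0 in auto)
  have f_inj: "f x = f y \<longleftrightarrow> x = y" for x y
    unfolding f_def pt_inj using coord[of x] coord[of y] by auto
  have fABCD: "f A = pt (- a) 0" "f B = pt (1 - a) 0" "f C = pt 0 (- c)" "f D = pt 0 (1 - c)"
    using XY[of "- a" 0] XY[of "1 - a" 0] XY[of 0 "- c"] XY[of 0 "1 - c"] by (simp_all add: f_def A C)
  have "bounded (f ` K)"
    using compact_imp_bounded[OF compact_continuous_image[OF cont, of "closure K"]] K
    by (meson bounded_subset closure_subset compact_closure image_mono)
  then obtain R where R: "R > 0" "\<And>x. x \<in> K \<Longrightarrow> norm (f x) \<le> R"
    by (auto simp: bounded_pos)
  have inK: "A \<in> K" "B \<in> K" "C \<in> K" "D \<in> K" using g h pathstart_in_path_image pathfinish_in_path_image by blast+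
  let ?box = "cbox (\<chi> i. - R) (\<chi> i. R) :: (real^2) set"
  have ptbox: "pt p r \<in> ?box \<longleftrightarrow> \<bar>p\<bar> \<le> R \<and> \<bar>r\<bar> \<le> R" for p r
    unfolding mem_box_cart forall_2 by (auto simp: pt)
  have fbox: "f x \<in> ?box" if "x \<in> K" for x
    using R(2)[OF that] component_le_norm_cart[of "f x" 1] component_le_norm_cart[of "f x" 2]
    unfolding f_def ptbox pt by linarith
  have aR: "a \<le> R" "1 - a \<le> R" "c \<le> R" "1 - c \<le> R"
    using fbox[OF inK(1)] fbox[OF inK(2)] fbox[OF inK(3)] fbox[OF inK(4)] unfolding fABCD ptbox by linarith+
  define g' where "g' = linepath (pt (- R) 0) (f A) +++ (f \<circ> g) +++ linepath (f B) (pt R 0)"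
  define h' where "h' = linepath (pt 0 (- R)) (f C) +++ (f \<circ> h) +++ linepath (f D) (pt 0 R)"
  have pg: "path (f \<circ> g)" "path (f \<circ> h)" using g h cont by (auto intro: path_continuous_image)
  have pg': "path g'" "path h'" unfolding g'_def h'_def using pg g h
    by (auto simp: pathfinish_compose pathstart_compose)
  have img: "path_image g' = closed_segment (pt (- R) 0) (pt (- a) 0) \<union> f ` path_image g \<union> closed_segment (pt (1 - a) 0) (pt R 0)"
    unfolding g'_def using g pg by (simp add: path_image_join pathfinish_compose pathstart_compose path_image_compose fABCD Un_assoc)
  have imh: "path_image h' = closed_segment (pt 0 (- R)) (pt 0 (- c)) \<union> f ` path_image h \<union> closed_segment (pt 0 (1 - c)) (pt 0 R)"
    unfolding h'_def using h pg by (simp add: path_image_join pathfinish_compose pathstart_compose path_image_compose fABCD Un_assoc)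
  have segbox: "closed_segment p r \<subseteq> ?box" if "p \<in> ?box" "r \<in> ?box" for p r
    using that by (simp add: closed_segment_subset)
  have "closed_segment (pt (- R) 0) (pt (- a) 0) \<subseteq> ?box" "closed_segment (pt (1 - a) 0) (pt R 0) \<subseteq> ?box"
    "closed_segment (pt 0 (- R)) (pt 0 (- c)) \<subseteq> ?box" "closed_segment (pt 0 (1 - c)) (pt 0 R) \<subseteq> ?box"
    using aR a(1,2) c(1,2) R(1) by (intro segbox; simp add: ptbox)+
  moreover have "f ` path_image g \<subseteq> ?box" "f ` path_image h \<subseteq> ?box" using fbox g(2) h(2) by blast+
  ultimately have "path_image g' \<subseteq> ?box" "path_image h' \<subseteq> ?box" unfolding img imh by blast+
  moreover have "pathstart g' $ 1 = (\<chi> i. - R) $ 1" "pathfinish g' $ 1 = (\<chi> i. R) $ 1"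
    "pathstart h' $ 2 = (\<chi> i. - R) $ 2" "pathfinish h' $ 2 = (\<chi> i. R) $ 2"
    unfolding g'_def h'_def by (simp_all add: pt)
  ultimately obtain z where z: "z \<in> path_image g'" "z \<in> path_image h'"
    using fashoda[OF pg', of "\<chi> i. - R" "\<chi> i. R"] by metis
  have axes: "pt x 0 = x *\<^sub>R axis 1 1" "pt 0 x = x *\<^sub>R axis 2 1" for x by (simp_all add: pt_def)
  note seg1 = segment_on_axis[of z _ "axis 1 1", folded axes] and seg2 = segment_on_axis[of z _ "axis 2 1", folded axes]
  have g1: "(\<exists>x. z = pt x 0 \<and> x \<le> - a) \<or> z \<in> f ` path_image g \<or> (\<exists>x. z = pt x 0 \<and> 1 - a \<le> x)"
    using z(1) seg1[of "- R" "- a"] seg1[of "1 - a" R] aR unfolding img Un_iff neg_le_iff_le by blast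
  have h1: "(\<exists>x. z = pt 0 x \<and> x \<le> - c) \<or> z \<in> f ` path_image h \<or> (\<exists>x. z = pt 0 x \<and> 1 - c \<le> x)"
    using z(2) seg2[of "- R" "- c"] seg2[of "1 - c" R] aR unfolding imh Un_iff neg_le_iff_le by blast
  \<comment> \<open>The added axis segments lie on rays beyond the chord ends. By \<open>ray\<close>
    these rays contain no point of \<open>K\<close> other than the end itself, so a meeting point on
    an added segment is already on both original curves.\<close>
  have end_ray: "y = E" if "y \<in> K" "E \<in> {A, B, C, D}" "t \<ge> 1" "y = z0 + t *\<^sub>R (E - z0)" for y E t
    using ray[of E t] that by (cases "t = 1") auto
  have onray: "y = z0 + p *\<^sub>R v + r *\<^sub>R w" if "f y = pt p r" for y p r
    using that coord[of y] by (simp add: f_def pt_inj)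
  have prolong: "y \<in> path_image k"
    if k: "pathstart k = z0 - b *\<^sub>R e" "pathfinish k = z0 + (1 - b) *\<^sub>R e" "0 < b" "b < 1"
        "{pathstart k, pathfinish k} \<subseteq> {A, B, C, D}"
      and y: "y \<in> K" "y = z0 + x *\<^sub>R e" "x \<le> - b \<or> 1 - b \<le> x" for k b e x y
    using y(3)
  proof
    assume x: "x \<le> - b"
    have "y = pathstart k"
    proof (rule end_ray[OF y(1)])
      show "1 \<le> x / (- b)" using x k(3) by (simp add: divide_simps)
      show "y = z0 + (x / (- b)) *\<^sub>R (pathstart k - z0)" using y(2) k(1,3) by simp
    qed (use k(5) in simp)
    then show ?thesis by (simp add: pathstart_in_path_image)
  next
    assume x: "1 - b \<le> x"
    have "y = pathfinish k"
    proof (rule end_ray[OF y(1)])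
      show "1 \<le> x / (1 - b)" using x k(4) by (simp add: divide_simps)
      show "y = z0 + (x / (1 - b)) *\<^sub>R (pathfinish k - z0)" using y(2) k(2,4) by simp
    qed (use k(5) in simp)
    then show ?thesis by (simp add: pathfinish_in_path_image)
  qed
  have x_axis: "y \<in> path_image g" if "y \<in> K" "f y = pt x 0" "x \<le> - a \<or> 1 - a \<le> x" for y x
  proof (rule prolong[of g a v, OF _ _ a(1,2) _ that(1) _ that(3)])
    show "y = z0 + x *\<^sub>R v" using onray[OF that(2)] by simp
  qed (use g(3,4) A in auto)
  have y_axis: "y \<in> path_image h" if "y \<in> K" "f y = pt 0 x" "x \<le> - c \<or> 1 - c \<le> x" for y x
  proof (rule prolong[of h c w, OF _ _ c(1,2) _ that(1) _ that(3)])
    show "y = z0 + x *\<^sub>R w" using onray[OF that(2)] by simp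
  qed (use h(3,4) C in auto)
  have both: False if "z = pt x 0" "z = pt 0 y" "x \<le> - a \<or> 1 - a \<le> x" for x y
    using that a(1,2) by (auto simp: pt_inj)
  show ?thesis
  proof (cases "z \<in> f ` path_image g")
    case True
    then obtain y where y: "y \<in> path_image g" "z = f y" by blast
    then have "y \<in> K" using g(2) by blast
    from h1 have "y \<in> path_image h"
    proof (elim disjE)
      assume "z \<in> f ` path_image h"
      then show ?thesis using y(2) f_inj by auto
    qed (use y_axis[OF \<open>y \<in> K\<close>] y(2) in auto)
    then show ?thesis using y by blast
  next
    case False
    then obtain x where x: "z = pt x 0" "x \<le> - a \<or> 1 - a \<le> x" using g1 by blast
    then have "z \<in> f ` path_image h" using h1 both by blast
    then obtain y where y: "y \<in> path_image h" "z = f y" by blast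
    then have "y \<in> K" using h(2) by blast
    then have "y \<in> path_image g" using x_axis x y by auto
    then show ?thesis using y by blast
  qed
qed

section \<open>A convex polygon with one triangle cut off at some of its sides\<close>

lemma det3_on_line:
  assumes "g \<noteq> h" "det3 g h a = 0" "det3 g h b = 0" "det3 g h c = 0"
  shows "det3 a b c = 0"
proof -
  have "x \<in> affine hull {g, h}" if "det3 g h x = 0" for x
    using that assms(1) collinear_3_imp_in_affine_hull[of g h x] by (simp add: collinear_iff_det3)
  then have "{a, b, c} \<subseteq> affine hull {g, h}" using assms by blast
  moreover have "collinear (affine hull {g, h})" by (simp add: collinear_affine_hull_collinear)
  ultimately have "collinear {a, b, c}" using collinear_subset by blast
  then show ?thesis by (simp add: collinear_iff_det3)
qed

lemma mult_mono_equality: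
  fixes x y x' y' :: real
  assumes "0 < x" "0 < y" "x \<le> x'" "y \<le> y'" "x' * y' \<le> x * y"
  shows "x = x' \<and> y = y'"
proof -
  have "x * y \<le> x' * y" "x' * y \<le> x' * y'" using assms by (simp_all add: mult_right_mono mult_left_mono)
  then have "x * y = x' * y" "x' * y = x' * y'" using assms(5) by linarith+
  then show ?thesis using assms by auto
qed

text \<open>This is the image side: \<open>G\<close> lists the hull of \<open>Q\<close> and
  \<open>q\<close> attaches the interior points to the sides in \<open>J\<close>. The hypothesis
  \<open>swap_optimal\<close> is what remains of the choice of an optimal assignment.\<close>

locale hull_config = convex_polygon n G s for n G s +
  fixes J :: "nat set" and q :: "nat \<Rightarrow> complex"
  assumes J: "J \<subseteq> {..<n}"
    and general_position: "point_set (G ` {..<n} \<union> q ` J)"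
    and inj_q: "inj_on q J"
    and q_in_hull: "\<And>i. i \<in> J \<Longrightarrow> q i \<in> convex hull (G ` {..<n})"
    and q_not_G: "q ` J \<inter> G ` {..<n} = {}"
    and hull_side: "\<And>i x. \<lbrakk>i < n; x \<in> G ` {..<n} \<union> q ` J; x \<noteq> G i; x \<noteq> G (Suc i)\<rbrakk>
      \<Longrightarrow> s * det3 (G i) (G (Suc i)) x > 0"
    and swap_optimal: "\<And>i j. \<lbrakk>i \<in> J; j \<in> J; i \<noteq> j\<rbrakk> \<Longrightarrow>
      (s * det3 (G i) (G (Suc i)) (q i)) * (s * det3 (G j) (G (Suc j)) (q j))
      \<le> (s * det3 (G i) (G (Suc i)) (q j)) * (s * det3 (G j) (G (Suc j)) (q i))"
begin

definition S where "S = G ` {..<n} \<union> q ` J"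

text \<open>Proportional to the distance from side \<open>i\<close>. The factor, the length of the
  side times the modulus of \<open>s\<close>, does not depend on the attached point and hence does
  not affect which assignment is optimal.\<close>

definition d where "d i x = s * det3 (G i) (G (Suc i)) x"

lemma point_set_S: "point_set S"
  using general_position by (simp add: S_def)

lemma G_in: "k \<le> n \<Longrightarrow> G k \<in> G ` {..<n}"
  using wrap n3 by (cases "k = n") auto

lemma G_S: "k \<le> n \<Longrightarrow> G k \<in> S"
  using G_in by (auto simp: S_def)

lemma q_S: "i \<in> J \<Longrightarrow> q i \<in> S"
  by (simp add: S_def)

lemma J_less: "i \<in> J \<Longrightarrow> i < n"
  using J by auto

lemma G_neq: "i < j \<Longrightarrow> j < n \<Longrightarrow> G i \<noteq> G j"
proof
  assume ij: "i < j" "j < n" "G i = G j"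
  consider "0 < i" | "i = 0" "j = 1" | "1 < j" "i = 0" using ij by linarith
  then show False
  proof cases
    case 1 then show False using convex_position[of 0 i j] ij by simp
  next
    case 2 then show False using convex_position[of 0 1 2] ij n3 by simp
  next
    case 3 then show False using convex_position[of 0 1 j] ij by simp
  qed
qed

lemma G_eq_iff: "i < n \<Longrightarrow> j < n \<Longrightarrow> G i = G j \<longleftrightarrow> i = j"
  using G_neq by (metis linorder_neqE_nat)

lemma G_Suc_cases: "i < n \<Longrightarrow> (Suc i < n \<or> (Suc i = n \<and> G (Suc i) = G 0))"
  using wrap by (cases "Suc i = n") auto

lemma G_Suc_neq: "i < n \<Longrightarrow> G i \<noteq> G (Suc i)"
proof -
  assume i: "i < n"
  from G_Suc_cases[OF i] show ?thesis
  proof (elim disjE conjE)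
    assume "Suc i < n" then show ?thesis using G_neq[of i "Suc i"] by simp
  next
    assume "Suc i = n" "G (Suc i) = G 0"
    then show ?thesis using G_neq[of 0 i] i n3 by simp
  qed
qed

text \<open>Sides with both ends in common would have to be cyclic successors of each other, which
  is impossible for \<open>n \<ge> 3\<close>.\<close>

lemma common_vertex_unique:
  assumes ij: "i < n" "j < n" "i \<noteq> j"
    and P: "P \<in> {G i, G (Suc i)}" "P \<in> {G j, G (Suc j)}" and P': "P' \<in> {G i, G (Suc i)}" "P' \<in> {G j, G (Suc j)}"
  shows "P = P'"
proof (rule ccontr)
  assume ne: "P \<noteq> P'"
  have "G i \<noteq> G j" using ij by (simp add: G_eq_iff)
  then have "G i = G (Suc j)" "G j = G (Suc i)" using P P' ne by auto
  then have "i = Suc j \<or> (Suc j = n \<and> i = 0)" "j = Suc i \<or> (Suc i = n \<and> j = 0)"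
    using G_Suc_cases[OF ij(1)] G_Suc_cases[OF ij(2)] G_eq_iff ij n3 by (metis zero_less_numeral order_less_le_trans)+
  then show False using n3 by auto
qed

lemma d_affine: "d i ((1 - u) *\<^sub>R x + u *\<^sub>R y) = (1 - u) * d i x + u * d i y"
  unfolding d_def det3_affine by (simp add: algebra_simps)

lemma d_sum3: "u + v + w = 1 \<Longrightarrow> d i (u *\<^sub>R x + v *\<^sub>R y + w *\<^sub>R z) = u * d i x + v * d i y + w * d i z"
  unfolding d_def by (subst det3_sum3) (simp_all add: algebra_simps)

lemma d_vertex [simp]: "d i (G i) = 0" "d i (G (Suc i)) = 0"
  by (simp_all add: d_def)

lemma d_pos: "i < n \<Longrightarrow> x \<in> S \<Longrightarrow> x \<noteq> G i \<Longrightarrow> x \<noteq> G (Suc i) \<Longrightarrow> d i x > 0"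
  using hull_side by (simp add: S_def d_def)

lemma d_nonneg_S: "i < n \<Longrightarrow> x \<in> S \<Longrightarrow> d i x \<ge> 0"
  using d_pos[of i x] by (cases "x = G i \<or> x = G (Suc i)") auto

lemma d_zero: "i < n \<Longrightarrow> x \<in> S \<Longrightarrow> d i x = 0 \<Longrightarrow> x \<in> {G i, G (Suc i)}"
  using d_pos[of i x] by force

lemma q_neq_G: "i \<in> J \<Longrightarrow> k \<le> n \<Longrightarrow> q i \<noteq> G k"
  using q_not_G G_in by fastforce

lemma d_pos_q: "i < n \<Longrightarrow> j \<in> J \<Longrightarrow> d i (q j) > 0"
  using d_pos[of i "q j"] q_neq_G[of j i] q_neq_G[of j "Suc i"] q_S by auto

lemma d_nonneg_hull:
  assumes "i < n" "x \<in> convex hull S"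
  shows "d i x \<ge> 0"
proof -
  have "convex {x. d i x \<ge> 0}"
    unfolding convex_alt by (auto simp: d_affine)
  then have "convex hull S \<subseteq> {x. d i x \<ge> 0}"
    using d_nonneg_S[OF assms(1)] by (intro hull_minimal) auto
  then show ?thesis using assms by auto
qed

section \<open>The triangles cut off at the sides\<close>

definition tri where "tri i = convex hull {G i, G (Suc i), q i}"

lemma tri_cases:
  assumes "x \<in> tri i"
  obtains u v w where "u \<ge> 0" "v \<ge> 0" "w \<ge> 0" "u + v + w = 1" "x = u *\<^sub>R G i + v *\<^sub>R G (Suc i) + w *\<^sub>R q i"
  using assms unfolding tri_def convex_hull_3 by blast

text \<open>A vertex of side \<open>i\<close> with positive weight must lie on side
  \<open>j\<close>, since \<open>d j\<close> is positive at every other point of \<open>S\<close>.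
  Two sides share at most one vertex, so only one vertex carries weight.\<close>

lemma tri_point_on_ray:
  assumes ij: "i < n" "j < n" "i \<noteq> j"
    and x: "u + v + w = 1" "x = u *\<^sub>R G i + v *\<^sub>R G (Suc i) + w *\<^sub>R q i"
    and z: "u * d j (G i) = 0" "v * d j (G (Suc i)) = 0"
  obtains P where "P \<in> {G i, G (Suc i)}" "w = 1 \<or> P \<in> {G j, G (Suc j)}" "x = (1 - w) *\<^sub>R P + w *\<^sub>R q i"
proof -
  have "u = 0 \<or> G i \<in> {G j, G (Suc j)}" "v = 0 \<or> G (Suc i) \<in> {G j, G (Suc j)}"
    using z d_zero[OF ij(2) G_S[of i]] d_zero[OF ij(2) G_S[of "Suc i"]] ij(1) by auto
  then consider "v = 0" "u = 0 \<or> G i \<in> {G j, G (Suc j)}" | "u = 0" "v = 0 \<or> G (Suc i) \<in> {G j, G (Suc j)}"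
    using common_vertex_unique[OF ij, of "G i" "G (Suc i)"] G_Suc_neq[OF ij(1)] by auto
  then show thesis
  proof cases
    case 1
    then have "u = 1 - w" using x(1) by simp
    then show thesis using that[of "G i"] 1 x(2) by auto
  next
    case 2
    then have "v = 1 - w" using x(1) by simp
    then show thesis using that[of "G (Suc i)"] 2 x(2) by auto
  qed
qed

text \<open>For a common point with weights \<open>w\<close>, \<open>w'\<close> at
  \<open>q i\<close>, \<open>q j\<close>, evaluating \<open>d i\<close> and \<open>d j\<close> in
  both triangles gives \<open>w * b \<le> w' * e\<close> and \<open>w' * c \<le> w * a\<close>.
  Together with optimality these are equalities unless the weights vanish. The point then lies on a
  segment from \<open>q i\<close> and on one from \<open>q j\<close> with a common vertex, or is
  itself attached, and general position excludes this.\<close>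

lemma tri_meet:
  assumes i: "i \<in> J" and j: "j \<in> J" and ij: "i \<noteq> j" and xi: "x \<in> tri i" and xj: "x \<in> tri j"
  shows "x \<in> G ` {..<n}"
proof -
  have n: "i < n" "j < n" "Suc i \<le> n" "Suc j \<le> n" using i j J_less by force+
  obtain u v w where x: "u \<ge> 0" "v \<ge> 0" "w \<ge> 0" "u + v + w = 1" "x = u *\<^sub>R G i + v *\<^sub>R G (Suc i) + w *\<^sub>R q i"
    using tri_cases[OF xi] .
  obtain u' v' w' where x': "u' \<ge> 0" "v' \<ge> 0" "w' \<ge> 0" "u' + v' + w' = 1" "x = u' *\<^sub>R G j + v' *\<^sub>R G (Suc j) + w' *\<^sub>R q j"
    using tri_cases[OF xj] .
  define a b c e where "a = d i (q i)" and "b = d j (q i)" and "c = d i (q j)" and "e = d j (q j)"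
  have pos: "a > 0" "b > 0" "c > 0" "e > 0" using d_pos_q n i j by (simp_all add: a_def b_def c_def e_def)
  have opt: "a * e \<le> c * b" using swap_optimal[OF i j ij] by (simp add: a_def b_def c_def e_def d_def)
  have di: "d i x = w * a" using d_sum3[OF x(4)] x(5) by (simp add: a_def)
  have di': "d i x = u' * d i (G j) + v' * d i (G (Suc j)) + w' * c" using d_sum3[OF x'(4)] x'(5) by (simp add: c_def)
  have dj: "d j x = w' * e" using d_sum3[OF x'(4)] x'(5) by (simp add: e_def)
  have dj': "d j x = u * d j (G i) + v * d j (G (Suc i)) + w * b" using d_sum3[OF x(4)] x(5) by (simp add: b_def)
  have nn: "d j (G i) \<ge> 0" "d j (G (Suc i)) \<ge> 0" "d i (G j) \<ge> 0" "d i (G (Suc j)) \<ge> 0"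
    using d_nonneg_S G_S n by simp_all
  have prods: "u * d j (G i) \<ge> 0" "v * d j (G (Suc i)) \<ge> 0" "u' * d i (G j) \<ge> 0" "v' * d i (G (Suc j)) \<ge> 0"
    using nn x x' by simp_all
  have le: "w * b \<le> w' * e" "w' * c \<le> w * a" using di di' dj dj' prods by linarith+
  show ?thesis
  proof (cases "w = 0")
    case True
    then have "w' * c \<le> 0" using le by simp
    then have "w' = 0" using pos x'(3) by (simp add: mult_le_0_iff)
    then have "u * d j (G i) + v * d j (G (Suc i)) = 0" using dj dj' True by simp
    then have "u * d j (G i) = 0" "v * d j (G (Suc i)) = 0" using prods(1,2) by linarith+
    then obtain P where "P \<in> {G i, G (Suc i)}" "x = (1 - w) *\<^sub>R P + w *\<^sub>R q i"
      using tri_point_on_ray[OF n(1,2) ij x(4,5)] by metis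
    then show ?thesis using True G_in n by auto
  next
    case False
    then have w: "w > 0" using x by simp
    then have "0 < w * b" using pos by simp
    then have w': "w' > 0" using le(1) pos x'(3) by (metis less_le_trans mult_zero_left order_le_less)
    \<comment> \<open>The exchange inequality is the reverse of the product of the two inequalities
      in \<open>le\<close>, so neither of them can be strict.\<close>
    have "(w' * e) * (w * a) \<le> (w * b) * (w' * c)"
      using mult_left_mono[OF opt, of "w * w'"] w w' by (simp add: mult_ac)
    then have eq: "w * b = w' * e \<and> w' * c = w * a"
      using le w w' pos by (intro mult_mono_equality) simp_all
    have z: "u * d j (G i) = 0" "v * d j (G (Suc i)) = 0" using dj dj' prods eq by linarith+
    have z': "u' * d i (G j) = 0" "v' * d i (G (Suc j)) = 0" using di di' prods eq by linarith+
    obtain P where P: "P \<in> {G i, G (Suc i)}" "w = 1 \<or> P \<in> {G j, G (Suc j)}" "x = (1 - w) *\<^sub>R P + w *\<^sub>R q i"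
      using tri_point_on_ray[OF n(1,2) ij x(4,5) z] .
    obtain P' where P': "P' \<in> {G j, G (Suc j)}" "w' = 1 \<or> P' \<in> {G i, G (Suc i)}" "x = (1 - w') *\<^sub>R P' + w' *\<^sub>R q j"
      using tri_point_on_ray[OF n(2,1) ij[symmetric] x'(4,5) z'] .
    have PS: "P \<in> S" "P' \<in> S" using P(1) P'(1) G_S n by auto
    have Pq: "P \<noteq> q i" "P \<noteq> q j" "P' \<noteq> q i" "P' \<noteq> q j"
      using P(1) P'(1) q_neq_G[OF i] q_neq_G[OF j] n by (metis less_imp_le insertE singletonD)+
    have qq: "q i \<noteq> q j" using inj_q i j ij by (meson inj_onD)
    have w1: "w \<le> 1" "w' \<le> 1" using x x' by linarith+
    have seg: "x \<in> closed_segment P (q i)" "x \<in> closed_segment P' (q j)"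
      unfolding in_segment using P(3) P'(3) w w' w1 by (metis less_imp_le)+
    show ?thesis
    proof (cases "w = 1 \<or> w' = 1")
      case True
      then show ?thesis
      proof
        assume "w = 1"
        then have "x = q i" using P(3) by simp
        then show ?thesis using point_set_closed_segment[OF point_set_S PS(2) q_S[OF j] q_S[OF i] Pq(4)] seg(2) qq Pq by simp
      next
        assume "w' = 1"
        then have "x = q j" using P'(3) by simp
        then show ?thesis using point_set_closed_segment[OF point_set_S PS(1) q_S[OF i] q_S[OF j] Pq(1)] seg(1) qq Pq by simp
      qed
    next
      case False
      then have "P = P'" using common_vertex_unique[OF n(1,2) ij, of P P'] P P' by simp
      then have "det3 P (q i) x = w' * det3 P (q i) (q j)" using P'(3) by (simp add: det3_affine)
      moreover have "det3 P (q i) x = 0" using seg(1) by (rule det3_closed_segment_0)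
      ultimately have "det3 P (q i) (q j) = 0" using w' by simp
      then show ?thesis using point_set_det3[OF point_set_S PS(1) q_S[OF i] q_S[OF j]] Pq qq by simp
    qed
  qed
qed

text \<open>A hull vertex \<open>G k\<close> lies on side \<open>k\<close>, where \<open>d k\<close>
  vanishes although it is positive at \<open>q i\<close>. So \<open>q i\<close> has weight zero and
  the vertex is on side \<open>i\<close>. Other attached points are excluded by
  \<open>tri_meet\<close>.\<close>

lemma tri_vertices:
  assumes i: "i \<in> J" and x: "x \<in> S" "x \<in> tri i"
  shows "x \<in> {G i, G (Suc i), q i}"
proof -
  consider k where "k < n" "x = G k" | j where "j \<in> J" "j \<noteq> i" "x = q j" | "x = q i" using x(1) unfolding S_def by blast
  then show ?thesis
  proof cases
    case 1
    have n: "i < n" "Suc i \<le> n" using J_less[OF i] by auto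
    obtain u v w where h: "u \<ge> 0" "v \<ge> 0" "w \<ge> 0" "u + v + w = 1" "x = u *\<^sub>R G i + v *\<^sub>R G (Suc i) + w *\<^sub>R q i"
      using tri_cases[OF x(2)] .
    have "d k x = u * d k (G i) + v * d k (G (Suc i)) + w * d k (q i)" unfolding h(5) by (rule d_sum3[OF h(4)])
    moreover have "d k x = 0" using 1 by simp
    moreover have "u * d k (G i) \<ge> 0" "v * d k (G (Suc i)) \<ge> 0" using h d_nonneg_S[OF 1(1)] G_S n by simp_all
    moreover have "w * d k (q i) \<ge> 0" using h d_pos_q[OF 1(1) i] by simp
    ultimately have "w * d k (q i) = 0" by linarith
    then have "w = 0" using d_pos_q[OF 1(1) i] by simp
    then have "d i x = 0" unfolding h(5) d_sum3[OF h(4)] by simp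
    then show ?thesis using d_zero[OF n(1) x(1)] by auto
  next
    case (2 j)
    then have "x \<in> tri j" unfolding tri_def by (auto intro: hull_inc)
    then have "x \<in> G ` {..<n}" using tri_meet[OF i 2(1) _ x(2)] 2 by auto
    then show ?thesis using 2 q_not_G by blast
  qed simp
qed

text \<open>Label \<open>2 * i\<close> stands for the hull vertex \<open>G i\<close> and label \<open>2 * i + 1\<close> for the point \<open>q i\<close> attached
  to the side from \<open>G i\<close> to \<open>G (Suc i)\<close>, so the order of the labels is the order along the polygon
  that is left after cutting off the triangles \<open>tri i\<close>.\<close>

definition V where "V x = (if even x then G (x div 2) else q (x div 2))"

definition L where "L = {x. x < 2 * n \<and> (odd x \<longrightarrow> x div 2 \<in> J)}"

text \<open>The label pairs of the hull edges, whether or not the label of an attached point belongs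
  to \<open>L\<close>; the second disjunct is the last side.\<close>

definition short where "short x y \<longleftrightarrow> (even x \<and> y = x + 2) \<or> (x = 0 \<and> y = 2 * n - 2)"

text \<open>The prolongation of an edge from its end to the hull, running inside the cut-off
  triangle for an odd label. For an even label it degenerates to the hull vertex.\<close>

definition stub where "stub x = closed_segment (bd x) (V x)"

lemma V_simps [simp]: "V (2 * i) = G i" "V (Suc (2 * i)) = q i"
  by (simp_all add: V_def)

lemma L_cases:
  assumes "x \<in> L"
  obtains i where "i < n" "x = 2 * i" "V x = G i" "stub x = {G i}"
    | i where "i \<in> J" "i < n" "x = Suc (2 * i)" "V x = q i" "stub x = closed_segment (midpoint (G i) (G (Suc i))) (q i)"
proof (cases "even x")
  case True
  then obtain i where "x = 2 * i" by blast
  then show thesis using that(1)[of i] assms by (auto simp: L_def stub_def)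
next
  case False
  then obtain i where "x = Suc (2 * i)" by (metis oddE Suc_eq_plus1)
  then show thesis using that(2)[of i] assms J_less by (auto simp: L_def stub_def)
qed

lemma V_in_S: "x \<in> L \<Longrightarrow> V x \<in> S"
  by (erule L_cases) (auto simp: G_S q_S)

lemma V_eq_iff:
  assumes "x \<in> L" "y \<in> L"
  shows "V x = V y \<longleftrightarrow> x = y"
  using assms(1)
proof (cases rule: L_cases)
  case x: (1 i)
  show ?thesis using assms(2)
  proof (cases rule: L_cases)
    case (1 j)
    then show ?thesis using x G_eq_iff[of i j] by auto
  next
    case (2 j)
    then have "V x \<noteq> V y" using x q_neq_G[of j i] by (metis less_imp_le)
    moreover have "x \<noteq> y" using x 2 by presburger
    ultimately show ?thesis by simp
  qed
next
  case x: (2 i)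
  show ?thesis using assms(2)
  proof (cases rule: L_cases)
    case (1 j)
    then have "V x \<noteq> V y" using x q_neq_G[of i j] by (metis less_imp_le)
    moreover have "x \<noteq> y" using x 1 by presburger
    ultimately show ?thesis by simp
  next
    case (2 j)
    then show ?thesis using x inj_onD[OF inj_q, of i j] by auto
  qed
qed

lemma V_image: "V ` L = S"
  unfolding L_def labels_eq[OF J] S_def by (simp add: image_Un image_image)

lemma V_eq_G:
  assumes "x \<in> L" "V x = G i" "i < n"
  shows "x = 2 * i"
proof -
  have "2 * i \<in> L" using assms(3) by (simp add: L_def)
  then show ?thesis using V_eq_iff[OF assms(1), of "2 * i"] assms(2) by simp
qed

lemma V_eq_q:
  assumes "x \<in> L" "V x = q i" "i \<in> J"
  shows "x = Suc (2 * i)"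
proof -
  have "Suc (2 * i) \<in> L" using assms(3) J_less[OF assms(3)] by (simp add: L_def)
  then show ?thesis using V_eq_iff[OF assms(1), of "Suc (2 * i)"] assms(2) by simp
qed

lemma V_eq_G_Suc:
  assumes "x \<in> L" "V x = G (Suc i)" "i < n"
  shows "x = 2 * i + 2 \<or> (x = 0 \<and> Suc i = n)"
proof (cases "Suc i = n")
  case True
  then have "V x = G 0" using assms(2) wrap by simp
  then show ?thesis using V_eq_G[OF assms(1), of 0] True n3 by simp
next
  case False
  then show ?thesis using V_eq_G[OF assms(1,2)] assms(3) by simp
qed

lemma stub_in_tri:
  assumes "i \<in> J" "p \<in> closed_segment (midpoint (G i) (G (Suc i))) (q i)"
  obtains t where "0 \<le> t" "t \<le> 1" "p = (1 - t) *\<^sub>R midpoint (G i) (G (Suc i)) + t *\<^sub>R q i"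
    "p = ((1 - t) / 2) *\<^sub>R G i + ((1 - t) / 2) *\<^sub>R G (Suc i) + t *\<^sub>R q i" "p \<in> tri i"
proof -
  obtain t where t: "0 \<le> t" "t \<le> 1" "p = (1 - t) *\<^sub>R midpoint (G i) (G (Suc i)) + t *\<^sub>R q i"
    using assms by (auto simp: in_segment)
  have eq: "p = ((1 - t) / 2) *\<^sub>R G i + ((1 - t) / 2) *\<^sub>R G (Suc i) + t *\<^sub>R q i"
    unfolding t(3) midpoint_def by (simp add: scaleR_add_right)
  moreover have "p \<in> tri i" unfolding tri_def convex_hull_3
    using t eq by (intro CollectI exI[of _ "(1 - t) / 2"] exI[of _ t]) auto
  ultimately show thesis using that t by blast
qed

lemma stub_not_vertex:
  assumes i: "i \<in> J" and p: "p \<in> closed_segment (midpoint (G i) (G (Suc i))) (q i)"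
  shows "p \<notin> G ` {..<n}"
proof
  assume G: "p \<in> G ` {..<n}"
  then obtain k where k: "k < n" "p = G k" by blast
  have n: "i < n" "Suc i \<le> n" using J_less[OF i] by auto
  obtain t where t: "0 \<le> t" "t \<le> 1" "p = ((1 - t) / 2) *\<^sub>R G i + ((1 - t) / 2) *\<^sub>R G (Suc i) + t *\<^sub>R q i"
    "p = (1 - t) *\<^sub>R midpoint (G i) (G (Suc i)) + t *\<^sub>R q i"
    using stub_in_tri[OF i p] by metis
  have "d k p = ((1 - t) / 2) * d k (G i) + ((1 - t) / 2) * d k (G (Suc i)) + t * d k (q i)"
    unfolding t(3) by (rule d_sum3) simp
  moreover have "d k p = 0" using k by simp
  moreover have "((1 - t) / 2) * d k (G i) \<ge> 0" "((1 - t) / 2) * d k (G (Suc i)) \<ge> 0"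
    using t d_nonneg_S[OF k(1)] G_S n by simp_all
  moreover have "t * d k (q i) \<ge> 0" using t d_pos_q[OF k(1) i] by simp
  ultimately have "t * d k (q i) = 0" by linarith
  then have t0: "t = 0" using d_pos_q[OF k(1) i] by simp
  then have pm: "p = midpoint (G i) (G (Suc i))" using t(4) by simp
  have "d i p = 0" unfolding t(3) using d_sum3[of "(1 - t) / 2" "(1 - t) / 2" t] t0 by simp
  moreover have "p \<in> S" using G by (simp add: S_def)
  ultimately have "p = G i \<or> p = G (Suc i)" using d_zero[OF n(1)] by auto
  then show False using pm G_Suc_neq[OF n(1)] by (auto simp: midpoint_eq_endpoint)
qed

lemma stubs_disjoint:
  assumes "x \<in> L" "y \<in> L" "x \<noteq> y"
  shows "stub x \<inter> stub y = {}"
  using assms(1)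
proof (cases rule: L_cases)
  case x: (1 i)
  show ?thesis using assms(2)
  proof (cases rule: L_cases)
    case (1 j)
    then show ?thesis using x G_eq_iff assms(3) by auto
  next
    case (2 j)
    then show ?thesis using x stub_not_vertex[of j] by blast
  qed
next
  case x: (2 i)
  show ?thesis using assms(2)
  proof (cases rule: L_cases)
    case (1 j)
    then show ?thesis using x stub_not_vertex[of i] by blast
  next
    case (2 j)
    then have ij: "i \<noteq> j" using x assms(3) by auto
    show ?thesis
    proof (rule ccontr)
      assume "\<not> ?thesis"
      then obtain p where p: "p \<in> closed_segment (midpoint (G i) (G (Suc i))) (q i)"
        "p \<in> closed_segment (midpoint (G j) (G (Suc j))) (q j)" using x 2 by auto
      then have "p \<in> tri i" "p \<in> tri j" using stub_in_tri x(1) 2(1) by metis+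
      then show False using tri_meet[OF x(1) 2(1) ij] stub_not_vertex[OF x(1) p(1)] by blast
    qed
  qed
qed

lemma short_if_hull_edge:
  assumes "x \<in> L" "y \<in> L" "x < y" "i < n" "{V x, V y} = {G i, G (Suc i)}"
  shows "short x y"
  using assms(5) V_eq_G[OF assms(1) _ assms(4)] V_eq_G[OF assms(2) _ assms(4)]
    V_eq_G_Suc[OF assms(1) _ assms(4)] V_eq_G_Suc[OF assms(2) _ assms(4)] assms(3)
  unfolding doubleton_eq_iff short_def by force

section \<open>Edges of a spanning set do not interleave\<close>

definition spanning :: "complex set set \<Rightarrow> bool" where
  "spanning T \<longleftrightarrow> T \<subseteq> edges S \<and> noncrossing T \<and> (\<forall>i<n. closed_segment (G i) (G (Suc i)) \<in> T) \<and>
    (\<forall>i\<in>J. closed_segment (G i) (q i) \<in> T \<and> closed_segment (q i) (G (Suc i)) \<in> T)"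

text \<open>An edge that meets the stub and has an endpoint outside the triangle would leave through
  a side at \<open>q i\<close>, which is itself in \<open>T\<close>, or through the hull. With both
  ends in the triangle and neither equal to \<open>q i\<close>, it is the hull edge, which
  \<open>ns\<close> excludes.\<close>

lemma stub_edge_disjoint:
  assumes T: "spanning T" and x: "x \<in> L" and yz: "y \<in> L" "z \<in> L" "closed_segment (V y) (V z) \<in> T"
    and ne: "x \<noteq> y" "x \<noteq> z" and ns: "\<And>i. i < n \<Longrightarrow> {V y, V z} \<noteq> {G i, G (Suc i)}"
  shows "stub x \<inter> closed_segment (V y) (V z) = {}"
proof (rule ccontr)
  assume "\<not> ?thesis"
  then obtain p where p: "p \<in> stub x" "p \<in> closed_segment (V y) (V z)" by blast
  have sub: "T \<subseteq> edges S" and ncr: "noncrossing T" using T by (auto simp: spanning_def)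
  have yzS: "V y \<in> S" "V z \<in> S" "V y \<noteq> V z" using yz sub closed_segment_in_edges_iff by blast+
  have Vx: "V x \<in> S" "V x \<noteq> V y" "V x \<noteq> V z" using V_in_S V_eq_iff x yz ne by auto
  have endp: "r = V y \<or> r = V z" if "r \<in> S" "r \<in> closed_segment (V y) (V z)" for r
    using point_set_closed_segment[OF point_set_S yzS(1,2) that(1) yzS(3) that(2)] .
  have pVx: "p \<noteq> V x" using endp p Vx by auto
  from x show False
  proof (cases rule: L_cases)
    case 1
    then show False using p pVx by auto
  next
    case (2 i)
    have n: "i < n" "Suc i \<le> n" using 2 by auto
    have pst: "p \<in> closed_segment (midpoint (G i) (G (Suc i))) (q i)" using p 2 by simp
    obtain t where t: "0 \<le> t" "t \<le> 1" "p = ((1 - t) / 2) *\<^sub>R G i + ((1 - t) / 2) *\<^sub>R G (Suc i) + t *\<^sub>R q i"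
      "p = (1 - t) *\<^sub>R midpoint (G i) (G (Suc i)) + t *\<^sub>R q i" "p \<in> tri i"
      using stub_in_tri[OF 2(1) pst] by metis
    have pS: "p \<notin> S"
    proof
      assume "p \<in> S"
      then have "p \<in> {G i, G (Suc i), q i}" using tri_vertices[OF 2(1)] t(5) by blast
      then show False using stub_not_vertex[OF 2(1) pst] pVx 2 G_in n by auto
    qed
    have D: "det3 (G i) (G (Suc i)) (q i) \<noteq> 0" using d_pos_q[OF n(1) 2(1)] by (auto simp: d_def)
    \<comment> \<open>Leaving through a side at \<open>q i\<close> without crossing it forces the
      exit point to be a common endpoint. This must be the other end \<open>g'\<close>, and then
      \<open>p\<close> coincides with \<open>g'\<close> although it is not in
      \<open>S\<close>.\<close>
    have outside: False if g: "g \<in> {V y, V z}" "g \<notin> tri i" and g': "g' \<in> {V y, V z}" "g' \<noteq> g" for g g'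
    proof -
      have gS: "g \<in> S" "g' \<in> S" using g g' yzS by auto
      have seg: "closed_segment g g' = closed_segment (V y) (V z)" using g g' by (auto simp: closed_segment_commute)
      have pg: "closed_segment p g \<subseteq> closed_segment (V y) (V z)" using p(2) g(1) by (auto simp: subset_closed_segment)
      obtain r where r: "r \<in> closed_segment p g"
        "(r \<in> closed_segment (G (Suc i)) (q i)) \<or> (r \<in> closed_segment (q i) (G i)) \<or> bary (q i) (G i) (G (Suc i)) g < 0"
        using triangle_exit[OF D] t(5) g(2) unfolding tri_def by metis
      have "bary (q i) (G i) (G (Suc i)) g = d i g / d i (q i)"
      proof -
        have "s \<noteq> 0" using d_pos_q[OF n(1) 2(1)] by (auto simp: d_def)
        then show ?thesis by (simp add: bary_def d_def det3_cyclic)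
      qed
      then have "bary (q i) (G i) (G (Suc i)) g \<ge> 0" using d_nonneg_S[OF n(1) gS(1)] d_pos_q[OF n(1) 2(1)] by simp
      then have "r \<in> closed_segment (q i) (G (Suc i)) \<or> r \<in> closed_segment (q i) (G i)"
        using r(2) closed_segment_commute[of "G (Suc i)" "q i"] by auto
      then obtain k where k: "k \<in> {i, Suc i}" "r \<in> closed_segment (q i) (G k)" by blast
      have kT: "closed_segment (q i) (G k) \<in> T" using T k(1) 2(1) by (auto simp: spanning_def closed_segment_commute)
      have rin: "r \<in> closed_segment (V y) (V z)" using r pg by blast
      have "{q i, G k} = {V y, V z} \<or> (r \<in> {q i, G k} \<and> r \<in> {V y, V z})"
        using noncrossing_meet[OF point_set_S sub ncr kT k(2) yz(3) rin] .
      then have rr: "r \<in> {q i, G k}" "r \<in> {V y, V z}" using Vx 2 by (auto simp: doubleton_eq_iff)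
      then have "r = G k" using Vx 2 by auto
      then have "r \<in> tri i" using k(1) unfolding tri_def by (auto intro: hull_inc)
      then have "r = g'" using rr(2) g g' by auto
      have "p \<in> closed_segment g' g" using p(2) unfolding seg[symmetric] by (subst closed_segment_commute)
      then have "p = g'" using closed_segment_antisym[of p g' g] r(1) \<open>r = g'\<close> by blast
      then show False using pS gS by simp
    qed
    have "V y \<in> tri i" "V z \<in> tri i" using outside[of "V y" "V z"] outside[of "V z" "V y"] yzS(3) by auto
    then have "V y \<in> {G i, G (Suc i), q i}" "V z \<in> {G i, G (Suc i), q i}" using tri_vertices[OF 2(1)] yzS by blast+
    then have "{V y, V z} = {G i, G (Suc i)}" using Vx 2 yzS(3) by auto
    then show False using ns n by blast
  qed
qed

lemma bd_in_hull: "x \<in> L \<Longrightarrow> bd x \<in> convex hull S"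
proof (erule L_cases)
  fix i assume "i < n" "x = 2 * i"
  then show ?thesis using G_S[of i] by (auto intro: hull_inc)
next
  fix i assume i: "i < n" "x = Suc (2 * i)"
  have "closed_segment (G i) (G (Suc i)) \<subseteq> convex hull S"
    using G_S[of i] G_S[of "Suc i"] i by (intro closed_segment_subset) (auto intro: hull_inc)
  then show ?thesis using i by auto
qed

lemma d_bd: "d (x div 2) (bd x) = 0"
proof (cases "even x")
  case True
  then show ?thesis by (auto simp: bd_def)
next
  case False
  then obtain i where "x = Suc (2 * i)" by (metis oddE Suc_eq_plus1)
  then show ?thesis by (simp add: d_def det3_midpoint)
qed

text \<open>Since neither pair is short, no three of the four labels are flat, so the chords between
  the boundary points cross and the prolonged edges must meet. Each curve consists of an edge and
  two stubs, and all nine intersections of their pieces are empty.\<close>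

lemma no_interleaving:
  assumes T: "spanning T" and lab: "x \<in> L" "z \<in> L" "y \<in> L" "w \<in> L" and lt: "x < z" "z < y" "y < w"
    and e: "closed_segment (V x) (V y) \<in> T" "closed_segment (V z) (V w) \<in> T"
    and ns: "\<not> short x y" "\<not> short z w"
  shows False
proof -
  have sub: "T \<subseteq> edges S" and ncr: "noncrossing T" using T by (auto simp: spanning_def)
  have w2: "w < 2 * n" using lab by (simp add: L_def)
  have ns1: "\<And>i. i < n \<Longrightarrow> {V x, V y} \<noteq> {G i, G (Suc i)}" using short_if_hull_edge[of x y] lab lt ns by auto
  have ns2: "\<And>i. i < n \<Longrightarrow> {V z, V w} \<noteq> {G i, G (Suc i)}" using short_if_hull_edge[of z w] lab lt ns by auto
  have "\<not> flat x z y" "\<not> flat x y w" "\<not> flat z y w" "\<not> flat x z w"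
    using lt w2 ns by (auto simp: flat_def short_def)
  then have pos: "s * det3 (bd x) (bd z) (bd y) > 0" "s * det3 (bd x) (bd y) (bd w) > 0"
    "s * det3 (bd z) (bd y) (bd w) > 0" "s * det3 (bd x) (bd z) (bd w) > 0"
    using bd_position lt w2 by auto
  obtain o' where o': "o' \<in> open_segment (bd x) (bd y)" "o' \<in> open_segment (bd z) (bd w)"
    using open_segments_cross[OF pos] .
  have S_fin: "finite S" using point_set_S by (simp add: point_set_def)
  have ncl: "det3 (bd x) (bd y) (bd z) \<noteq> 0" using pos(1) by (auto simp: det3_swap2[of "bd x" "bd z"])
  let ?K = "convex hull S"
  have segK: "closed_segment a b \<subseteq> ?K" if "a \<in> ?K" "b \<in> ?K" for a b using that by (simp add: closed_segment_subset)
  have VK: "V a \<in> ?K" if "a \<in> L" for a using V_in_S[OF that] by (rule hull_inc)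
  have o'K: "o' \<in> ?K" using o'(1) segK[OF bd_in_hull bd_in_hull, OF lab(1,3)] by (auto simp: open_segment_def)
  \<comment> \<open>The boundary point \<open>X\<close> lies on a side where \<open>d i\<close>
    vanishes. Going past it from \<open>o'\<close> would make \<open>d i\<close> negative unless
    \<open>o'\<close> is on that side too, and then both chords would lie on one line.\<close>
  have ray: "o' + t *\<^sub>R (X - o') \<notin> ?K" if X: "X \<in> {bd x, bd y, bd z, bd w}" and t: "t > 1" for X t
  proof
    assume inK: "o' + t *\<^sub>R (X - o') \<in> ?K"
    obtain a where a: "a \<in> L" "X = bd a" using X lab by auto
    define i where "i = a div 2"
    have i: "i < n" using a by (auto simp: i_def L_def)
    have "o' + t *\<^sub>R (X - o') = (1 - t) *\<^sub>R o' + t *\<^sub>R X" by (simp add: algebra_simps)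
    then have "(1 - t) * d i o' + t * d i X \<ge> 0" using d_nonneg_hull[OF i inK] d_affine by metis
    then have "(1 - t) * d i o' \<ge> 0" using d_bd[of a] a(2) i_def by simp
    then have "d i o' \<le> 0" using t by (simp add: zero_le_mult_iff)
    then have o0: "d i o' = 0" using d_nonneg_hull[OF i o'K] by simp
    have nn: "d i (bd b) \<ge> 0" if "b \<in> L" for b using d_nonneg_hull[OF i bd_in_hull[OF that]] .
    have zero: "d i (bd b) = 0 \<and> d i (bd c) = 0" if bc: "b \<in> L" "c \<in> L" "o' \<in> open_segment (bd b) (bd c)" for b c
    proof -
      obtain u where u: "0 < u" "u < 1" "o' = (1 - u) *\<^sub>R bd b + u *\<^sub>R bd c" using bc(3) by (auto simp: in_segment)
      have "(1 - u) * d i (bd b) + u * d i (bd c) = 0" using o0 u(3) d_affine by metis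
      moreover have "(1 - u) * d i (bd b) \<ge> 0" "u * d i (bd c) \<ge> 0" using u nn bc by simp_all
      ultimately have "(1 - u) * d i (bd b) = 0" "u * d i (bd c) = 0" by linarith+
      then show ?thesis using u by simp
    qed
    have "d i (bd x) = 0" "d i (bd y) = 0" "d i (bd z) = 0" using zero o' lab by blast+
    moreover have "s \<noteq> 0" using pos by auto
    ultimately have "det3 (bd x) (bd y) (bd z) = 0"
      using det3_on_line[OF G_Suc_neq[OF i]] by (simp add: d_def)
    then show False using ncl by simp
  qed
  define g where "g = linepath (bd x) (V x) +++ linepath (V x) (V y) +++ linepath (V y) (bd y)"
  define h where "h = linepath (bd z) (V z) +++ linepath (V z) (V w) +++ linepath (V w) (bd w)"
  have img: "path_image g = stub x \<union> closed_segment (V x) (V y) \<union> stub y"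
    unfolding g_def stub_def by (simp add: path_image_join closed_segment_commute[of "V y" "bd y"] Un_assoc)
  have imh: "path_image h = stub z \<union> closed_segment (V z) (V w) \<union> stub w"
    unfolding h_def stub_def by (simp add: path_image_join closed_segment_commute[of "V w" "bd w"] Un_assoc)
  have stubK: "stub a \<subseteq> ?K" if "a \<in> L" for a
    unfolding stub_def using segK bd_in_hull VK that by blast
  have "path_image g \<inter> path_image h \<noteq> {}"
  proof (rule chords_curves_meet[OF _ o' ncl ray])
    show "bounded ?K" using S_fin by (simp add: finite_imp_bounded bounded_convex_hull)
    show "path_image g \<subseteq> ?K" "path_image h \<subseteq> ?K"
      unfolding img imh using stubK segK VK lab by blast+
  qed (auto simp: g_def h_def)
  moreover have "stub x \<inter> stub z = {}" "stub x \<inter> stub w = {}" "stub y \<inter> stub z = {}" "stub y \<inter> stub w = {}"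
    using stubs_disjoint lab lt by auto
  moreover have "stub x \<inter> closed_segment (V z) (V w) = {}" "stub y \<inter> closed_segment (V z) (V w) = {}"
    using stub_edge_disjoint[OF T _ lab(2,4) e(2) _ _ ns2] lab lt by auto
  moreover have "stub z \<inter> closed_segment (V x) (V y) = {}" "stub w \<inter> closed_segment (V x) (V y) = {}"
    using stub_edge_disjoint[OF T _ lab(1,3) e(1) _ _ ns1] lab lt by auto
  moreover have "closed_segment (V x) (V y) \<inter> closed_segment (V z) (V w) = {}"
  proof (rule ccontr)
    assume "\<not> ?thesis"
    then obtain p where p: "p \<in> closed_segment (V x) (V y)" "p \<in> closed_segment (V z) (V w)" by blast
    have "{V x, V y} = {V z, V w} \<or> (p \<in> {V x, V y} \<and> p \<in> {V z, V w})"
      using noncrossing_meet[OF point_set_S sub ncr e(1) p(1) e(2) p(2)] .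
    moreover have "V x \<noteq> V z" "V x \<noteq> V w" "V y \<noteq> V z" "V y \<noteq> V w"
      using V_eq_iff lab lt by auto
    ultimately show False by (auto simp: doubleton_eq_iff)
  qed
  ultimately show False unfolding img imh by blast
qed

end

section \<open>Triangulations of the remaining polygon\<close>

text \<open>Take a shortest present pair \<open>i\<close>, \<open>j\<close> enclosing
  \<open>x\<close>, \<open>y\<close>. If it is a different pair, its apex lies strictly between
  \<open>x\<close> and \<open>y\<close>, as otherwise a shorter enclosing pair is present; the pair
  of the apex with \<open>i\<close> or with \<open>j\<close> then interleaves.\<close>

lemma pairs_maximal:
  fixes D :: "nat \<Rightarrow> nat \<Rightarrow> bool" and m :: nat
  assumes base: "D 0 m" and apex: "\<And>i j. \<lbrakk>D i j; i < j; \<exists>l\<in>L. i < l \<and> l < j\<rbrakk> \<Longrightarrow> \<exists>c. i < c \<and> c < j \<and> D i c \<and> D c j"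
    and xy: "x \<in> L" "y \<in> L" "x < y" "y \<le> m"
  shows "D x y \<or> (\<exists>i j. i < j \<and> D i j \<and> (i < x \<and> x < j \<and> j < y \<or> x < i \<and> i < y \<and> y < j))"
proof -
  define Q where "Q = (\<lambda>k. \<exists>i j. D i j \<and> i \<le> x \<and> y \<le> j \<and> k = j - i)"
  have "Q m" unfolding Q_def using base xy by (intro exI[of _ 0] exI[of _ m]) auto
  then have "Q (LEAST k. Q k)" by (rule LeastI)
  then obtain i j where ij: "D i j" "i \<le> x" "y \<le> j" "(LEAST k. Q k) = j - i" unfolding Q_def by blast
  have min: "j - i \<le> j' - i'" if "D i' j'" "i' \<le> x" "y \<le> j'" for i' j'
    using Least_le[of Q "j' - i'"] that ij(4) unfolding Q_def by auto
  show ?thesis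
  proof (cases "i = x \<and> j = y")
    case False
    have "\<exists>l\<in>L. i < l \<and> l < j"
    proof (cases "i = x")
      case True
      then have "y < j" using False ij by simp
      then show ?thesis using xy True by blast
    next
      case False
      then have "i < x" "x < j" using ij xy by simp_all
      then show ?thesis using xy by blast
    qed
    then obtain c where c: "i < c" "c < j" "D i c" "D c j" using apex[OF ij(1)] ij xy by auto
    have "\<not> c \<le> x" using min[OF c(4)] c ij by auto
    moreover have "\<not> y \<le> c" using min[OF c(3)] c ij by auto
    ultimately have cc: "x < c" "c < y" by auto
    show ?thesis
    proof (cases "i = x")
      case True
      then have "y < j" using False ij by auto
      then show ?thesis using c cc by blast
    next
      case False
      then have "i < x" using ij by simp
      then show ?thesis using c cc by blast
    qed
  qed (use ij in auto)
qed

text \<open>With a point or a segment of the boundary line for \<open>C\<close>, this controls which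
  points of that line can lie in a convex hull; a closed half-plane would be too weak for
  that.\<close>

lemma convex_open_halfplane_Un:
  assumes "convex C" and nn: "\<And>x. x \<in> C \<Longrightarrow> t * det3 a b x \<ge> 0"
  shows "convex ({x. t * det3 a b x > 0} \<union> C)"
proof -
  have "(1 - u) *\<^sub>R x + u *\<^sub>R y \<in> {x. t * det3 a b x > 0} \<union> C"
    if x: "x \<in> {x. t * det3 a b x > 0} \<union> C" and y: "y \<in> {x. t * det3 a b x > 0} \<union> C" and u: "0 \<le> u" "u \<le> 1" for x y u
  proof (cases "x \<in> C \<and> y \<in> C")
    case True
    then show ?thesis using assms(1) u unfolding convex_alt by blast
  next
    case False
    define X Y where "X = t * det3 a b x" and "Y = t * det3 a b y"
    have XY: "X \<ge> 0" "Y \<ge> 0" "X > 0 \<or> Y > 0" using x y False nn[of x] nn[of y] by (auto simp: X_def Y_def)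
    have eq: "t * det3 a b ((1 - u) *\<^sub>R x + u *\<^sub>R y) = (1 - u) * X + u * Y"
      unfolding det3_affine X_def Y_def by (simp add: algebra_simps)
    consider "u = 0" | "u = 1" | "0 < u" "u < 1" using u by linarith
    then show ?thesis
    proof cases
      case 3
      then have "(1 - u) * X + u * Y > 0" using XY by (auto intro: add_pos_nonneg add_nonneg_pos)
      then show ?thesis using eq by simp
    qed (use x y in auto)
  qed
  then show ?thesis unfolding convex_alt by blast
qed

context hull_config
begin

text \<open>Hull edges that cut off one of the points \<open>q i\<close>; they lie outside the polygon.\<close>

definition flipped where
  "flipped x y \<longleftrightarrow> (even x \<and> y = x + 2 \<and> x + 1 \<in> L) \<or> (x = 0 \<and> y = 2 * n - 2 \<and> 2 * n - 1 \<in> L)"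

lemma flipped_edge:
  assumes "x \<in> L" "y \<in> L" "x < y" "flipped x y"
  obtains i where "i \<in> J" "{V x, V y} = {G i, G (Suc i)}"
proof (cases "even x \<and> y = x + 2 \<and> x + 1 \<in> L")
  case True
  then obtain i where i: "x = 2 * i" by blast
  then have "y = 2 * Suc i" using True by simp
  moreover have "i \<in> J" using True i by (auto simp: L_def)
  ultimately show thesis using that[of i] i by (simp del: mult_Suc_right)
next
  case False
  then have *: "x = 0" "y = 2 * n - 2" "2 * n - 1 \<in> L" using assms(4) by (auto simp: flipped_def)
  define i where "i = n - 1"
  have i: "Suc i = n" using n3 by (simp add: i_def)
  have "odd (2 * n - 1)" "(2 * n - 1) div 2 = i" using n3 i by (auto simp: i_def)
  then have "i \<in> J" using *(3) by (simp add: L_def)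
  moreover have "x = 2 * 0" "y = 2 * i" using * i by auto
  then have "V x = G (Suc i)" "V y = G i" using i wrap by (metis V_simps(1))+
  ultimately show thesis using that[of i] by (simp add: insert_commute)
qed

text \<open>If one side were empty, the line would support the hull and \<open>V i\<close> would be
  a hull vertex \<open>G k\<close>. But both neighbours of \<open>G k\<close> differ from
  \<open>V j\<close> because the pair is not short, and they lie on opposite sides, since
  \<open>V j\<close> is inside the angle at \<open>G k\<close>.\<close>

lemma crossing_sides:
  assumes "i \<in> L" "j \<in> L" "i < j" "\<not> short i j" and t: "t = 1 \<or> t = - 1"
  shows "\<exists>z\<in>S. t * det3 (V i) (V j) z > 0"
proof (rule ccontr)
  assume neg: "\<not> ?thesis"
  let ?a = "V i" and ?b = "V j"
  have ab: "?a \<in> S" "?b \<in> S" "?a \<noteq> ?b" using assms V_in_S V_eq_iff by auto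
  have pos: "(- t) * det3 ?a ?b z > 0" if "z \<in> S" "z \<noteq> ?a" "z \<noteq> ?b" for z
    using neg that t point_set_det3[OF point_set_S ab(1,2) that(1) ab(3)] by force
  have "q m \<noteq> ?a" if m: "m \<in> J" for m
  proof
    assume qa: "q m = ?a"
    then have "?a \<notin> G ` {..<n}" using q_not_G m by force
    then have "G ` {..<n} \<subseteq> {x. (- t) * det3 ?a ?b x > 0} \<union> {?b}"
    proof (intro subsetI)
      fix x assume x: "x \<in> G ` {..<n}"
      then have "x \<in> S" by (simp add: S_def)
      moreover have "x \<noteq> ?a" using x \<open>?a \<notin> G ` {..<n}\<close> by metis
      ultimately show "x \<in> {x. (- t) * det3 ?a ?b x > 0} \<union> {?b}" using pos[of x] by blast
    qed
    then have "convex hull (G ` {..<n}) \<subseteq> {x. (- t) * det3 ?a ?b x > 0} \<union> {?b}"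
      by (rule hull_minimal) (rule convex_open_halfplane_Un; simp)
    then have "?a \<in> {x. (- t) * det3 ?a ?b x > 0} \<union> {?b}" using q_in_hull[OF m] qa by auto
    then show False using ab(3) by simp
  qed
  then have "?a \<notin> q ` J" by (metis imageE)
  then have "?a \<in> G ` {..<n}" using ab(1) by (simp add: S_def)
  then obtain k where k: "k < n" "?a = G k" by blast
  define p where "p = (if k = 0 then n - 1 else k - 1)"
  have p: "p < n" "G (Suc p) = G k" using k n3 wrap by (auto simp: p_def)
  have b1: "?b \<noteq> G (Suc k)"
    using short_if_hull_edge[OF assms(1-3) k(1)] k(2) assms(4) by auto
  have b2: "?b \<noteq> G p"
    using short_if_hull_edge[OF assms(1-3) p(1)] k(2) p(2) assms(4) by (auto simp: insert_commute)
  have "?b \<noteq> G k" "?b \<noteq> G (Suc p)" using ab(3) k(2) p(2) by auto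
  then have "d k ?b > 0" "d p ?b > 0" using d_pos[OF k(1) ab(2) _ b1] d_pos[OF p(1) ab(2) b2] by blast+
  moreover have "det3 (G k) (G (Suc k)) ?b = - det3 (G k) ?b (G (Suc k))" "det3 (G p) (G k) ?b = det3 (G k) ?b (G p)"
    by (simp_all add: det3_def algebra_simps)
  ultimately have sg: "s * det3 ?a ?b (G (Suc k)) < 0" "s * det3 ?a ?b (G p) > 0"
    unfolding d_def k(2) p(2) by simp_all
  have "G (Suc k) \<in> S" "G p \<in> S" using G_S k(1) p(1) by auto
  then have "(- t) * det3 ?a ?b (G (Suc k)) > 0" "(- t) * det3 ?a ?b (G p) > 0"
    using pos sg by (metis det3_degenerate(2,3) less_irrefl mult_zero_right)+
  then show False using sg t by (auto simp: mult_less_0_iff zero_less_mult_iff)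
qed

text \<open>The sides of the triangle with apex \<open>b\<close> and of the one with apex
  \<open>q i\<close> do not cross, so one triangle contains the apex of the other. As both are
  empty, the apexes coincide.\<close>

lemma flipped_triangle:
  assumes T: "spanning T" and i: "i \<in> J" and b: "b \<in> S" "b \<noteq> G i" "b \<noteq> G (Suc i)"
    and e: "closed_segment (G i) b \<in> T" "closed_segment (G (Suc i)) b \<in> T"
    and empty: "S \<inter> convex hull {G i, G (Suc i), b} \<subseteq> {G i, G (Suc i), b}"
  shows "b = q i"
proof (rule ccontr)
  assume bq: "b \<noteq> q i"
  let ?a = "G i" and ?c = "G (Suc i)" and ?q = "q i"
  have sub: "T \<subseteq> edges S" and ncr: "noncrossing T" using T by (auto simp: spanning_def)
  have n: "i < n" "Suc i \<le> n" using J_less[OF i] by auto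
  have ne: "?q \<noteq> ?a" "?q \<noteq> ?c" "?a \<noteq> ?c" using q_neq_G[OF i] n G_Suc_neq by (metis less_imp_le)+
  have qT: "closed_segment ?a ?q \<in> T" "closed_segment ?c ?q \<in> T" using T i by (auto simp: spanning_def closed_segment_commute)
  have db: "d i b > 0" using d_pos[OF n(1) b] .
  have dq: "d i ?q > 0" using d_pos_q[OF n(1) i] .
  have D: "det3 ?a ?c b \<noteq> 0" using db by (auto simp: d_def)
  have out: "?q \<notin> convex hull {?a, ?c, b}" using empty q_S[OF i] ne bq by auto
  have "bary b ?a ?c ?q = d i ?q / d i b"
  proof -
    have "s \<noteq> 0" using db by (auto simp: d_def)
    then show ?thesis by (simp add: bary_def d_def det3_cyclic)
  qed
  then have bq_pos: "bary b ?a ?c ?q > 0" using db dq by simp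
  have av: "?a \<in> convex hull {?a, ?c, b}" "?c \<in> convex hull {?a, ?c, b}" by (simp_all add: hull_inc)
  have no1: False if "p \<in> closed_segment ?a ?q" "p \<in> closed_segment ?c b" for p
    using noncrossing_meet[OF point_set_S sub ncr qT(1) that(1) e(2) that(2)] ne b bq by (auto simp: doubleton_eq_iff)
  have no2: False if "p \<in> closed_segment ?c ?q" "p \<in> closed_segment ?a b" for p
    using noncrossing_meet[OF point_set_S sub ncr qT(2) that(1) e(1) that(2)] ne b bq by (auto simp: doubleton_eq_iff)
  have c_neg: "bary ?c b ?a ?q < 0"
    using triangle_exit[OF D av(1) out] no1 bq_pos by (metis less_asym)
  have a_neg: "bary ?a ?c b ?q < 0"
    using triangle_exit[OF D av(2) out] no2 bq_pos by (metis less_asym closed_segment_commute)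
  define u v w where "u = bary ?a ?c b ?q" and "v = bary ?c b ?a ?q" and "w = bary b ?a ?c ?q"
  have ex: "?q = u *\<^sub>R ?a + v *\<^sub>R ?c + w *\<^sub>R b" unfolding u_def v_def w_def by (rule bary_expand[OF D])
  have sum: "u + v + w = 1" unfolding u_def v_def w_def by (rule bary_sum[OF D])
  have w0: "w > 0" using bq_pos w_def by simp
  have wb: "w *\<^sub>R b = (- u) *\<^sub>R ?a + (- v) *\<^sub>R ?c + ?q" using arg_cong[OF ex, of "\<lambda>z. (- u) *\<^sub>R ?a + (- v) *\<^sub>R ?c + z"] by simp
  have "b = (1 / w) *\<^sub>R (w *\<^sub>R b)" using w0 by simp
  then have "b = (- u / w) *\<^sub>R ?a + (- v / w) *\<^sub>R ?c + (1 / w) *\<^sub>R ?q"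
    unfolding wb by (simp only: scaleR_add_right scaleR_scaleR times_divide_eq_left mult_1)
  moreover have "- u / w \<ge> 0" "- v / w \<ge> 0" "1 / w \<ge> 0" "- u / w + - v / w + 1 / w = 1"
    using a_neg c_neg w0 sum by (simp_all add: u_def v_def divide_nonpos_pos field_simps)
  ultimately have "b \<in> tri i" unfolding tri_def convex_hull_3 by blast
  then show False using tri_vertices[OF i b(1)] b bq by auto
qed

lemma flipped_triangle':
  assumes "spanning T" "i \<in> J" "{a, c} = {G i, G (Suc i)}" "b \<in> S" "b \<noteq> a" "b \<noteq> c"
    "closed_segment a b \<in> T" "closed_segment b c \<in> T" "S \<inter> convex hull {a, b, c} \<subseteq> {a, b, c}"
  shows "b = q i"
proof (rule flipped_triangle[OF assms(1,2,4)])
  show "b \<noteq> G i" "b \<noteq> G (Suc i)" using assms(3,5,6) by (auto simp: doubleton_eq_iff)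
  show "closed_segment (G i) b \<in> T" "closed_segment (G (Suc i)) b \<in> T"
    using assms(3,7,8) by (auto simp: doubleton_eq_iff closed_segment_commute)
  have "{G i, G (Suc i), b} = {a, b, c}" using assms(3) by auto
  then show "S \<inter> convex hull {G i, G (Suc i), b} \<subseteq> {G i, G (Suc i), b}" using assms(9) by simp
qed

text \<open>Flipped hull edges are left out because the label of the attached point lies between
  their ends, so edges at this point may interleave with them.\<close>

definition diag where
  "diag T x y \<longleftrightarrow> x \<in> L \<and> y \<in> L \<and> x < y \<and> closed_segment (V x) (V y) \<in> T \<and> \<not> flipped x y"

text \<open>A short pair can only interleave through the label of the point attached to its side. If
  this label is in \<open>L\<close> the pair is flipped, so \<open>no_interleaving\<close> applies
  to the pairs here.\<close>

lemma diag_no_interleaving: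
  assumes "spanning T" "diag T x y" "diag T z w" "x < z" "z < y" "y < w"
  shows False
proof -
  have l: "x \<in> L" "y \<in> L" "z \<in> L" "w \<in> L" using assms by (auto simp: diag_def)
  have "w < 2 * n" using l by (simp add: L_def)
  have "\<not> short x y"
  proof
    assume "short x y"
    then consider "even x" "y = x + 2" | "x = 0" "y = 2 * n - 2" by (auto simp: short_def)
    then show False
    proof cases
      case 1
      then have "z = x + 1" using assms by simp
      then show False using 1 l assms(2) by (simp add: diag_def flipped_def)
    next
      case 2
      then have "w = 2 * n - 1" using assms \<open>w < 2 * n\<close> by simp
      then show False using 2 l assms(2) by (simp add: diag_def flipped_def)
    qed
  qed
  moreover have "\<not> short z w"
  proof
    assume "short z w"
    then have "even z" "w = z + 2" using assms by (auto simp: short_def)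
    moreover then have "y = z + 1" using assms by simp
    ultimately show False using l assms(3) by (simp add: diag_def flipped_def)
  qed
  ultimately show False
    using no_interleaving[of T x z y w] assms l by (auto simp: diag_def)
qed

definition linked where "linked T x y \<longleftrightarrow> diag T (min x y) (max x y)"

lemma linked_iff:
  assumes "x \<in> L" "y \<in> L" "x \<noteq> y" "closed_segment (V x) (V y) \<in> T" "\<And>m. m \<in> J \<Longrightarrow> {V x, V y} \<noteq> {G m, G (Suc m)}"
  shows "linked T x y"
proof (cases "x < y")
  case True
  then have "\<not> flipped x y" using flipped_edge[of x y] assms by metis
  then show ?thesis using assms True by (simp add: linked_def diag_def min_def max_def)
next
  case False
  then have yx: "y < x" using assms by simp
  then have "\<not> flipped y x" using flipped_edge[of y x] assms by (metis insert_commute)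
  then show ?thesis using assms yx by (simp add: linked_def diag_def min_def max_def closed_segment_commute)
qed

text \<open>The apex comes from the empty triangle on the side given by \<open>t\<close>. It is
  linked to both ends unless a triangle side is a flipped hull edge. The label \<open>l\<close>
  excludes this except for the triangle of the last side, seen from its edge between the labels
  \<open>0\<close> and \<open>2 * n - 1\<close>.\<close>

lemma diag_apex_side:
  assumes T: "triangulation S T" and sp: "spanning T" and ij: "diag T i j" and l: "l \<in> L" "i < l" "l < j"
    and t: "t = 1 \<or> t = - 1" and z: "z \<in> S" "t * det3 (V i) (V j) z > 0"
  obtains k where "k \<in> L" "t * det3 (V i) (V j) (V k) > 0"
    "linked T i k \<and> linked T k j \<or> (i = 0 \<and> j = 2 * n - 1 \<and> k = 2 * n - 2)"
proof -
  let ?a = "V i" and ?b = "V j"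
  have ijL: "i \<in> L" "j \<in> L" "i < j" and ab: "closed_segment ?a ?b \<in> T" using ij by (auto simp: diag_def)
  have "\<exists>c\<in>S. t * det3 ?a ?b c > 0 \<and> closed_segment ?a c \<in> T \<and> closed_segment ?b c \<in> T \<and>
    S \<inter> convex hull {?a, ?b, c} \<subseteq> {?a, ?b, c}"
    using t
  proof
    assume "t = 1"
    then have "det3 ?a ?b z > 0" using z(2) by simp
    from triangulation_left_triangle[OF point_set_S T ab z(1) this] show ?thesis
      unfolding \<open>t = 1\<close> mult_1 by metis
  next
    assume t1: "t = - 1"
    then have "det3 ?b ?a z > 0" using z(2) by (simp add: det3_swap[of ?a ?b])
    then obtain c where c: "c \<in> S" "det3 ?b ?a c > 0" "closed_segment ?b c \<in> T" "closed_segment ?a c \<in> T"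
      "S \<inter> convex hull {?b, ?a, c} \<subseteq> {?b, ?a, c}"
      using triangulation_left_triangle[OF point_set_S T _ z(1), of ?b ?a] ab
      unfolding closed_segment_commute[of ?b ?a] by blast
    have "{?b, ?a, c} = {?a, ?b, c}" by (rule insert_commute)
    moreover have "t * det3 ?a ?b c > 0" using c(2) t1 det3_swap[of ?b ?a c] by simp
    ultimately show ?thesis using c by metis
  qed
  then obtain c where c: "c \<in> S" "t * det3 ?a ?b c > 0" "closed_segment ?a c \<in> T" "closed_segment ?b c \<in> T"
    "S \<inter> convex hull {?a, ?b, c} \<subseteq> {?a, ?b, c}" by blast
  obtain k where k: "k \<in> L" "c = V k" using c(1) V_image by blast
  have ne: "c \<noteq> ?a" "c \<noteq> ?b" using c(2) by auto
  then have kne: "k \<noteq> i" "k \<noteq> j" using k by auto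
  have nab: "?a \<noteq> ?b" using V_eq_iff ijL by auto
  have abS: "?a \<in> S" "?b \<in> S" using V_in_S ijL by auto
  have perm: "{?b, ?a, c} = {?a, ?b, c}" by (rule insert_commute)
  \<comment> \<open>If \<open>?a\<close> and \<open>c\<close> bound a flipped hull edge, the empty
    triangle on it has apex \<open>q m\<close>, so \<open>?b\<close> is \<open>q m\<close>. Since a
    label lies between \<open>i\<close> and \<open>j\<close>, \<open>i\<close> cannot be
    \<open>2 * m\<close>, and only the wrapped last side remains.\<close>
  have exc1: "i = 0 \<and> j = 2 * n - 1 \<and> k = 2 * n - 2" if m: "m \<in> J" "{?a, c} = {G m, G (Suc m)}" for m
  proof -
    have mn: "m < n" using J_less m by simp
    have "?b = q m"
      using flipped_triangle'[OF sp m abS(2) nab[symmetric] ne(2)[symmetric] ab c(4,5)] .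
    then have jm: "j = Suc (2 * m)" using V_eq_q ijL m(1) by blast
    then have "i \<noteq> 2 * m" using l by auto
    then have ac: "?a = G (Suc m)" "c = G m" using m(2) V_eq_G[OF ijL(1) _ mn] by (auto simp: doubleton_eq_iff)
    then show ?thesis using V_eq_G_Suc[OF ijL(1) ac(1) mn] V_eq_G[OF k(1) _ mn] k(2) jm ijL(3) by auto
  qed
  have exc2: False if m: "m \<in> J" "{?b, c} = {G m, G (Suc m)}" for m
  proof -
    have mn: "m < n" using J_less m by simp
    have "?a = q m"
      by (rule flipped_triangle'[OF sp m abS(1) nab ne(1)[symmetric] _ c(3)])
        (use ab c(5) in \<open>simp_all only: perm closed_segment_commute[of ?b ?a]\<close>)
    then have "i = Suc (2 * m)" using V_eq_q ijL m(1) by blast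
    moreover have "j = 2 * m \<or> j = 2 * m + 2 \<or> j = 0"
      using m(2) V_eq_G[OF ijL(2) _ mn] V_eq_G_Suc[OF ijL(2) _ mn] by (auto simp: doubleton_eq_iff)
    ultimately show False using l by auto
  qed
  have "linked T i k \<or> (i = 0 \<and> j = 2 * n - 1 \<and> k = 2 * n - 2)"
    using linked_iff[OF ijL(1) k(1)] kne c(3) k(2) exc1 by metis
  moreover have "linked T k j"
    using linked_iff[OF k(1) ijL(2)] kne c(4) k(2) exc2 by (metis closed_segment_commute insert_commute)
  ultimately show thesis using that[of k] k c(2) by auto
qed

text \<open>In general the edge has an apex on either geometric side. Two apexes outside the
  interval from \<open>i\<close> to \<open>j\<close> would produce interleaved edges, so one of them
  is inside, and it is irrelevant on which geometric side it lies.\<close>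

lemma diag_apex:
  assumes T: "triangulation S T" and sp: "spanning T" and ij: "diag T i j" and l: "l \<in> L" "i < l" "l < j"
  shows "\<exists>c. i < c \<and> c < j \<and> diag T i c \<and> diag T c j"
proof -
  have ijL: "i \<in> L" "j \<in> L" "i < j" using ij by (auto simp: diag_def)
  have inside: "\<exists>c. i < c \<and> c < j \<and> diag T i c \<and> diag T c j" if "i < k" "k < j" "linked T i k" "linked T k j" for k
    using that by (auto simp: linked_def min_def max_def)
  have kne: "k \<noteq> i" "k \<noteq> j" if "t * det3 (V i) (V j) (V k) > 0" for k and t :: real using that by auto
  show ?thesis
  proof (cases "short i j")
    case True
    \<comment> \<open>A hull edge has points on one side only, so there is a single apex. The
      unflipped short pair with a label inside is the last side without attached point, for which
      every label is in the interval.\<close>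
    have "\<not> (even i \<and> j = i + 2)"
    proof
      assume "even i \<and> j = i + 2"
      moreover then have "i + 1 \<in> L" using l by (metis Suc_eq_plus1 add_2_eq_Suc' less_SucE less_Suc_eq_le not_less)
      ultimately show False using ij by (auto simp: diag_def flipped_def)
    qed
    then have w: "i = 0" "j = 2 * n - 2" using True by (auto simp: short_def)
    then have nl: "2 * n - 1 \<notin> L" using ij by (auto simp: diag_def flipped_def)
    have "det3 (V i) (V j) (V l) \<noteq> 0"
      using point_set_det3[OF point_set_S] V_in_S V_eq_iff ijL l by (metis less_irrefl)
    then obtain t :: real where t: "t = 1 \<or> t = - 1" "t * det3 (V i) (V j) (V l) > 0"
      by (metis linorder_neqE_linordered_idom mult_1 mult_minus1 neg_0_less_iff_less)
    obtain k where k: "k \<in> L" "t * det3 (V i) (V j) (V k) > 0"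
      "linked T i k \<and> linked T k j \<or> (i = 0 \<and> j = 2 * n - 1 \<and> k = 2 * n - 2)"
      using diag_apex_side[OF T sp ij l t(1) V_in_S[OF l(1)] t(2)] by metis
    have "k < 2 * n" "k \<noteq> 2 * n - 1" using k(1) nl by (auto simp: L_def)
    then have "i < k" "k < j" using kne[OF k(2)] w by auto
    moreover have "linked T i k \<and> linked T k j" using k(3) w n3 by auto
    ultimately show ?thesis using inside by blast
  next
    case False
    obtain z1 z2 where z: "z1 \<in> S" "1 * det3 (V i) (V j) z1 > 0" "z2 \<in> S" "(- 1) * det3 (V i) (V j) z2 > 0"
      using crossing_sides[OF ijL False] by metis
    obtain k1 where k1: "k1 \<in> L" "1 * det3 (V i) (V j) (V k1) > 0"
      "linked T i k1 \<and> linked T k1 j \<or> (i = 0 \<and> j = 2 * n - 1 \<and> k1 = 2 * n - 2)"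
      using diag_apex_side[OF T sp ij l _ z(1,2)] by metis
    obtain k2 where k2: "k2 \<in> L" "(- 1) * det3 (V i) (V j) (V k2) > 0"
      "linked T i k2 \<and> linked T k2 j \<or> (i = 0 \<and> j = 2 * n - 1 \<and> k2 = 2 * n - 2)"
      using diag_apex_side[OF T sp ij l _ z(3,4)] by metis
    have k12: "k1 \<noteq> k2" using k1(2) k2(2) by auto
    have ne: "k1 \<noteq> i" "k1 \<noteq> j" "k2 \<noteq> i" "k2 \<noteq> j" using kne[OF k1(2)] kne[OF k2(2)] by auto
    show ?thesis
    \<comment> \<open>In this case all other labels are inside the interval, and at most one of the
      two distinct apexes is the exceptional label \<open>2 * n - 2\<close>.\<close>
    proof (cases "i = 0 \<and> j = 2 * n - 1")
      case True
      obtain k where k: "k \<in> {k1, k2}" "linked T i k" "linked T k j" using k1(3) k2(3) k12 by auto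
      have "k < 2 * n" using k(1) k1(1) k2(1) by (auto simp: L_def)
      then have "i < k" "k < j" using True k(1) ne by auto
      then show ?thesis using inside k by blast
    next
      case False
      then have g: "linked T i k1" "linked T k1 j" "linked T i k2" "linked T k2 j" using k1 k2 by auto
      have out: False if h: "a < b" "a < i \<or> j < a" "b < i \<or> j < b" "linked T i a" "linked T a j" "linked T i b" "linked T b j" for a b
      proof -
        consider "j < a" | "a < i" "j < b" | "b < i" using h ijL by linarith
        then show False
        proof cases
          case 1
          then have "diag T i a" "diag T j b" using h ijL by (auto simp: linked_def min_def max_def split: if_splits)
          then show False using diag_no_interleaving[OF sp, of i a j b] 1 h ijL by simp
        next
          case 2
          then have "diag T a j" "diag T i b" using h ijL by (auto simp: linked_def min_def max_def split: if_splits)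
          then show False using diag_no_interleaving[OF sp, of a j i b] 2 h ijL by simp
        next
          case 3
          then have "diag T a i" "diag T b j" using h ijL by (auto simp: linked_def min_def max_def split: if_splits)
          then show False using diag_no_interleaving[OF sp, of a i b j] 3 h ijL by simp
        qed
      qed
      have "(i < k1 \<and> k1 < j) \<or> (i < k2 \<and> k2 < j)"
      proof (rule ccontr)
        assume "\<not> ?thesis"
        then have o: "k1 < i \<or> j < k1" "k2 < i \<or> j < k2" using ne by auto
        from k12 show False
        proof (cases "k1 < k2")
          case True
          then show False using out[of k1 k2] o g by blast
        next
          case False
          then have "k2 < k1" using k12 by simp
          then show False using out[of k2 k1] o g by blast
        qed
      qed
      then show ?thesis using inside g by blast
    qed
  qed
qed

lemma diag_maximal:
  assumes T: "triangulation S T" and sp: "spanning T" and xy: "x \<in> L" "y \<in> L" "x < y"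
  shows "diag T x y \<or> (\<exists>i j. diag T i j \<and> (i < x \<and> x < j \<and> j < y \<or> x < i \<and> i < y \<and> y < j))"
proof -
  define i where "i = n - 1"
  have i: "Suc i = n" "i < n" using n3 by (auto simp: i_def)
  have L0: "2 * 0 \<in> L" "2 * i \<in> L" using i by (auto simp: L_def)
  \<comment> \<open>The largest label in \<open>L\<close>. Its edge to label \<open>0\<close> closes
    the remaining polygon, and the interval of this pair contains all labels.\<close>
  define m where "m = (if i \<in> J then 2 * n - 1 else 2 * n - 2)"
  have "diag T 0 m \<and> y \<le> m"
  proof (cases "i \<in> J")
    case True
    then have mi: "m = Suc (2 * i)" using i by (auto simp: m_def)
    have "m \<in> L" using True i by (simp add: mi L_def)
    moreover have "closed_segment (V (2 * 0)) (V m) \<in> T"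
      using sp True i wrap unfolding mi V_simps spanning_def by (metis closed_segment_commute)
    moreover have "\<not> flipped 0 m"
    proof
      assume "flipped 0 m"
      then have "even m" unfolding flipped_def by (elim disjE conjE) simp_all
      then show False using mi by simp
    qed
    moreover have "y \<le> m" using xy mi i by (auto simp: L_def)
    ultimately show ?thesis using L0 mi by (simp add: diag_def)
  next
    case False
    then have mi: "m = 2 * i" using i by (auto simp: m_def)
    have nl: "Suc (2 * i) \<notin> L" using False by (simp add: L_def)
    have "closed_segment (V (2 * 0)) (V m) \<in> T"
      using sp i wrap unfolding mi V_simps spanning_def by (metis closed_segment_commute)
    moreover have "\<not> flipped 0 m"
    proof -
      have "2 * n - 1 = Suc (2 * i)" using i by auto
      then show ?thesis using nl mi i n3 by (auto simp: flipped_def)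
    qed
    moreover have "y \<le> m"
    proof -
      have "y < 2 * n" "y \<noteq> Suc (2 * i)" using xy nl by (auto simp: L_def)
      then show ?thesis using mi i by auto
    qed
    ultimately show ?thesis using L0 mi n3 i by (simp add: diag_def)
  qed
  then have "diag T x y \<or> (\<exists>i j. i < j \<and> diag T i j \<and> (i < x \<and> x < j \<and> j < y \<or> x < i \<and> i < y \<and> y < j))"
    using diag_apex[OF T sp] xy by (intro pairs_maximal[where m = m and L = L]) auto
  then show ?thesis by blast
qed

end

section \<open>Hull edges and the choice of the triangles\<close>

lemma inner_det3: "(\<i> * (b - a)) \<bullet> (x - a) = det3 a b x"
  by (simp add: det3_def inner_complex_def algebra_simps)

text \<open>The vector \<open>\<i> * (b - a)\<close> is normal to the edge, and
  \<open>det3 a b\<close> is the corresponding linear function up to a constant. So the line through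
  \<open>a\<close> and \<open>b\<close> supports the hull and meets it only in the segment.\<close>

lemma hull_edgeI:
  assumes S: "a \<in> S" "b \<in> S" "a \<noteq> b" and pos: "\<And>x. \<lbrakk>x \<in> S; x \<noteq> a; x \<noteq> b\<rbrakk> \<Longrightarrow> s * det3 a b x > 0"
  shows "closed_segment a b edge_of convex hull S"
proof -
  let ?C = "{x. s * det3 a b x > 0} \<union> closed_segment a b"
  let ?v = "s *\<^sub>R (\<i> * (b - a))"
  have "convex ?C" by (rule convex_open_halfplane_Un) (auto simp: det3_closed_segment_0)
  moreover have "S \<subseteq> ?C" using pos by force
  ultimately have KC: "convex hull S \<subseteq> ?C" by (rule hull_minimal[rotated])
  have v: "?v \<bullet> x = ?v \<bullet> a + s * det3 a b x" for x
  proof -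
    have "(\<i> * (b - a)) \<bullet> x = (\<i> * (b - a)) \<bullet> a + det3 a b x"
      using inner_det3[of b a x] unfolding inner_diff_right by linarith
    then show ?thesis by (simp only: inner_scaleR_left distrib_left)
  qed
  have "?v \<bullet> x \<ge> ?v \<bullet> a" if "x \<in> convex hull S" for x
    unfolding v[of x] using KC that by (auto simp: det3_closed_segment_0)
  then have "(convex hull S \<inter> {x. ?v \<bullet> x = ?v \<bullet> a}) face_of convex hull S"
    by (intro face_of_Int_supporting_hyperplane_ge) auto
  moreover have "convex hull S \<inter> {x. ?v \<bullet> x = ?v \<bullet> a} = closed_segment a b"
  proof
    show "convex hull S \<inter> {x. ?v \<bullet> x = ?v \<bullet> a} \<subseteq> closed_segment a b"
    proof
      fix x assume x: "x \<in> convex hull S \<inter> {x. ?v \<bullet> x = ?v \<bullet> a}"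
      then have "?v \<bullet> x = ?v \<bullet> a" by blast
      then have "s * det3 a b x = 0" using v[of x] by linarith
      then show "x \<in> closed_segment a b" using x KC by auto
    qed
    have "closed_segment a b \<subseteq> convex hull S" using S by (intro closed_segment_subset) (auto intro: hull_inc)
    moreover have "?v \<bullet> x = ?v \<bullet> a" if "x \<in> closed_segment a b" for x
      unfolding v[of x] using det3_closed_segment_0[OF that] by simp
    ultimately show "closed_segment a b \<subseteq> convex hull S \<inter> {x. ?v \<bullet> x = ?v \<bullet> a}" by blast
  qed
  ultimately have "closed_segment a b face_of convex hull S" by simp
  moreover have "aff_dim (closed_segment a b) = 1"
    using S(3) by (simp add: segment_convex_hull aff_dim_convex_hull aff_dim_2)
  ultimately show ?thesis by (simp add: edge_of_def)
qed

text \<open>Faces of a polytope are exposed, so a linear function attains its maximum on the hull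
  exactly on the edge. It is a multiple of \<open>det3 a b\<close> up to a constant, and general
  position makes the inequality strict at all other points.\<close>

lemma hull_edgeD:
  assumes S: "point_set S" "a \<in> S" "b \<in> S" "a \<noteq> b" and e: "closed_segment a b edge_of convex hull S"
  obtains s where "s = 1 \<or> s = - 1" "\<And>x. \<lbrakk>x \<in> S; x \<noteq> a; x \<noteq> b\<rbrakk> \<Longrightarrow> s * det3 a b x > 0"
proof -
  have "closed_segment a b exposed_face_of convex hull S"
    using e S(1) by (simp add: edge_of_def point_set_def exposed_face_of_polyhedron polyhedron_convex_hull)
  then obtain c k where c: "convex hull S \<subseteq> {x. c \<bullet> x \<le> k}" "closed_segment a b = convex hull S \<inter> {x. c \<bullet> x = k}"
    unfolding exposed_face_of_def by blast
  have ab: "c \<bullet> a = k" "c \<bullet> b = k" using c(2) ends_in_segment by blast+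
  define l where "l = c \<bullet> (\<i> * (b - a))"
  have id: "(norm (b - a))\<^sup>2 * (c \<bullet> (x - a)) = l * det3 a b x" for x
  proof -
    have "(norm (b - a))\<^sup>2 * (c \<bullet> (x - a)) = l * det3 a b x + (c \<bullet> (b - a)) * ((b - a) \<bullet> (x - a))"
      unfolding l_def cmod_power2 by (simp add: det3_def inner_complex_def power2_eq_square algebra_simps)
    then show ?thesis using ab by (simp add: inner_diff_right)
  qed
  have lneg: "l * det3 a b x < 0" if "x \<in> S" "x \<noteq> a" "x \<noteq> b" for x
  proof -
    have "x \<in> convex hull S" using that by (simp add: hull_inc)
    moreover have "x \<notin> closed_segment a b" using point_set_closed_segment[OF S(1-3) that(1) S(4)] that by blast
    ultimately have "c \<bullet> x < k" using c by fastforce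
    then have "c \<bullet> (x - a) < 0" using ab by (simp add: inner_diff_right)
    then have "(norm (b - a))\<^sup>2 * (c \<bullet> (x - a)) < 0" using S(4) by (simp add: mult_pos_neg)
    then show ?thesis by (simp add: id)
  qed
  show thesis
  proof (cases "l > 0")
    case True
    then have "(- 1) * det3 a b x > 0" if "x \<in> S" "x \<noteq> a" "x \<noteq> b" for x
      using lneg[OF that] by (simp add: mult_less_0_iff)
    then show thesis using that[of "- 1"] by blast
  next
    case False
    then have "1 * det3 a b x > 0" if "x \<in> S" "x \<noteq> a" "x \<noteq> b" for x
      using lneg[OF that] by (auto simp: mult_less_0_iff)
    then show thesis using that[of 1] by blast
  qed
qed

text \<open>Induction on the last vertex. The Pluecker relation at \<open>G i\<close>, with
  \<open>G (Suc i)\<close> as auxiliary point, expresses the new orientation by the previous one and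
  by orientations that involve a side.\<close>

lemma convex_polygon_if_edges:
  assumes n3: "n \<ge> 3" and wrap: "G n = G 0" and inj: "inj_on G {..<n}"
    and edges: "\<And>i j. \<lbrakk>i < n; j < n; G j \<noteq> G i; G j \<noteq> G (Suc i)\<rbrakk> \<Longrightarrow> s * det3 (G i) (G (Suc i)) (G j) > 0"
  shows "convex_polygon n G s"
proof
  show "n \<ge> 3" "G n = G 0" by fact+
  have eq: "G i = G j \<longleftrightarrow> i = j" if "i < n" "j < n" for i j using inj that by (auto dest: inj_onD)
  fix i j k assume ij: "i < j" and "j < k" "k < n"
  then have "Suc j \<le> k" "k < n" by auto
  then show "s * det3 (G i) (G j) (G k) > 0"
  proof (induction k rule: dec_induct)
    case base
    have "s * det3 (G j) (G (Suc j)) (G i) > 0" using edges[of j i] eq base ij by auto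
    then show ?case by (simp add: det3_cyclic)
  next
    case (step k)
    have IH: "s * det3 (G i) (G j) (G k) > 0" using step by simp
    have e: "s * det3 (G i) (G k) (G (Suc k)) > 0"
      using edges[of k i] eq[of i k] eq[of i "Suc k"] step ij by (auto simp: det3_cyclic)
    show ?case
    proof (cases "j = Suc i")
      case True
      then show ?thesis using edges[of i "Suc k"] eq[of "Suc k" i] eq[of "Suc k" "Suc i"] step by auto
    next
      case False
      have p: "s * det3 (G i) (G (Suc i)) (G m) > 0" if "Suc i < m" "m < n" for m
        using edges[of i m] eq[of m i] eq[of m "Suc i"] that by auto
      have pj: "s * det3 (G i) (G (Suc i)) (G j) > 0" "s * det3 (G i) (G (Suc i)) (G k) > 0" "s * det3 (G i) (G (Suc i)) (G (Suc k)) > 0"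
        using p False ij step by auto
      have pl: "det3 (G i) (G (Suc i)) (G k) * det3 (G i) (G j) (G (Suc k)) =
        det3 (G i) (G (Suc i)) (G j) * det3 (G i) (G k) (G (Suc k)) + det3 (G i) (G (Suc i)) (G (Suc k)) * det3 (G i) (G j) (G k)"
        by (rule det3_plucker)
      have "(s * det3 (G i) (G (Suc i)) (G k)) * (s * det3 (G i) (G j) (G (Suc k))) =
        s * s * (det3 (G i) (G (Suc i)) (G k) * det3 (G i) (G j) (G (Suc k)))" by simp
      also have "\<dots> = (s * det3 (G i) (G (Suc i)) (G j)) * (s * det3 (G i) (G k) (G (Suc k))) +
        (s * det3 (G i) (G (Suc i)) (G (Suc k))) * (s * det3 (G i) (G j) (G k))"
        unfolding pl by (simp add: algebra_simps)
      also have "\<dots> > 0" by (rule add_pos_pos[OF mult_pos_pos[OF pj(1) e] mult_pos_pos[OF pj(3) IH]])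
      finally show ?thesis using pj(2) by (rule zero_less_mult_pos)
    qed
  qed
qed

text \<open>A bijection with least product exists by finiteness. Exchanging two values changes only
  two factors, and the positive product of the others cancels.\<close>

lemma optimal_assignment:
  fixes d :: "'i \<Rightarrow> 'a \<Rightarrow> real"
  assumes fin: "finite J" "finite X" and card: "card J = card X"
    and pos: "\<And>i x. \<lbrakk>i \<in> J; x \<in> X\<rbrakk> \<Longrightarrow> d i x > 0"
  obtains q where "bij_betw q J X" "\<And>i j. \<lbrakk>i \<in> J; j \<in> J; i \<noteq> j\<rbrakk> \<Longrightarrow> d i (q i) * d j (q j) \<le> d i (q j) * d j (q i)"
proof -
  \<comment> \<open>Fixing the values outside \<open>J\<close> makes the set of candidates
    finite.\<close>
  define B where "B = {f \<in> J \<rightarrow>\<^sub>E X. bij_betw f J X}"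
  have "finite B" unfolding B_def using fin by (simp add: finite_PiE)
  obtain f where "bij_betw f J X" using finite_same_card_bij[OF fin card] by blast
  then have "bij_betw (restrict f J) J X" by (subst bij_betw_cong[of J _ f]) auto
  moreover have "restrict f J \<in> J \<rightarrow>\<^sub>E X" using \<open>bij_betw f J X\<close> by (auto simp: bij_betw_def)
  ultimately have "restrict f J \<in> B" unfolding B_def by blast
  then have "B \<noteq> {}" by blast
  then obtain q where q: "q \<in> B" and min: "\<And>g. g \<in> B \<Longrightarrow> (\<Prod>i\<in>J. d i (q i)) \<le> (\<Prod>i\<in>J. d i (g i))"
    using ex_is_arg_min_if_finite[of B "\<lambda>g. \<Prod>i\<in>J. d i (g i)"] \<open>finite B\<close> by (auto simp: is_arg_min_linorder)
  have bq: "bij_betw q J X" using q by (simp add: B_def)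
  have qX: "q i \<in> X" if "i \<in> J" for i using bq that by (auto simp: bij_betw_def)
  have "d i (q i) * d j (q j) \<le> d i (q j) * d j (q i)" if ij: "i \<in> J" "j \<in> J" "i \<noteq> j" for i j
  proof -
    define g where "g = q(i := q j, j := q i)"
    have img: "g ` J = q ` J"
    proof
      show "g ` J \<subseteq> q ` J" using ij by (auto simp: g_def)
      show "q ` J \<subseteq> g ` J"
      proof
        fix y assume "y \<in> q ` J"
        then obtain k where k: "k \<in> J" "y = q k" by blast
        have "y = g (if k = i then j else if k = j then i else k)" using k ij by (auto simp: g_def)
        moreover have "(if k = i then j else if k = j then i else k) \<in> J" using k ij by auto
        ultimately show "y \<in> g ` J" by blast
      qed
    qed
    then have "inj_on g J" using fin(1) bq by (metis bij_betw_def card_image eq_card_imp_inj_on)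
    then have "bij_betw g J X" using img bq by (simp add: bij_betw_def)
    moreover have "g \<in> J \<rightarrow>\<^sub>E X"
      using q ij qX by (auto simp: g_def B_def PiE_def extensional_def)
    ultimately have le: "(\<Prod>k\<in>J. d k (q k)) \<le> (\<Prod>k\<in>J. d k (g k))" using min by (simp add: B_def)
    define R where "R = (\<Prod>k\<in>J - {i} - {j}. d k (q k))"
    have split: "(\<Prod>k\<in>J. h k) = h i * (h j * (\<Prod>k\<in>J - {i} - {j}. h k))" for h :: "'i \<Rightarrow> real"
      using ij fin(1) prod.remove[of J i h] prod.remove[of "J - {i}" j h] by simp
    have "(\<Prod>k\<in>J - {i} - {j}. d k (g k)) = R" unfolding R_def by (intro prod.cong) (auto simp: g_def)
    then have "(d i (q i) * d j (q j)) * R \<le> (d i (q j) * d j (q i)) * R"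
      using le ij(3) unfolding split[of "\<lambda>k. d k (q k)"] split[of "\<lambda>k. d k (g k)"]
      by (simp add: g_def R_def mult.assoc)
    moreover have "R > 0" unfolding R_def using pos qX by (intro prod_pos) auto
    ultimately show ?thesis by simp
  qed
  then show thesis using that bq by blast
qed

lemma extreme_points_eq:
  fixes S :: "complex set"
  assumes "compact (convex hull S)"
  shows "convex hull {x. x extreme_point_of (convex hull S)} = convex hull S"
  using Krein_Milman_Minkowski[OF assms convex_convex_hull] by simp

section \<open>Transferring triangulations to the double circle\<close>

lemma same_side_disjoint:
  assumes "t * det3 a b c > 0" "t * det3 a b d > 0"
  shows "open_segment a b \<inter> open_segment c d = {}"
proof (rule ccontr)
  assume "\<not> ?thesis"
  then obtain u where u: "u \<in> open_segment a b" "u \<in> open_segment c d" by blast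
  have "t * det3 a b u > 0" using det3_open_segment_pos[OF u(2), of t a b] assms by simp
  moreover have "det3 a b u = 0" using u(1) by (intro det3_closed_segment_0) (simp add: open_segment_def)
  ultimately show False by simp
qed

lemma not_crosses_side:
  assumes S: "point_set S" "a \<in> S" "b \<in> S" "c \<in> S" "d \<in> S" "a \<noteq> b" "c \<noteq> d"
    and pos: "\<And>x. \<lbrakk>x \<in> S; x \<noteq> a; x \<noteq> b\<rbrakk> \<Longrightarrow> t * det3 a b x > 0"
  shows "\<not> crosses (closed_segment a b) (closed_segment c d)"
proof
  assume "crosses (closed_segment a b) (closed_segment c d)"
  then obtain u where u: "{a, b} \<noteq> {c, d}" "u \<in> open_segment a b" "u \<in> open_segment c d"
    using crosses_segments[OF S(6,7)] by blast
  have o: "a \<notin> {c, d}" "b \<notin> {c, d}" using open_segment_det3_opposite[OF S u(2,3,1)] by auto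
  then have "t * det3 a b c > 0" "t * det3 a b d > 0" using pos S(4,5) by auto
  then show False using same_side_disjoint u by blast
qed

lemma not_crosses_shared:
  assumes "point_set S" "a \<in> S" "b \<in> S" "c \<in> S" "d \<in> S" "a \<noteq> b" "c \<noteq> d" "{a, b} \<inter> {c, d} \<noteq> {}"
  shows "\<not> crosses (closed_segment a b) (closed_segment c d)"
  using open_segment_det3_opposite(1,2)[OF assms(1-7)] assms(8) crosses_segments[OF assms(6,7)] by blast

lemma crosses_sym: "crosses s t \<longleftrightarrow> crosses t s"
  by (auto simp: crosses_def)

lemma triangulation_extends:
  assumes "finite S" "B \<subseteq> edges S" "noncrossing B"
  obtains T where "triangulation S T" "B \<subseteq> T"
proof -
  define F where "F = {T. B \<subseteq> T \<and> T \<subseteq> edges S \<and> noncrossing T}"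
  have F: "T \<in> F \<longleftrightarrow> B \<subseteq> T \<and> T \<subseteq> edges S \<and> noncrossing T" for T by (simp add: F_def)
  have "F \<subseteq> Pow (edges S)" using F by blast
  then have "finite F" using finite_edges[OF assms(1)] finite_subset by (metis finite_Pow_iff)
  moreover have "B \<in> F" using F assms(2,3) by simp
  then have "F \<noteq> {}" by blast
  ultimately have "\<exists>T\<in>F. \<forall>T'\<in>F. T \<subseteq> T' \<longrightarrow> T = T'" by (rule finite_has_maximal)
  then obtain T where T: "T \<in> F" "\<And>T'. T' \<in> F \<Longrightarrow> T \<subseteq> T' \<Longrightarrow> T = T'" by blast
  have "triangulation S T" unfolding triangulation_def
  proof (intro conjI allI impI)
    fix T' assume "T \<subseteq> T' \<and> T' \<subseteq> edges S \<and> noncrossing T'"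
    then have "T' \<in> F" "T \<subseteq> T'" using T(1) unfolding F by auto
    then show "T' = T" using T(2) by blast
  qed (use T(1) F in auto)
  then show thesis using that T(1) F by blast
qed

context hull_config
begin

text \<open>Nothing crosses a hull edge, two sides at the same \<open>q i\<close> share an endpoint,
  and sides in different triangles meet only in hull vertices by \<open>tri_meet\<close>. So all
  these edges extend to a triangulation.\<close>

lemma spanning_triangulation:
  obtains T where "triangulation S T" "spanning T"
proof -
  define H where "H = {closed_segment (G i) (G (Suc i)) | i. i < n}"
  define Q where "Q = {closed_segment (G k) (q i) | i k. i \<in> J \<and> k \<in> {i, Suc i}}"
  have fin: "finite S" using point_set_S by (simp add: point_set_def)
  have H1: "H \<subseteq> edges S" unfolding H_def using G_S G_Suc_neq by (auto simp: closed_segment_in_edges_iff)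
  have Q1: "Q \<subseteq> edges S"
  proof
    fix e assume "e \<in> Q"
    then obtain i k where e: "e = closed_segment (G k) (q i)" "i \<in> J" "k \<in> {i, Suc i}" unfolding Q_def by blast
    then have "k \<le> n" using J_less[of i] by auto
    then show "e \<in> edges S" using e G_S q_S q_neq_G[of i k] by (metis closed_segment_in_edges_iff)
  qed
  have Hc: "\<not> crosses h e" if he: "h \<in> H" "e \<in> edges S" for h e
  proof -
    obtain i where i: "i < n" "h = closed_segment (G i) (G (Suc i))" using he(1) unfolding H_def by blast
    obtain c d' where c: "e = closed_segment c d'" "c \<in> S" "d' \<in> S" "c \<noteq> d'" using he(2) by (auto simp: edges_def)
    have "G i \<in> S" "G (Suc i) \<in> S" using G_S i by auto
    then show ?thesis unfolding i(2) c(1)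
      using not_crosses_side[OF point_set_S _ _ c(2,3) G_Suc_neq[OF i(1)] c(4), of s] d_pos[OF i(1)] by (simp add: d_def)
  qed
  have Qc: "\<not> crosses e e'" if ee: "e \<in> Q" "e' \<in> Q" for e e'
  proof -
    obtain i k where e: "e = closed_segment (G k) (q i)" "i \<in> J" "k \<in> {i, Suc i}" using ee(1) unfolding Q_def by blast
    obtain j l where e': "e' = closed_segment (G l) (q j)" "j \<in> J" "l \<in> {j, Suc j}" using ee(2) unfolding Q_def by blast
    have kl: "k \<le> n" "l \<le> n" using e e' J_less[of i] J_less[of j] by auto
    have ne: "G k \<noteq> q i" "G l \<noteq> q j" using q_neq_G e e' kl by metis+
    show ?thesis
    proof (cases "i = j")
      case True
      then show ?thesis unfolding e(1) e'(1)
        using not_crosses_shared[OF point_set_S G_S[OF kl(1)] q_S[OF e(2)] G_S[OF kl(2)] q_S[OF e'(2)] ne] by simp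
    next
      case False
      have "False" if u: "u \<in> open_segment (G k) (q i)" "u \<in> open_segment (G l) (q j)" for u
      proof -
        have "closed_segment (G k) (q i) \<subseteq> tri i" "closed_segment (G l) (q j) \<subseteq> tri j" unfolding tri_def
          using e(3) e'(3) by (intro closed_segment_subset; auto intro: hull_inc)+
        then have "u \<in> tri i" "u \<in> tri j" using u by (auto simp: open_segment_def)
        then have "u \<in> S" using tri_meet[OF e(2) e'(2) False] by (auto simp: S_def)
        then show False using u(1) point_set_open_segment[OF point_set_S G_S[OF kl(1)] q_S[OF e(2)]] by blast
      qed
      then show ?thesis unfolding e(1) e'(1) using crosses_segments[OF ne] by blast
    qed
  qed
  have "noncrossing (H \<union> Q)" unfolding noncrossing_def
  proof (intro ballI)
    fix e e' assume ee: "e \<in> H \<union> Q" "e' \<in> H \<union> Q"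
    then have E: "e \<in> edges S" "e' \<in> edges S" using H1 Q1 by auto
    show "\<not> crosses e e'"
    proof (cases "e \<in> H \<or> e' \<in> H")
      case True
      then show ?thesis using Hc E crosses_sym by metis
    next
      case False
      then show ?thesis using Qc ee by blast
    qed
  qed
  then obtain T where T: "triangulation S T" "H \<union> Q \<subseteq> T"
    using triangulation_extends[OF fin, of "H \<union> Q"] H1 Q1 by blast
  have "closed_segment (G i) (G (Suc i)) \<in> T" if "i < n" for i using T(2) that unfolding H_def by blast
  moreover have "closed_segment (G i) (q i) \<in> T \<and> closed_segment (q i) (G (Suc i)) \<in> T" if "i \<in> J" for i
  proof -
    have "closed_segment (G i) (q i) \<in> Q" "closed_segment (G (Suc i)) (q i) \<in> Q" using that unfolding Q_def by blast+
    then show ?thesis using T(2) unfolding closed_segment_commute[of "q i" "G (Suc i)"] by blast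
  qed
  ultimately have "spanning T" using T(1) unfolding spanning_def triangulation_def by blast
  then show thesis using that T(1) by blast
qed

end

text \<open>The labelled order type of the source set: convex position except that the flat triples
  are reversed, because an attached point lies just inside its hull edge. \<open>L\<close> and
  \<open>flat\<close> repeat the formulas used on the image side, so that facts about both sets can
  be combined.\<close>

locale double_circle_type =
  fixes n :: nat and J :: "nat set" and W :: "nat \<Rightarrow> complex" and L :: "nat set" and flat :: "nat \<Rightarrow> nat \<Rightarrow> nat \<Rightarrow> bool"
  defines "L \<equiv> {x. x < 2 * n \<and> (odd x \<longrightarrow> x div 2 \<in> J)}"
    and "flat \<equiv> \<lambda>x y z. (even x \<and> y = x + 1 \<and> z = x + 2) \<or> (x = 0 \<and> y = 2 * n - 2 \<and> z = 2 * n - 1)"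
  assumes n3: "n \<ge> 3" and inj_W: "inj_on W L" and pset_W: "point_set (W ` L)"
    and pos: "\<And>x y z. \<lbrakk>x \<in> L; y \<in> L; z \<in> L; x < y; y < z; \<not> flat x y z\<rbrakk> \<Longrightarrow> det3 (W x) (W y) (W z) > 0"
    and neg: "\<And>x y z. \<lbrakk>x \<in> L; y \<in> L; z \<in> L; flat x y z\<rbrakk> \<Longrightarrow> det3 (W x) (W y) (W z) < 0"
begin

lemma W_eq_iff: "x \<in> L \<Longrightarrow> y \<in> L \<Longrightarrow> W x = W y \<longleftrightarrow> x = y"
  using inj_W by (auto dest: inj_onD)

lemma L_less: "x \<in> L \<Longrightarrow> x < 2 * n"
  by (simp add: L_def)

lemma polygon_side:
  assumes x: "x \<in> L" "even x" "x + 2 \<in> L" and z: "z \<in> L" "z \<noteq> x" "z \<noteq> x + 2"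
  shows "det3 (W x) (W (x + 2)) (W z) > 0"
proof -
  have lt: "x + 2 < 2 * n" using x L_less by blast
  consider "z < x" | "z = x + 1" | "z > x + 2" using z by linarith
  then show ?thesis
  proof cases
    case 1
    have "\<not> flat z x (x + 2)" using 1 x(2) lt unfolding flat_def by (auto; presburger)
    then have "det3 (W z) (W x) (W (x + 2)) > 0" using pos[of z x "x + 2"] x z 1 by simp
    then show ?thesis by (simp add: det3_cyclic)
  next
    case 2
    then have "flat x z (x + 2)" using x by (simp add: flat_def)
    then have "det3 (W x) (W z) (W (x + 2)) < 0" using neg x z by blast
    then show ?thesis using det3_swap2[of "W x" "W (x + 2)" "W z"] by linarith
  next
    case 3
    have "\<not> flat x (x + 2) z" using 3 n3 unfolding flat_def by auto
    then show ?thesis using pos[of x "x + 2" z] x z 3 by simp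
  qed
qed

lemma polygon_side_wrap:
  assumes z: "z \<in> L" "z \<noteq> 2 * n - 2" "z \<noteq> 0"
  shows "det3 (W (2 * n - 2)) (W 0) (W z) > 0"
proof -
  have L0: "0 \<in> L" "2 * n - 2 \<in> L" using n3 by (auto simp: L_def)
  consider "z < 2 * n - 2" | "z = 2 * n - 1" using z L_less[OF z(1)] by linarith
  then show ?thesis
  proof cases
    case 1
    have "\<not> flat 0 z (2 * n - 2)" using 1 n3 unfolding flat_def by auto
    then have "det3 (W 0) (W z) (W (2 * n - 2)) > 0" using pos[of 0 z "2 * n - 2"] L0 z 1 by simp
    then show ?thesis by (simp add: det3_cyclic)
  next
    case 2
    then have "flat 0 (2 * n - 2) z" by (simp add: flat_def)
    then have "det3 (W 0) (W (2 * n - 2)) (W z) < 0" using neg L0 z by blast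
    then show ?thesis using det3_swap[of "W 0" "W (2 * n - 2)" "W z"] by linarith
  qed
qed

lemma short_not_crosses:
  assumes x: "x \<in> L" "y \<in> L" "(even x \<and> y = x + 2) \<or> (x = 0 \<and> y = 2 * n - 2)" and z: "z \<in> L" "w \<in> L" "z \<noteq> w"
  shows "\<not> crosses (closed_segment (W x) (W y)) (closed_segment (W z) (W w))"
proof -
  have ne: "x \<noteq> y" using x(3) n3 by auto
  have m: "W x \<in> W ` L" "W y \<in> W ` L" "W z \<in> W ` L" "W w \<in> W ` L" using x z by auto
  have nW: "W x \<noteq> W y" "W z \<noteq> W w" using W_eq_iff x z ne by auto
  show ?thesis using x(3)
  proof
    assume e: "even x \<and> y = x + 2"
    then have "1 * det3 (W x) (W y) p > 0" if "p \<in> W ` L" "p \<noteq> W x" "p \<noteq> W y" for p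
      using polygon_side[of x] x that by auto
    then show ?thesis using not_crosses_side[OF pset_W m nW] by blast
  next
    assume e: "x = 0 \<and> y = 2 * n - 2"
    have "(- 1) * det3 (W x) (W y) p > 0" if "p \<in> W ` L" "p \<noteq> W x" "p \<noteq> W y" for p
      using polygon_side_wrap e that det3_swap[of "W 0" "W (2 * n - 2)" p] by auto
    then show ?thesis using not_crosses_side[OF pset_W m nW] by blast
  qed
qed

text \<open>One segment has both ends on the same side of the line through the other. A flat triple
  spoils this for one choice of the line, and then the roles of the two segments are
  exchanged.\<close>

lemma noninterleaved_disjoint:
  assumes l: "a \<in> L" "b \<in> L" "c \<in> L" "e \<in> L" and lt: "a < b" "b < c" "c < e"
  shows "open_segment (W a) (W b) \<inter> open_segment (W c) (W e) = {}"
    "open_segment (W a) (W e) \<inter> open_segment (W b) (W c) = {}"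
proof -
  have e: "e < 2 * n" using L_less l by blast
  show "open_segment (W a) (W b) \<inter> open_segment (W c) (W e) = {}"
  proof (cases "flat a b c")
    case False
    have "\<not> flat a b e" using lt e unfolding flat_def by auto
    then have "1 * det3 (W a) (W b) (W c) > 0" "1 * det3 (W a) (W b) (W e) > 0"
      using pos[of a b c] pos[of a b e] l lt False by simp_all
    then show ?thesis by (rule same_side_disjoint)
  next
    case True
    then have abc: "even a" "b = a + 1" "c = a + 2" using lt e by (auto simp: flat_def)
    have "odd b" "b \<noteq> 0" "c \<noteq> a + 1" "a = 0 \<Longrightarrow> c \<noteq> 2 * n - 2" using abc n3 by auto
    then have "\<not> flat a c e" "\<not> flat b c e" unfolding flat_def by blast+
    then have "det3 (W a) (W c) (W e) > 0" "det3 (W b) (W c) (W e) > 0"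
      using pos[of a c e] pos[of b c e] l lt by simp_all
    then have "1 * det3 (W c) (W e) (W a) > 0" "1 * det3 (W c) (W e) (W b) > 0" by (simp_all add: det3_cyclic)
    then show ?thesis using same_side_disjoint by blast
  qed
  show "open_segment (W a) (W e) \<inter> open_segment (W b) (W c) = {}"
  proof (cases "flat a c e")
    case False
    have "\<not> flat a b e" using lt e unfolding flat_def by auto
    then have "det3 (W a) (W b) (W e) > 0" "det3 (W a) (W c) (W e) > 0"
      using pos[of a b e] pos[of a c e] l lt False by simp_all
    then have "(- 1) * det3 (W a) (W e) (W b) > 0" "(- 1) * det3 (W a) (W e) (W c) > 0"
      by (simp_all add: det3_swap2[of "W a" "W e"])
    then show ?thesis by (rule same_side_disjoint)
  next
    case True
    then have ace: "a = 0" "c = 2 * n - 2" "e = 2 * n - 1" using lt by (auto simp: flat_def)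
    have "\<not> flat a b c" "\<not> flat b c e" using ace lt n3 unfolding flat_def by (auto; presburger)+
    then have "det3 (W a) (W b) (W c) > 0" "det3 (W b) (W c) (W e) > 0"
      using pos[of a b c] pos[of b c e] l lt by simp_all
    then have "1 * det3 (W b) (W c) (W a) > 0" "1 * det3 (W b) (W c) (W e) > 0" by (simp_all add: det3_cyclic)
    then show ?thesis using same_side_disjoint by blast
  qed
qed

lemma interleaved_cross:
  assumes l: "a \<in> L" "b \<in> L" "c \<in> L" "e \<in> L" and lt: "a < b" "b < c" "c < e"
    and ns: "\<not> flat a b c" "\<not> flat a c e" "\<not> flat b c e"
  shows "crosses (closed_segment (W a) (W c)) (closed_segment (W b) (W e))"
proof -
  have e: "e < 2 * n" using L_less l by blast
  have "\<not> flat a b e" using lt e unfolding flat_def by auto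
  then have "1 * det3 (W a) (W b) (W c) > 0" "1 * det3 (W a) (W c) (W e) > 0" "1 * det3 (W b) (W c) (W e) > 0"
    "1 * det3 (W a) (W b) (W e) > 0" using pos l lt ns by simp_all
  then obtain u where "u \<in> open_segment (W a) (W c)" "u \<in> open_segment (W b) (W e)"
    by (rule open_segments_cross)
  moreover have "W a \<noteq> W c" "W b \<noteq> W e" "W a \<noteq> W b" "W a \<noteq> W e" using W_eq_iff l lt by auto
  ultimately show ?thesis using crosses_segments by (auto simp: doubleton_eq_iff)
qed

end

text \<open>Flipped edges become hull edges, which nothing crosses, and the other edges do not
  interleave. Conversely a missing pair interleaves with a present one by
  \<open>diag_maximal\<close>, and in the double circle such pairs cross.\<close>

lemma (in hull_config) transfer_triangulation:
  assumes dc: "double_circle_type n J W" and T: "triangulation S T" and sp: "spanning T"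
  shows "triangulation (W ` L) {closed_segment (W x) (W y) | x y. x \<in> L \<and> y \<in> L \<and> x < y \<and> closed_segment (V x) (V y) \<in> T}"
proof -
  interpret W: double_circle_type n J W "{x. x < 2 * n \<and> (odd x \<longrightarrow> x div 2 \<in> J)}"
     "\<lambda>x y z. (even x \<and> y = x + 1 \<and> z = x + 2) \<or> (x = 0 \<and> y = 2 * n - 2 \<and> z = 2 * n - 1)"
    using dc by simp_all
  note defs = L_def[symmetric] flat_def[symmetric]
  note Wpset = W.pset_W[unfolded defs] and Weq = W.W_eq_iff[unfolded defs]
  let ?TP = "{closed_segment (W x) (W y) | x y. x \<in> L \<and> y \<in> L \<and> x < y \<and> closed_segment (V x) (V y) \<in> T}"
  have flip_short: "(even x \<and> y = x + 2) \<or> (x = 0 \<and> y = 2 * n - 2)" if "flipped x y" for x y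
    using that by (auto simp: flipped_def)
  have nc: "\<not> crosses (closed_segment (W x) (W y)) (closed_segment (W z) (W w))"
    if p: "x \<in> L" "y \<in> L" "x < y" "closed_segment (V x) (V y) \<in> T" "z \<in> L" "w \<in> L" "z < w" "closed_segment (V z) (V w) \<in> T"
      and le: "x \<le> z" for x y z w
  proof -
    have nW: "W x \<noteq> W y" "W z \<noteq> W w" using Weq p by auto
    have mW: "W x \<in> W ` L" "W y \<in> W ` L" "W z \<in> W ` L" "W w \<in> W ` L" using p by auto
    consider "flipped x y" | "flipped z w" | "{x, y} \<inter> {z, w} \<noteq> {}"
      | "diag T x y" "diag T z w" "x < z" "y \<noteq> z" "y \<noteq> w"
      using p le unfolding diag_def by (cases "x = z") auto
    then show ?thesis
    proof cases
      case 1
      then show ?thesis using W.short_not_crosses[unfolded defs, OF p(1,2) flip_short[OF 1] p(5,6)] p(7) by simp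
    next
      case 2
      then show ?thesis using W.short_not_crosses[unfolded defs, OF p(5,6) flip_short[OF 2] p(1,2)] p(3) crosses_sym by simp
    next
      case 3
      then have "{W x, W y} \<inter> {W z, W w} \<noteq> {}" by auto
      then show ?thesis using not_crosses_shared[OF Wpset mW nW] by simp
    next
      case 4
      consider "y < z" | "z < y" "y < w" | "w < y" using 4 by linarith
      then have "open_segment (W x) (W y) \<inter> open_segment (W z) (W w) = {}"
      proof cases
        case 1
        then show ?thesis using W.noninterleaved_disjoint(1)[unfolded defs, OF p(1,2,5,6,3)] p(7) by simp
      next
        case 2
        then show ?thesis using diag_no_interleaving[OF sp 4(1,2,3)] by simp
      next
        case 3
        then show ?thesis using W.noninterleaved_disjoint(2)[unfolded defs, OF p(1,5,6,2) 4(3) p(7)] by simp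
      qed
      then show ?thesis using crosses_segments[OF nW] by simp
    qed
  qed
  have NC: "noncrossing ?TP" unfolding noncrossing_def
  proof (intro ballI)
    fix e e' assume "e \<in> ?TP" "e' \<in> ?TP"
    then obtain x y z w where p: "e = closed_segment (W x) (W y)" "x \<in> L" "y \<in> L" "x < y" "closed_segment (V x) (V y) \<in> T"
      "e' = closed_segment (W z) (W w)" "z \<in> L" "w \<in> L" "z < w" "closed_segment (V z) (V w) \<in> T" by blast
    show "\<not> crosses e e'"
    proof (cases "x \<le> z")
      case True
      then show ?thesis using nc[OF p(2-5,7-10)] p(1,6) by simp
    next
      case False
      then show ?thesis using nc[OF p(7-10,2-5)] p(1,6) crosses_sym by simp
    qed
  qed
  have SUB: "?TP \<subseteq> edges (W ` L)" using Weq by (auto simp: closed_segment_in_edges_iff)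
  have MAX: "T' = ?TP" if T': "?TP \<subseteq> T'" "T' \<subseteq> edges (W ` L)" "noncrossing T'" for T'
  proof (rule antisym[OF _ T'(1)], rule subsetI, rule ccontr)
    fix e assume e: "e \<in> T'" "e \<notin> ?TP"
    then obtain x' y' where xy': "x' \<in> L" "y' \<in> L" "W x' \<noteq> W y'" "e = closed_segment (W x') (W y')"
      using T'(2) by (auto simp: edges_def)
    then have "x' \<noteq> y'" by auto
    then obtain x y where xy: "x \<in> L" "y \<in> L" "x < y" "e = closed_segment (W x) (W y)"
      using xy' closed_segment_commute by (metis linorder_neqE_nat)
    then have notT: "closed_segment (V x) (V y) \<notin> T" using e(2) by blast
    have nf: "\<not> flipped x y"
    proof
      assume "flipped x y"
      then obtain i where i: "i \<in> J" "{V x, V y} = {G i, G (Suc i)}" using flipped_edge xy by metis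
      have eq: "closed_segment (V x) (V y) = closed_segment (G i) (G (Suc i))" using i(2) by (simp only: closed_segment_eq)
      have "closed_segment (G i) (G (Suc i)) \<in> T" using sp J_less[OF i(1)] unfolding spanning_def by blast
      then show False using notT unfolding eq by blast
    qed
    obtain i j where ij: "diag T i j" "i < x \<and> x < j \<and> j < y \<or> x < i \<and> i < y \<and> y < j"
      using diag_maximal[OF T sp xy(1-3)] notT by (auto simp: diag_def)
    have ijL: "i \<in> L" "j \<in> L" "i < j" "\<not> flipped i j" "closed_segment (V i) (V j) \<in> T" using ij(1) by (auto simp: diag_def)
    have "closed_segment (W i) (W j) \<in> T'" using T'(1) ijL by blast
    \<comment> \<open>A flat triple among four interleaved labels contains the two ends of a hull
      edge and the label attached to it, so one of the two pairs would be flipped.\<close>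
    moreover have flats: "\<not> flat a b c \<and> \<not> flat a c e' \<and> \<not> flat b c e'"
      if "a < b" "b < c" "c < e'" "b \<in> L" "c \<in> L" "e' \<in> L" "\<not> flipped a c" "\<not> flipped b e'" for a b c e'
    proof -
      have "e' < 2 * n" using that by (simp add: L_def)
      then show ?thesis using that unfolding flat_def flipped_def by auto
    qed
    from ij(2) have "crosses (closed_segment (W i) (W j)) e"
    proof
      assume "i < x \<and> x < j \<and> j < y"
      then have h: "i < x" "x < j" "j < y" by auto
      note f = flats[OF h xy(1) ijL(2) xy(2) ijL(4) nf]
      show ?thesis unfolding xy(4)
        using W.interleaved_cross[unfolded defs, OF ijL(1) xy(1) ijL(2) xy(2) h] f by simp
    next
      assume "x < i \<and> i < y \<and> y < j"
      then have h: "x < i" "i < y" "y < j" by auto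
      note f = flats[OF h ijL(1) xy(2) ijL(2) nf ijL(4)]
      have "crosses e (closed_segment (W i) (W j))" unfolding xy(4)
        using W.interleaved_cross[unfolded defs, OF xy(1) ijL(1) xy(2) ijL(2) h] f by simp
      then show ?thesis using crosses_sym by blast
    qed
    ultimately show False using T'(3) e(1) by (simp add: noncrossing_def)
  qed
  show ?thesis unfolding triangulation_def
  proof (intro conjI allI impI)
    fix T' assume "?TP \<subseteq> T' \<and> T' \<subseteq> edges (W ` L) \<and> noncrossing T'"
    then show "T' = ?TP" using MAX[of T'] by (elim conjE)
  qed (rule SUB NC)+
qed

section \<open>The order type of the double circle\<close>

lemma det3_similarity: "det3 (c + w * x) (c + w * y) (c + w * z) = (norm w)\<^sup>2 * det3 x y z"
  unfolding det3_def cmod_power2 by (simp add: power2_eq_square algebra_simps)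

lemma sin_product_identity:
  fixes p q :: real
  shows "sin (2 * p) + sin (2 * q) - sin (2 * (p + q)) = 4 * sin p * sin q * sin (p + q)"
proof -
  have "sin p ^ 2 + cos p ^ 2 = 1" "sin q ^ 2 + cos q ^ 2 = 1" by simp_all
  then show ?thesis
    unfolding sin_double sin_add cos_add by algebra
qed

lemma det3_cis: "det3 (cis a) (cis b) (cis c) = 4 * sin ((b - a) / 2) * sin ((c - b) / 2) * sin ((c - a) / 2)"
proof -
  define p q where "p = (b - a) / 2" and "q = (c - b) / 2"
  have e: "(c - a) / 2 = p + q" "2 * p = b - a" "2 * q = c - b" "2 * (p + q) = c - a"
    by (simp_all add: p_def q_def field_simps)
  have "det3 (cis a) (cis b) (cis c) = sin (b - a) + sin (c - b) - sin (c - a)"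
    by (simp add: det3_def sin_diff algebra_simps)
  then show ?thesis using sin_product_identity[of p q] unfolding e p_def[symmetric] q_def[symmetric] e(1) by simp
qed

text \<open>As \<open>c\<close> is equidistant from the ends, the midpoint is the foot of the
  perpendicular for every point of the line from \<open>c\<close> through it; Pythagoras shows that
  it is the nearest point.\<close>

lemma infdist_segment_midpoint:
  fixes a b c :: complex
  assumes eq: "dist c a = dist c b" and r: "r \<le> 1"
  shows "infdist (c + r *\<^sub>R (midpoint a b - c)) (closed_segment a b) = (1 - r) * norm (midpoint a b - c)"
proof -
  let ?m = "midpoint a b" and ?x = "c + r *\<^sub>R (midpoint a b - c)"
  have d: "dist ?x ?m = (1 - r) * norm (?m - c)"
  proof -
    have "?x - ?m = (1 - r) *\<^sub>R (c - ?m)" by (simp add: algebra_simps)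
    then show ?thesis using r by (simp add: dist_norm norm_minus_commute)
  qed
  have orth: "(?m - c) \<bullet> (b - a) = 0"
  proof -
    have "(norm (b - c))\<^sup>2 = (norm (a - c))\<^sup>2" using eq by (simp add: dist_norm norm_minus_commute)
    then show ?thesis
      unfolding cmod_power2 by (simp add: midpoint_def inner_complex_def power2_eq_square field_simps)
  qed
  have ge: "(1 - r) * norm (?m - c) \<le> dist ?x y" if ys: "y \<in> closed_segment a b" for y
  proof -
    obtain u where u: "y = (1 - u) *\<^sub>R a + u *\<^sub>R b" using ys by (auto simp: in_segment)
    have y: "y = ?m + (u - 1 / 2) *\<^sub>R (b - a)"
      unfolding u midpoint_def by (simp add: complex_eq_iff field_simps)
    define v z where "v = ?m - c" and "z = (u - 1 / 2) *\<^sub>R (b - a)"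
    have o: "v \<bullet> z = 0" using orth by (simp add: v_def z_def)
    have "y - ?x = (1 - r) *\<^sub>R v + z" unfolding y v_def z_def by (simp add: algebra_simps)
    then have "(dist ?x y)\<^sup>2 = (norm ((1 - r) *\<^sub>R v + z))\<^sup>2" by (simp add: dist_norm norm_minus_commute)
    also have "\<dots> = (norm ((1 - r) *\<^sub>R v))\<^sup>2 + (norm z)\<^sup>2"
      by (rule norm_add_Pythagorean) (simp add: orthogonal_def o)
    also have "\<dots> \<ge> ((1 - r) * norm v)\<^sup>2" using r by simp
    finally show ?thesis unfolding v_def by (rule power2_le_imp_le) simp
  qed
  have m: "?m \<in> closed_segment a b" by simp
  show ?thesis
  proof (rule antisym)
    show "infdist ?x (closed_segment a b) \<le> (1 - r) * norm (?m - c)" using infdist_le[OF m, of ?x] d by simp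
    show "(1 - r) * norm (?m - c) \<le> infdist ?x (closed_segment a b)"
      using ge by (subst infdist_notempty) (auto intro!: cINF_greatest)
  qed
qed

text \<open>The bijection may permute the points, so only invariants independent of labels are
  extracted: cardinality and general position.\<close>

lemma same_order_type_point_set:
  assumes "same_order_type S T"
  shows "card S = card T" "point_set S \<longleftrightarrow> point_set T"
proof -
  obtain g where g: "bij_betw g S T" "\<And>a b c. a \<in> S \<Longrightarrow> b \<in> S \<Longrightarrow> c \<in> S \<Longrightarrow> orientation (g a) (g b) (g c) = orientation a b c"
    using assms unfolding same_order_type_def by blast
  show "card S = card T" using bij_betw_same_card[OF g(1)] .
  have o: "det3 (g a) (g b) (g c) = 0 \<longleftrightarrow> det3 a b c = 0" if "a \<in> S" "b \<in> S" "c \<in> S" for a b c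
    using g(2)[OF that] unfolding orientation_det3 by (metis sgn_0_0)
  have i: "g a = g b \<longleftrightarrow> a = b" if "a \<in> S" "b \<in> S" for a b using g(1) that by (auto simp: bij_betw_def inj_on_def)
  have T: "T = g ` S" using g(1) by (simp add: bij_betw_def)
  show "point_set S \<longleftrightarrow> point_set T"
    using bij_betw_finite[OF g(1)] o i unfolding point_set_def collinear_iff_det3 T by (simp add: ball_simps)
qed

section \<open>Inner points moving from the centre to the midpoints of the sides\<close>

locale regular_polygon_config =
  fixes n :: nat and c w :: complex
  assumes n3: "n \<ge> 3" and w0: "w \<noteq> 0"
begin

definition G where "G i = c + w * cis (2 * pi * real i / real n)"

lemma convex_polygon_G: "convex_polygon n G 1"
proof
  show "n \<ge> 3" by (rule n3)
  show "G n = G 0" using n3 by (simp add: G_def)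
  fix i j k assume ijk: "i < j" "j < k" "k < n"
  have pos: "sin ((2 * pi * real b / real n - 2 * pi * real a / real n) / 2) > 0" if "a < b" "b < n" for a b
  proof (rule sin_gt_zero)
    have e: "(2 * pi * real b / real n - 2 * pi * real a / real n) / 2 = pi * ((real b - real a) / real n)"
      by (simp add: diff_divide_distrib right_diff_distrib)
    have bn: "0 < (real b - real a) / real n" "(real b - real a) / real n < 1" using that by (auto simp: divide_simps)
    show "0 < (2 * pi * real b / real n - 2 * pi * real a / real n) / 2"
      unfolding e by (rule mult_pos_pos[OF pi_gt_zero bn(1)])
    show "(2 * pi * real b / real n - 2 * pi * real a / real n) / 2 < pi"
      unfolding e using mult_strict_left_mono[OF bn(2) pi_gt_zero] by (simp only: mult_1_right)
  qed
  have "det3 (G i) (G j) (G k) > 0" unfolding G_def det3_similarity det3_cis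
    using pos[of i j] pos[of j k] pos[of i k] ijk w0 by simp
  then show "1 * det3 (G i) (G j) (G k) > 0" by simp
qed

sublocale convex_polygon n G 1
  by (rule convex_polygon_G)

definition M where "M i = midpoint (G i) (G (Suc i))"

text \<open>At \<open>r = 0\<close> all inner points are at the centre and at \<open>r = 1\<close>
  they are the midpoints of the sides, where the configuration is \<open>bd\<close>.\<close>

definition W where "W r x = (if even x then G (x div 2) else c + r *\<^sub>R (M (x div 2) - c))"

lemma W_simps [simp]: "W r (2 * i) = G i" "W r (Suc (2 * i)) = c + r *\<^sub>R (M i - c)"
  by (simp_all add: W_def)

lemma W_one: "W 1 x = bd x"
  by (cases "even x") (auto simp: W_def M_def elim: oddE)

lemma sin_central: "sin (2 * pi / real n) > 0"
proof (rule sin_gt_zero)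
  show "0 < 2 * pi / real n" using n3 by simp
  show "2 * pi / real n < pi" using n3 by (simp add: divide_simps)
qed

lemma G_Suc: "G (Suc i) = c + w * (cis (2 * pi * real i / real n) * cis (2 * pi / real n))"
  by (simp add: G_def cis_mult add_divide_distrib distrib_left add.commute)

lemma det3_centre: "det3 (G i) (G (Suc i)) c > 0"
proof -
  let ?a = "2 * pi * real i / real n" and ?b = "2 * pi * real (Suc i) / real n"
  have "?b - ?a = (2 * pi * real (Suc i) - 2 * pi * real i) / real n" by (rule diff_divide_distrib[symmetric])
  also have "\<dots> = 2 * pi / real n" by (simp add: algebra_simps)
  finally have "?b - ?a = 2 * pi / real n" .
  have "det3 (G i) (G (Suc i)) (c + w * 0) = (norm w)\<^sup>2 * det3 (cis ?a) (cis ?b) 0"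
    unfolding G_def by (rule det3_similarity)
  also have "det3 (cis ?a) (cis ?b) 0 = sin (?b - ?a)" by (simp add: det3_def sin_diff algebra_simps)
  finally show ?thesis using sin_central w0 \<open>?b - ?a = 2 * pi / real n\<close> by simp
qed

lemma dist_G: "dist c (G i) = norm w"
  by (simp add: G_def dist_norm norm_mult)

definition h where "h = norm (M 0 - c)"

lemma norm_M: "norm (M i - c) = h"
proof -
  have e: "M j - c = w * ((1 + cis (2 * pi / real n)) / 2) * cis (2 * pi * real j / real n)" for j
    unfolding M_def G_Suc unfolding G_def midpoint_def by (simp add: scaleR_conv_of_real field_simps)
  have "norm (M j - c) = norm (w * ((1 + cis (2 * pi / real n)) / 2))" for j
    unfolding e by (simp add: norm_mult)
  then show ?thesis unfolding h_def by metis
qed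

lemma h_pos: "h > 0"
proof -
  have "M 0 \<noteq> c"
  proof
    assume "M 0 = c"
    then have "det3 (G 0) (G (Suc 0)) c = 0" unfolding M_def
      using det3_midpoint(3)[of "G 0" "G (Suc 0)" "G 0" "G (Suc 0)"] by simp
    then show False using det3_centre[of 0] by simp
  qed
  then show ?thesis by (simp add: h_def)
qed

text \<open>For \<open>r < 1\<close> the inner point of a side is strictly on the same side of it as
  the centre, so these triples are settled without any limit argument.\<close>

lemma flat_neg:
  assumes r: "r < 1" and f: "flat x y z"
  shows "det3 (W r x) (W r y) (W r z) < 0"
proof -
  have base: "det3 (G i) (c + r *\<^sub>R (M i - c)) (G (Suc i)) < 0" for i
  proof -
    have "c + r *\<^sub>R (M i - c) = (1 - r) *\<^sub>R c + r *\<^sub>R M i" by (simp add: algebra_simps)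
    then have "det3 (G i) (G (Suc i)) (c + r *\<^sub>R (M i - c)) = (1 - r) * det3 (G i) (G (Suc i)) c"
      by (simp add: det3_affine M_def det3_midpoint)
    then have "det3 (G i) (G (Suc i)) (c + r *\<^sub>R (M i - c)) > 0" using det3_centre r by simp
    then show ?thesis using det3_swap2[of "G i" "G (Suc i)"] by simp
  qed
  from f consider i where "x = 2 * i" "y = Suc (2 * i)" "z = 2 * Suc i" | "x = 2 * 0" "y = 2 * (n - 1)" "z = Suc (2 * (n - 1))"
    unfolding flat_def using n3 by (auto elim!: evenE)
  then show ?thesis
  proof cases
    case 1
    show ?thesis unfolding 1 W_simps by (rule base)
  next
    case 2
    have "Suc (n - 1) = n" using n3 by simp
    then have "det3 (G (n - 1)) (c + r *\<^sub>R (M (n - 1) - c)) (G 0) < 0" using base[of "n - 1"] wrap by simp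
    then show ?thesis unfolding 2 W_simps by (simp add: det3_cyclic)
  qed
qed

lemma continuous_det3_W: "continuous_on S (\<lambda>r. det3 (W r x) (W r y) (W r z))"
proof -
  have "continuous_on S (\<lambda>r. W r x)" for x unfolding W_def by (cases "even x") (auto intro!: continuous_intros)
  then show ?thesis unfolding det3_def by (intro continuous_intros)
qed

text \<open>At parameter \<open>1\<close> all non-flat triples are strictly positive; as they are
  finitely many, this persists nearby by continuity. Together with \<open>flat_neg\<close> it yields
  one configuration in general position to compare with.\<close>

lemma nonzero_near_one:
  assumes "r < 1"
  obtains p where "r < p" "p < 1" "\<And>x y z. \<lbrakk>x < y; y < z; z < 2 * n\<rbrakk> \<Longrightarrow> det3 (W p x) (W p y) (W p z) \<noteq> 0"
proof -
  define I where "I = {(x, y, z). x < y \<and> y < z \<and> z < 2 * n \<and> \<not> flat x y z}"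
  define f where "f = (\<lambda>t p. case t of (x, y, z) \<Rightarrow> det3 (W p x) (W p y) (W p z))"
  have "I \<subseteq> {..<2 * n} \<times> {..<2 * n} \<times> {..<2 * n}" by (auto simp: I_def)
  then have fin: "finite I" by (rule finite_subset) auto
  have "eventually (\<lambda>p. f t p > 0) (at_left 1)" if t: "t \<in> I" for t
  proof -
    obtain x y z where t': "t = (x, y, z)" by (cases t)
    have "continuous_on UNIV (f t)" unfolding f_def t' by (simp add: continuous_det3_W)
    then have "(f t \<longlongrightarrow> f t 1) (at 1)" by (simp add: continuous_on_def)
    then have "(f t \<longlongrightarrow> f t 1) (at_left 1)" by (rule tendsto_within_subset) simp
    moreover have "f t 1 > 0" using bd_position[of x y z] t by (simp add: f_def t' W_one I_def)
    ultimately show ?thesis by (rule order_tendstoD)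
  qed
  then have "eventually (\<lambda>p. \<forall>t\<in>I. f t p > 0) (at_left 1)" using fin by (simp add: eventually_ball_finite)
  moreover have "eventually (\<lambda>p. p \<in> {r<..<1}) (at_left 1)" using assms by (rule eventually_at_left_real)
  ultimately have "eventually (\<lambda>p. (\<forall>t\<in>I. f t p > 0) \<and> p \<in> {r<..<1}) (at_left 1)" by (rule eventually_conj)
  then obtain p where p: "\<forall>t\<in>I. f t p > 0" "r < p" "p < 1"
    using eventually_happens'[of "at_left (1::real)"] by auto
  have "det3 (W p x) (W p y) (W p z) \<noteq> 0" if "x < y" "y < z" "z < 2 * n" for x y z
  proof (cases "flat x y z")
    case True
    then show ?thesis using flat_neg[OF p(3)] by fastforce
  next
    case False
    then have "(x, y, z) \<in> I" using that by (simp add: I_def)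
    then show ?thesis using p(1) by (force simp: f_def)
  qed
  then show thesis using that p by blast
qed

lemma distinct_labels_nonzero:
  assumes nz: "\<And>x y z. \<lbrakk>x < y; y < z; z < 2 * n\<rbrakk> \<Longrightarrow> det3 (W p x) (W p y) (W p z) \<noteq> 0"
    and xyz: "x < 2 * n" "y < 2 * n" "z < 2 * n" "x \<noteq> y" "x \<noteq> z" "y \<noteq> z"
  shows "det3 (W p x) (W p y) (W p z) \<noteq> 0"
proof -
  have sym: "det3 (W p x) (W p y) (W p z) = 0 \<longleftrightarrow> det3 (W p y) (W p x) (W p z) = 0"
    "det3 (W p x) (W p y) (W p z) = 0 \<longleftrightarrow> det3 (W p x) (W p z) (W p y) = 0" for x y z
    using det3_swap[of "W p x" "W p y" "W p z"] det3_swap2[of "W p x" "W p y" "W p z"] by auto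
  show ?thesis using nz xyz sym by (metis linorder_neqE_nat)
qed

lemma point_set_imp_nonzero:
  assumes "point_set (W p ` {..<2 * n})" "card (W p ` {..<2 * n}) = 2 * n"
    and xyz: "x < y" "y < z" "z < 2 * n"
  shows "det3 (W p x) (W p y) (W p z) \<noteq> 0"
proof -
  have "inj_on (W p) {..<2 * n}" using assms(2) by (intro eq_card_imp_inj_on) auto
  then have "W p x \<noteq> W p y" "W p x \<noteq> W p z" "W p y \<noteq> W p z" using xyz by (auto dest: inj_onD)
  then show ?thesis using point_set_det3[OF assms(1)] xyz by simp
qed

lemma nonzero_imp_inj:
  assumes nz: "\<And>x y z. \<lbrakk>x < y; y < z; z < 2 * n\<rbrakk> \<Longrightarrow> det3 (W p x) (W p y) (W p z) \<noteq> 0"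
  shows "inj_on (W p) {..<2 * n}"
proof (rule inj_onI, rule ccontr)
  fix x y assume xy: "x \<in> {..<2 * n}" "y \<in> {..<2 * n}" "W p x = W p y" "x \<noteq> y"
  have "\<exists>z. z < 2 * n \<and> z \<noteq> x \<and> z \<noteq> y"
  proof -
    have "card ({..<2 * n} - {x, y}) \<ge> 2 * n - card {x, y}" using diff_card_le_card_Diff[of "{x, y}" "{..<2 * n}"] by simp
    moreover have "card {x, y} \<le> 2" by (simp add: card_insert_if)
    ultimately have "{..<2 * n} - {x, y} \<noteq> {}" using n3 by force
    then show ?thesis by auto
  qed
  then obtain z where "z < 2 * n" "z \<noteq> x" "z \<noteq> y" by blast
  then show False using distinct_labels_nonzero[OF nz, of x y z] xy by simp
qed

lemma nonzero_imp_point_set: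
  assumes nz: "\<And>x y z. \<lbrakk>x < y; y < z; z < 2 * n\<rbrakk> \<Longrightarrow> det3 (W p x) (W p y) (W p z) \<noteq> 0"
  shows "point_set (W p ` {..<2 * n})" "card (W p ` {..<2 * n}) = 2 * n"
proof -
  show "point_set (W p ` {..<2 * n})" unfolding point_set_def collinear_iff_det3
  proof (intro conjI ballI impI)
    fix a b d assume "a \<in> W p ` {..<2 * n}" "b \<in> W p ` {..<2 * n}" "d \<in> W p ` {..<2 * n}" and ne: "a \<noteq> b \<and> a \<noteq> d \<and> b \<noteq> d"
    then obtain x y z where "x < 2 * n" "y < 2 * n" "z < 2 * n" "a = W p x" "b = W p y" "d = W p z" by auto
    then show "det3 a b d \<noteq> 0" using distinct_labels_nonzero[OF nz, of x y z] ne by auto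
  qed simp
  show "card (W p ` {..<2 * n}) = 2 * n" using card_image[OF nonzero_imp_inj[OF nz]] by simp
qed

text \<open>No triple becomes collinear while the inner points move from the midpoints of the sides
  to their final position, so no orientation changes on the way.\<close>

lemma orientation_from_midpoints:
  assumes r: "r < 1" and same: "\<And>p. \<lbrakk>r < p; p < 1\<rbrakk> \<Longrightarrow> same_order_type (W r ` {..<2 * n}) (W p ` {..<2 * n})"
  shows "point_set (W r ` {..<2 * n})" "inj_on (W r) {..<2 * n}"
    "\<And>x y z. \<lbrakk>x < y; y < z; z < 2 * n; \<not> flat x y z\<rbrakk> \<Longrightarrow> det3 (W r x) (W r y) (W r z) > 0"
proof -
  obtain p0 where p0: "r < p0" "p0 < 1" "\<And>x y z. \<lbrakk>x < y; y < z; z < 2 * n\<rbrakk> \<Longrightarrow> det3 (W p0 x) (W p0 y) (W p0 z) \<noteq> 0"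
    using nonzero_near_one[OF r] by blast
  \<comment> \<open>General position and distinctness pass from \<open>p0\<close> to
    \<open>r\<close> through the common order type, and from \<open>r\<close> to every parameter in
    between. In particular the inner points are distinct at \<open>r\<close>.\<close>
  have g0: "point_set (W r ` {..<2 * n})" "card (W r ` {..<2 * n}) = 2 * n"
    using same_order_type_point_set[OF same[OF p0(1,2)]] nonzero_imp_point_set[OF p0(3)] by auto
  then show "point_set (W r ` {..<2 * n})" by simp
  have nz: "det3 (W p x) (W p y) (W p z) \<noteq> 0" if "r \<le> p" "p < 1" "x < y" "y < z" "z < 2 * n" for p x y z
  proof -
    have "point_set (W p ` {..<2 * n})" "card (W p ` {..<2 * n}) = 2 * n"
      using g0 same_order_type_point_set[OF same[of p]] that(1,2) by (cases "p = r"; simp)+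
    then show ?thesis using point_set_imp_nonzero that by blast
  qed
  show "inj_on (W r) {..<2 * n}" using nonzero_imp_inj nz r by blast
  fix x y z assume xyz: "x < y" "y < z" "z < 2 * n" "\<not> flat x y z"
  define f where "f = (\<lambda>p. det3 (W p x) (W p y) (W p z))"
  have f1: "f 1 > 0" using bd_position[OF xyz] by (simp add: f_def W_one)
  show "det3 (W r x) (W r y) (W r z) > 0"
  proof (rule ccontr)
    assume "\<not> ?thesis"
    then have "f r \<le> 0" by (simp add: f_def)
    moreover have "continuous_on {r..1} f" unfolding f_def by (rule continuous_det3_W)
    ultimately obtain p where p: "r \<le> p" "p \<le> 1" "f p = 0"
      using IVT'[of f r 0 1] f1 r by auto
    then have "p \<noteq> 1" using f1 by auto
    then show False using nz[of p x y z] p xyz by (simp add: f_def)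
  qed
qed

text \<open>The centre is the mean of the vertices, because the \<open>n\<close>-th roots of unity
  sum to zero.\<close>

lemma centre_in_hull: "c \<in> convex hull (G ` {..<n})"
proof -
  define z where "z = cis (2 * pi / real n)"
  have "z \<noteq> 1" using sin_central by (auto simp: z_def complex_eq_iff)
  have zi: "cis (2 * pi * real i / real n) = z ^ i" for i
  proof -
    have "z ^ i = cis (real i * (2 * pi / real n))" by (simp only: z_def Complex.DeMoivre)
    also have "real i * (2 * pi / real n) = 2 * pi * real i / real n" by simp
    finally show ?thesis by (rule sym)
  qed
  have "z ^ n = 1" using zi[of n] n3 by simp
  then have s0: "(\<Sum>i<n. z ^ i) = 0" using geometric_sum[OF \<open>z \<noteq> 1\<close>, of n] by simp
  have "(\<Sum>i<n. (1 / real n) *\<^sub>R G i) = (1 / real n) *\<^sub>R (\<Sum>i<n. G i)" by (rule scaleR_sum_right[symmetric])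
  also have "(\<Sum>i<n. G i) = real n *\<^sub>R c + w * (\<Sum>i<n. z ^ i)"
    by (simp add: G_def zi sum.distrib sum_distrib_left scaleR_conv_of_real)
  also have "(1 / real n) *\<^sub>R \<dots> = c" using n3 s0 by simp
  finally have "(\<Sum>i<n. (1 / real n) *\<^sub>R G i) = c" .
  moreover have "(\<Sum>i<n. (1 / real n) *\<^sub>R G i) \<in> convex hull (G ` {..<n})"
    using n3 by (intro convex_sum) (auto intro: hull_inc)
  ultimately show ?thesis by simp
qed

lemma W_in_hull:
  assumes "0 \<le> r" "r \<le> 1" "x < 2 * n"
  shows "W r x \<in> convex hull (G ` {..<n})"
proof -
  have Gi: "G i \<in> convex hull (G ` {..<n})" if "i \<le> n" for i
    using that wrap n3 by (cases "i = n") (auto intro: hull_inc)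
  show ?thesis
  proof (cases "even x")
    case True
    then show ?thesis using Gi assms(3) by (auto simp: W_def)
  next
    case False
    then obtain i where i: "x = Suc (2 * i)" by (metis oddE Suc_eq_plus1)
    then have "closed_segment (G i) (G (Suc i)) \<subseteq> convex hull (G ` {..<n})"
      using assms(3) by (intro closed_segment_subset Gi) auto
    then have "M i \<in> convex hull (G ` {..<n})" by (auto simp: M_def)
    then have "closed_segment c (M i) \<subseteq> convex hull (G ` {..<n})" using centre_in_hull by (intro closed_segment_subset) auto
    moreover have "c + r *\<^sub>R (M i - c) = (1 - r) *\<^sub>R c + r *\<^sub>R M i" by (simp add: algebra_simps)
    then have "W r x \<in> closed_segment c (M i)" unfolding in_segment i W_simps using assms by blast
    ultimately show ?thesis by blast
  qed
qed

end

section \<open>Universality\<close>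

text \<open>The hull edges give supporting lines with individual signs; once these are known to
  agree, the cyclic order is convex and an optimal assignment of the interior points supplies
  \<open>q\<close>.\<close>

lemma hull_config_exists:
  assumes n3: "n \<ge> 3" and J: "J \<subseteq> {..<n}" and Q: "point_set Q" and wrap: "G n = G 0" and inj: "inj_on G {..<n}"
    and hv: "hull_vertices Q = G ` {..<n}" and card: "card Q = n + card J"
    and edges: "\<And>i. i < n \<Longrightarrow> closed_segment (G i) (G (Suc i)) edge_of convex hull Q"
  obtains s q where "hull_config n G s J q" "G ` {..<n} \<union> q ` J = Q"
proof -
  have finQ: "finite Q" using Q by (simp add: point_set_def)
  have GQ: "G ` {..<n} \<subseteq> Q"
    unfolding hv[symmetric] hull_vertices_def using extreme_point_of_convex_hull by blast
  have Gin: "G i \<in> Q" if "i \<le> n" for i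
    using GQ wrap n3 that by (cases "i = n") auto
  have eq: "G i = G j \<longleftrightarrow> i = j" if "i < n" "j < n" for i j using inj that by (auto dest: inj_onD)
  have ne: "G i \<noteq> G (Suc i)" if "i < n" for i
  proof (cases "Suc i = n")
    case True
    then show ?thesis using wrap eq[of i 0] n3 that by auto
  next
    case False
    then show ?thesis using eq[of i "Suc i"] that by auto
  qed
  have "\<exists>s. (s = 1 \<or> s = - 1) \<and> (\<forall>x\<in>Q. x \<noteq> G i \<longrightarrow> x \<noteq> G (Suc i) \<longrightarrow> s * det3 (G i) (G (Suc i)) x > 0)" if "i < n" for i
    using hull_edgeD[OF Q Gin Gin ne edges, of i] that by (metis Suc_leI less_imp_le)
  then obtain sg where sg: "\<And>i. i < n \<Longrightarrow> sg i = 1 \<or> sg i = (- 1 :: real)"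
    "\<And>i x. i < n \<Longrightarrow> x \<in> Q \<Longrightarrow> x \<noteq> G i \<Longrightarrow> x \<noteq> G (Suc i) \<Longrightarrow> sg i * det3 (G i) (G (Suc i)) x > 0" by metis
  \<comment> \<open>The signs of consecutive sides are both determined by the orientation of the
    same triangle of three consecutive vertices.\<close>
  have step: "sg (Suc i) = sg i" if i: "Suc i < n" for i
  proof -
    have d: "G (Suc (Suc i)) \<noteq> G i"
    proof (cases "Suc (Suc i) = n")
      case True
      then show ?thesis using wrap eq[of 0 i] n3 i by auto
    next
      case False
      then show ?thesis using eq[of "Suc (Suc i)" i] i by auto
    qed
    have "sg i * det3 (G i) (G (Suc i)) (G (Suc (Suc i))) > 0"
      using sg(2)[of i "G (Suc (Suc i))"] d ne[OF i] Gin[of "Suc (Suc i)"] i by auto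
    moreover have "sg (Suc i) * det3 (G (Suc i)) (G (Suc (Suc i))) (G i) > 0"
      using sg(2)[of "Suc i" "G i"] d ne[of i] Gin[of i] i by auto
    moreover have "det3 (G (Suc i)) (G (Suc (Suc i))) (G i) = det3 (G i) (G (Suc i)) (G (Suc (Suc i)))" by (rule det3_rotate)
    ultimately show ?thesis using sg(1)[of i] sg(1)[of "Suc i"] i by (auto simp: zero_less_mult_iff)
  qed
  define s where "s = sg 0"
  have sgs: "sg i = s" if "i < n" for i using that by (induction i) (simp_all add: step s_def)
  have side: "s * det3 (G i) (G (Suc i)) x > 0" if "i < n" "x \<in> Q" "x \<noteq> G i" "x \<noteq> G (Suc i)" for i x
    using sg(2)[OF that] sgs[OF that(1)] by simp
  have cp: "convex_polygon n G s"
    by (rule convex_polygon_if_edges[OF n3 wrap inj]) (use side Gin in auto)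
  define X where "X = Q - G ` {..<n}"
  have "card X = card J" unfolding X_def using card GQ inj by (simp add: card_Diff_subset card_image)
  moreover have "finite J" using J finite_subset by blast
  moreover have "finite X" using finQ by (simp add: X_def)
  moreover have "s * det3 (G i) (G (Suc i)) x > 0" if "i \<in> J" "x \<in> X" for i x
  proof -
    have i: "i < n" using J that by auto
    have "G (Suc i) \<in> G ` {..<n}" using i wrap n3 by (cases "Suc i = n") auto
    then have "x \<noteq> G i" "x \<noteq> G (Suc i)" "x \<in> Q" using that(2) i unfolding X_def by auto
    then show ?thesis using side i by blast
  qed
  ultimately obtain q where q: "bij_betw q J X"
    "\<And>i j. \<lbrakk>i \<in> J; j \<in> J; i \<noteq> j\<rbrakk> \<Longrightarrow> (s * det3 (G i) (G (Suc i)) (q i)) * (s * det3 (G j) (G (Suc j)) (q j))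
      \<le> (s * det3 (G i) (G (Suc i)) (q j)) * (s * det3 (G j) (G (Suc j)) (q i))"
    using optimal_assignment[of J X "\<lambda>i x. s * det3 (G i) (G (Suc i)) x"] by metis
  have qX: "q ` J = X" using q(1) by (simp add: bij_betw_def)
  have un: "G ` {..<n} \<union> q ` J = Q" using qX GQ by (auto simp: X_def)
  have "compact (convex hull Q)" using finQ by (simp add: finite_imp_compact_convex_hull)
  then have hull: "convex hull (G ` {..<n}) = convex hull Q"
    using extreme_points_eq[of Q] hv by (simp add: hull_vertices_def)
  interpret cp: convex_polygon n G s by (rule cp)
  have "hull_config n G s J q"
  proof
    show "J \<subseteq> {..<n}" by (rule J)
    show "point_set (G ` {..<n} \<union> q ` J)" using un Q by simp
    show "inj_on q J" using q(1) by (simp add: bij_betw_def)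
    show "q i \<in> convex hull (G ` {..<n})" if "i \<in> J" for i
      unfolding hull using qX that by (intro hull_inc) (auto simp: X_def)
    show "q ` J \<inter> G ` {..<n} = {}" unfolding qX X_def by blast
    show "s * det3 (G i) (G (Suc i)) x > 0" if "i < n" "x \<in> G ` {..<n} \<union> q ` J" "x \<noteq> G i" "x \<noteq> G (Suc i)" for i x
      using side that un by blast
  qed (rule q(2))
  then show thesis using that un by blast
qed

context regular_polygon_config
begin

lemma universal_double_circle:
  assumes r: "0 \<le> r" "r < 1" and J: "J \<subseteq> {..<n}"
    and same: "\<And>p. \<lbrakk>r < p; p < 1\<rbrakk> \<Longrightarrow> same_order_type (W r ` {..<2 * n}) (W p ` {..<2 * n})"
  shows "universal (G ` {..<n} \<union> (\<lambda>i. c + r *\<^sub>R (M i - c)) ` J)"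
proof -
  define L where "L = {x. x < 2 * n \<and> (odd x \<longrightarrow> x div 2 \<in> J)}"
  have Lsub: "L \<subseteq> {..<2 * n}" by (auto simp: L_def)
  then have finL: "finite L" by (rule finite_subset) simp
  have injW: "inj_on (W r) L" using orientation_from_midpoints(2)[OF r(2) same] Lsub inj_on_subset by blast
  have ps: "point_set (W r ` L)"
    using orientation_from_midpoints(1)[OF r(2) same] finL Lsub unfolding point_set_def by blast
  have dct: "double_circle_type n J (W r)"
  proof (unfold_locales, goal_cases)
    case 1 show ?case by (rule n3)
  next
    case 2 show ?case using injW unfolding L_def .
  next
    case 3 show ?case using ps unfolding L_def .
  next
    case (4 x y z)
    then show ?case using orientation_from_midpoints(3)[OF r(2) same, of x y z] by (auto simp: flat_def)
  next
    case (5 x y z)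
    then show ?case using flat_neg[OF r(2), of x y z] by (auto simp: flat_def)
  qed
  interpret D: double_circle_type n J "W r" "{x. x < 2 * n \<and> (odd x \<longrightarrow> x div 2 \<in> J)}"
     "\<lambda>x y z. (even x \<and> y = x + 1 \<and> z = x + 2) \<or> (x = 0 \<and> y = 2 * n - 2 \<and> z = 2 * n - 1)"
    using dct by simp_all
  have Lev: "2 * i \<in> L" if "i < n" for i using that by (simp add: L_def)
  have PW: "G ` {..<n} \<union> (\<lambda>i. c + r *\<^sub>R (M i - c)) ` J = W r ` L"
    unfolding L_def labels_eq[OF J] by (simp add: image_Un image_image)
  let ?P = "W r ` L"
  have GP: "G i \<in> ?P" if "i \<le> n" for i
  proof -
    have "G i \<in> G ` {..<n}" using that wrap n3 by (cases "i = n") auto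
    then show ?thesis using PW by blast
  qed
  have injG: "inj_on G {..<n}"
  proof (rule inj_onI)
    fix i j assume "i \<in> {..<n}" "j \<in> {..<n}" "G i = G j"
    then have "W r (2 * i) = W r (2 * j)" "2 * i \<in> L" "2 * j \<in> L" using Lev by auto
    then have "2 * i = 2 * j" by (rule inj_onD[OF injW])
    then show "i = j" by simp
  qed
  have hullP: "convex hull ?P = convex hull (G ` {..<n})"
  proof
    have "?P \<subseteq> convex hull (G ` {..<n})" using W_in_hull[of r] r Lsub by auto
    then show "convex hull ?P \<subseteq> convex hull (G ` {..<n})" by (simp add: hull_minimal)
    show "convex hull (G ` {..<n}) \<subseteq> convex hull ?P" using PW by (intro hull_mono) blast
  qed
  have edgesP: "closed_segment (G i) (G (Suc i)) edge_of convex hull ?P" if i: "i < n" for i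
  proof (cases "Suc i < n")
    case True
    have l: "2 * i \<in> L" "2 * i + 2 \<in> L" using Lev[of i] Lev[of "Suc i"] True by auto
    have e: "W r (2 * i + 2) = G (Suc i)" using W_simps(1)[of r "Suc i"] by simp
    show ?thesis
    proof (rule hull_edgeI[where s = 1])
      show "G i \<in> ?P" "G (Suc i) \<in> ?P" using GP True by auto
      show "G i \<noteq> G (Suc i)" using injG True by (auto dest: inj_onD)
      fix p assume p: "p \<in> ?P" "p \<noteq> G i" "p \<noteq> G (Suc i)"
      then obtain x where x: "x \<in> L" "p = W r x" by blast
      have "x \<noteq> 2 * i" using x(2) p(2) by auto
      moreover have "x \<noteq> 2 * i + 2" using x(2) p(3) e by metis
      ultimately have "det3 (W r (2 * i)) (W r (2 * i + 2)) (W r x) > 0"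
        by (intro D.polygon_side[folded L_def]) (use l x in auto)
      then show "1 * det3 (G i) (G (Suc i)) p > 0" using e x by simp
    qed
  next
    case False
    then have sn: "Suc i = n" using i by simp
    have i2: "2 * n - 2 = 2 * i" using sn by linarith
    have e1: "W r (2 * n - 2) = G i" unfolding i2 by (rule W_simps)
    have e2: "W r 0 = G (Suc i)" unfolding sn wrap using W_simps(1)[of r 0] by simp
    note e = e1 e2
    show ?thesis
    proof (rule hull_edgeI[where s = 1])
      show "G i \<in> ?P" "G (Suc i) \<in> ?P" using GP[of i] GP[of "Suc i"] i by simp_all
      have "i \<noteq> 0" using sn n3 by linarith
      then have "G i \<noteq> G 0" using inj_onD[OF injG, of i 0] i by auto
      then show "G i \<noteq> G (Suc i)" unfolding sn wrap .
      fix p assume p: "p \<in> ?P" "p \<noteq> G i" "p \<noteq> G (Suc i)"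
      then obtain x where x: "x \<in> L" "p = W r x" by blast
      have "x \<noteq> 2 * n - 2" using x(2) p(2) e1 by metis
      moreover have "x \<noteq> 0" using x(2) p(3) e2 by metis
      ultimately have "det3 (W r (2 * n - 2)) (W r 0) (W r x) > 0"
        by (intro D.polygon_side_wrap[folded L_def] x)
      then show "1 * det3 (G i) (G (Suc i)) p > 0" unfolding e1 e2 x(2) by simp
    qed
  qed
  have hvP: "hull_vertices ?P = G ` {..<n}"
  proof
    show "hull_vertices ?P \<subseteq> G ` {..<n}"
      unfolding hull_vertices_def hullP using extreme_point_of_convex_hull by blast
    show "G ` {..<n} \<subseteq> hull_vertices ?P"
    proof
      fix p assume "p \<in> G ` {..<n}"
      then obtain i where i: "i < n" "p = G i" by blast
      have "closed_segment (G i) (G (Suc i)) face_of convex hull ?P" using edgesP[OF i(1)] by (simp add: edge_of_def)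
      moreover have "G i extreme_point_of closed_segment (G i) (G (Suc i))" by (simp add: extreme_point_of_segment)
      ultimately show "p \<in> hull_vertices ?P" using i(2) extreme_point_of_face by (auto simp: hull_vertices_def)
    qed
  qed
  have cardP: "card ?P = n + card J"
  proof -
    have "L = (\<lambda>i. 2 * i) ` {..<n} \<union> (\<lambda>i. Suc (2 * i)) ` J" unfolding L_def by (rule labels_eq[OF J])
    moreover have "card ((\<lambda>i. 2 * i) ` {..<n} \<union> (\<lambda>i. Suc (2 * i)) ` J) = n + card J"
    proof (subst card_Un_disjoint)
      show "(\<lambda>i. 2 * i) ` {..<n} \<inter> (\<lambda>i. Suc (2 * i)) ` J = {}" by auto presburger
      show "finite ((\<lambda>i. Suc (2 * i)) ` J)" using J finite_subset by blast
    qed (simp_all add: card_image inj_on_def)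
    ultimately show ?thesis using card_image[OF injW] by simp
  qed
  show ?thesis unfolding PW universal_def
  proof (intro conjI allI impI)
    show "point_set ?P" by (rule ps)
    fix Q f0 assume "point_set Q \<and> card Q = card ?P \<and> cyclic_bijection ?P Q f0"
    then have Q: "point_set Q" "card Q = card ?P" "cyclic_bijection ?P Q f0" by auto
    define H where "H = (\<lambda>i. f0 (G i))"
    have bij: "bij_betw f0 (G ` {..<n}) (hull_vertices Q)" using Q(3) hvP by (simp add: cyclic_bijection_def)
    have edges: "closed_segment (H i) (H (Suc i)) edge_of convex hull Q" if "i < n" for i
    proof -
      have "G (Suc i) \<in> G ` {..<n}" using that wrap n3 by (cases "Suc i = n") auto
      then show ?thesis using Q(3) edgesP[OF that] that unfolding cyclic_bijection_def hvP H_def by blast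
    qed
    obtain s q where hc: "hull_config n H s J q" and Qeq: "H ` {..<n} \<union> q ` J = Q"
    proof (rule hull_config_exists[OF n3 J Q(1), of H])
      show "H n = H 0" using wrap by (simp add: H_def)
      show "inj_on H {..<n}" unfolding H_def using comp_inj_on[OF injG] bij by (auto simp: bij_betw_def comp_def)
      show "hull_vertices Q = H ` {..<n}" using bij by (auto simp: bij_betw_def H_def)
      show "card Q = n + card J" using Q(2) cardP by simp
    qed (use edges in auto)
    interpret C: hull_config n H s J q by (rule hc)
    have CL: "C.L = L" by (simp add: C.L_def L_def)
    have CS: "C.S = Q" using Qeq by (simp add: C.S_def)
    obtain T where T: "triangulation C.S T" "C.spanning T" by (rule C.spanning_triangulation)
    define TP where "TP = {closed_segment (W r x) (W r y) | x y. x \<in> L \<and> y \<in> L \<and> x < y \<and> closed_segment (C.V x) (C.V y) \<in> T}"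
    have TP: "triangulation ?P TP" using C.transfer_triangulation[OF dct T] unfolding CL TP_def .
    \<comment> \<open>Points with the same label correspond. On even labels this is
      \<open>f0\<close>, so \<open>f\<close> extends the given bijection of the hull
      vertices.\<close>
    define f where "f = (\<lambda>p. C.V (inv_into L (W r) p))"
    have fW: "f (W r x) = C.V x" if "x \<in> L" for x using inv_into_f_f[OF injW that] by (simp add: f_def)
    have injV: "inj_on C.V L" using C.V_eq_iff by (auto simp: inj_on_def CL)
    have "bij_betw f ?P Q"
      unfolding bij_betw_def
    proof
      show "inj_on f ?P" using fW injV by (auto simp: inj_on_def)
      have "f ` ?P = C.V ` L" using fW by (simp add: image_image)
      then show "f ` ?P = Q" using C.V_image CL CS by simp
    qed
    moreover have "f p = f0 p" if "p \<in> hull_vertices ?P" for p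
    proof -
      obtain i where i: "i < n" "p = G i" using \<open>p \<in> hull_vertices ?P\<close> unfolding hvP by auto
      have "f p = C.V (2 * i)" using fW[OF Lev[OF i(1)]] i(2) by simp
      also have "\<dots> = H i" by (rule C.V_simps)
      also have "\<dots> = f0 p" using i(2) by (simp add: H_def)
      finally show ?thesis .
    qed
    moreover have "compatible_triangulation ?P Q f TP T"
      unfolding compatible_triangulation_def
    proof (intro conjI ballI)
      show "triangulation ?P TP" by (rule TP)
      show "triangulation Q T" using T(1) CS by simp
      have key: "closed_segment (W r x) (W r y) \<in> TP \<longleftrightarrow> closed_segment (C.V x) (C.V y) \<in> T"
        if xy: "x \<in> L" "y \<in> L" "x < y" for x y
      proof
        assume "closed_segment (W r x) (W r y) \<in> TP"
        then obtain x' y' where x': "x' \<in> L" "y' \<in> L" "x' < y'" "closed_segment (C.V x') (C.V y') \<in> T"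
          "closed_segment (W r x) (W r y) = closed_segment (W r x') (W r y')" unfolding TP_def by blast
        then have "{W r x, W r y} = {W r x', W r y'}" by (simp only: closed_segment_eq)
        then have "x = x' \<and> y = y'" using xy x'(1-3) inj_on_eq_iff[OF injW] unfolding doubleton_eq_iff
          by (metis less_asym)
        then show "closed_segment (C.V x) (C.V y) \<in> T" using x'(4) by simp
      next
        assume "closed_segment (C.V x) (C.V y) \<in> T"
        then show "closed_segment (W r x) (W r y) \<in> TP" unfolding TP_def using xy by blast
      qed
      fix p p' assume "p \<in> ?P" "p' \<in> ?P"
      then obtain x y where xy: "x \<in> L" "p = W r x" "y \<in> L" "p' = W r y" by blast
      consider "x < y" | "y < x" | "x = y" by linarith
      then show "closed_segment p p' \<in> TP \<longleftrightarrow> closed_segment (f p) (f p') \<in> T"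
      proof cases
        case 1
        then show ?thesis using key[of x y] xy fW by simp
      next
        case 2
        then show ?thesis
          unfolding closed_segment_commute[of p p'] closed_segment_commute[of "f p" "f p'"]
          using key[of y x] xy fW by simp
      next
        case 3
        have "closed_segment p p \<notin> TP" using TP closed_segment_in_edges_iff[of p p] unfolding triangulation_def by blast
        moreover have "closed_segment (f p) (f p) \<notin> T"
          using T(1) closed_segment_in_edges_iff[of "f p" "f p"] unfolding triangulation_def by blast
        ultimately show ?thesis using 3 xy by simp
      qed
    qed
    ultimately show "\<exists>f. bij_betw f ?P Q \<and> (\<forall>p\<in>hull_vertices ?P. f p = f0 p) \<and>
           (\<exists>TP TQ. compatible_triangulation ?P Q f TP TQ)" by blast
  qed
qed

end

theorem theorem11:
  fixes n :: nat and P A :: "nat \<Rightarrow> complex" and I' :: "complex set"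
  assumes "n \<ge> 3"
    and "double_circle n P A"
    and "I' \<subseteq> A ` {1..n}"
  shows "universal (P ` {1..n} \<union> I')"
proof -
  note n3 = assms(1)
  obtain c e where e: "0 < e" "regular_polygon n c P" "inner_points n c P e A"
    and stable: "\<And>e' A'. \<lbrakk>0 < e'; e' < e; inner_points n c P e' A'\<rbrakk> \<Longrightarrow>
      same_order_type (P ` {1..n} \<union> A ` {1..n}) (P ` {1..n} \<union> A' ` {1..n})"
    using assms(2) unfolding double_circle_def by blast
  obtain w where w: "w \<noteq> 0" "\<And>i. i \<in> {1..n} \<Longrightarrow> P i = c + w * cis (2 * pi * real i / real n)"
    using e(2) unfolding regular_polygon_def by blast
  interpret R: regular_polygon_config n c w by unfold_locales (use n3 w in auto)
  \<comment> \<open>The given vertices are numbered from \<open>1\<close> to \<open>n\<close> but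
    the labels start at \<open>0\<close>; vertex \<open>n\<close> is \<open>R.G 0\<close>.\<close>
  define idx where "idx = (\<lambda>i. if i = 0 then n else i)"
  have idx_img: "idx ` {..<n} = {1..n}"
  proof (intro equalityI subsetI)
    fix k assume k: "k \<in> {1..n}"
    then have "k = idx (if k = n then 0 else k)" "(if k = n then 0 else k) < n" using n3 by (auto simp: idx_def)
    then show "k \<in> idx ` {..<n}" by blast
  qed (use n3 in \<open>auto simp: idx_def\<close>)
  have PG: "P k = R.G k" if "k \<in> {1..n}" for k using w(2)[OF that] by (simp add: R.G_def)
  have Pidx: "P (idx i) = R.G i" "P (idx i mod n + 1) = R.G (Suc i)" if "i < n" for i
    using PG[of "idx i"] PG[of "Suc i"] R.wrap that n3 by (auto simp: idx_def)
  have mid: "midpoint (P (idx i)) (P (idx i mod n + 1)) = R.M i" if "i < n" for i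
    using Pidx[OF that] by (simp add: R.M_def)
  have inf: "infdist (c + u *\<^sub>R (R.M i - c)) (closed_segment (P (idx i)) (P (idx i mod n + 1))) = (1 - u) * R.h"
    if "i < n" "u \<le> 1" for i u
    using infdist_segment_midpoint[of c "R.G i" "R.G (Suc i)" u] R.dist_G R.norm_M that(2)
    unfolding Pidx[OF that(1)] R.M_def by simp
  \<comment> \<open>\<open>R.h\<close> is the apothem, and the inner point at parameter
    \<open>u\<close> has distance \<open>(1 - u) * R.h\<close> from its side; solving for distance
    \<open>e\<close> gives \<open>r\<close>.\<close>
  define r where "r = 1 - e / R.h"
  have inner: "A (idx i) = c + r *\<^sub>R (R.M i - c) \<and> 0 \<le> r" if i: "i < n" for i
  proof -
    have ii: "idx i \<in> {1..n}" using idx_img i by blast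
    have a: "A (idx i) \<in> closed_segment c (R.M i)"
      "infdist (A (idx i)) (closed_segment (P (idx i)) (P (idx i mod n + 1))) = e"
      using bspec[OF e(3)[unfolded inner_points_def] ii] unfolding mid[OF i] by blast+
    then obtain u where u: "0 \<le> u" "u \<le> 1" "A (idx i) = (1 - u) *\<^sub>R c + u *\<^sub>R R.M i" by (auto simp: in_segment)
    have Au: "A (idx i) = c + u *\<^sub>R (R.M i - c)" unfolding u(3) by (simp add: algebra_simps)
    then have "(1 - u) * R.h = e" using inf[OF i u(2)] a(2) by simp
    then have "u = r" using R.h_pos by (simp add: r_def field_simps)
    then show ?thesis using Au u(1) by simp
  qed
  have r: "0 \<le> r" "r < 1" using inner[of 0] n3 e(1) R.h_pos by (auto simp: r_def)
  have Pimg: "P ` {1..n} = R.G ` {..<n}" unfolding idx_img[symmetric] image_image using Pidx(1) by simp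
  have "{x. x < 2 * n \<and> (odd x \<longrightarrow> x div 2 \<in> {..<n})} = {..<2 * n}" by auto
  then have labels: "{..<2 * n} = (\<lambda>i. 2 * i) ` {..<n} \<union> (\<lambda>i. Suc (2 * i)) ` {..<n}"
    using labels_eq[of "{..<n}" n] by simp
  have Wimg: "R.W p ` {..<2 * n} = R.G ` {..<n} \<union> (\<lambda>i. c + p *\<^sub>R (R.M i - c)) ` {..<n}" for p
    unfolding labels by (simp add: image_Un image_image)
  have Aimg: "A ` {1..n} = (\<lambda>i. c + r *\<^sub>R (R.M i - c)) ` {..<n}"
    unfolding idx_img[symmetric] image_image using inner by simp
  have same: "same_order_type (R.W r ` {..<2 * n}) (R.W p ` {..<2 * n})" if p: "r < p" "p < 1" for p
  proof -
    \<comment> \<open>Parameters between \<open>r\<close> and \<open>1\<close> correspond to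
      distances between \<open>0\<close> and \<open>e\<close>, so the stability of the order type
      applies to these inner points.\<close>
    define A' where "A' = (\<lambda>k. c + p *\<^sub>R (midpoint (P k) (P (k mod n + 1)) - c))"
    have A': "A' (idx i) = c + p *\<^sub>R (R.M i - c)" if "i < n" for i using mid[OF that] by (simp add: A'_def)
    have "inner_points n c P ((1 - p) * R.h) A'" unfolding inner_points_def
    proof
      fix k assume "k \<in> {1..n}"
      then obtain i where i: "i < n" "k = idx i" using idx_img by blast
      have "A' k = (1 - p) *\<^sub>R c + p *\<^sub>R R.M i" unfolding i(2) A'[OF i(1)] by (simp add: algebra_simps)
      then have "A' k \<in> closed_segment c (R.M i)" unfolding in_segment using p r by (intro exI[of _ p]) simp
      then show "A' k \<in> closed_segment c (midpoint (P k) (P (k mod n + 1))) \<and>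
        infdist (A' k) (closed_segment (P k) (P (k mod n + 1))) = (1 - p) * R.h"
        using mid[OF i(1)] inf[OF i(1), of p] p A'[OF i(1)] i(2) by simp
    qed
    moreover have "0 < (1 - p) * R.h" using p R.h_pos by simp
    moreover have "(1 - p) * R.h < e"
    proof -
      have "(1 - p) * R.h < (1 - r) * R.h" using p R.h_pos by simp
      also have "\<dots> = e" using R.h_pos by (simp add: r_def)
      finally show ?thesis .
    qed
    ultimately have "same_order_type (P ` {1..n} \<union> A ` {1..n}) (P ` {1..n} \<union> A' ` {1..n})" using stable by blast
    moreover have "A' ` {1..n} = (\<lambda>i. c + p *\<^sub>R (R.M i - c)) ` {..<n}"
      unfolding idx_img[symmetric] image_image using A' by simp
    ultimately show ?thesis unfolding Wimg Pimg Aimg by simp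
  qed
  define J where "J = {i. i < n \<and> c + r *\<^sub>R (R.M i - c) \<in> I'}"
  have "I' = (\<lambda>i. c + r *\<^sub>R (R.M i - c)) ` J" using assms(3) unfolding Aimg J_def by auto
  moreover have "universal (R.G ` {..<n} \<union> (\<lambda>i. c + r *\<^sub>R (R.M i - c)) ` J)"
    by (rule R.universal_double_circle[OF r _ same]) (auto simp: J_def)
  ultimately show ?thesis using Pimg by simp
qed

end
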